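(* The following are equalities of sets in $\mathbb{R}^{20}/\mathbb{R}\mathbf{1}$, and the common set is a balanced fan of pure dimension $8$: $$\mathrm{trop}(\mathrm{SGr}(3,6))=\mathrm{trop}(\mathrm{Gr}(3,6))^{\mathrm{sd}}=\mathrm{Dr}(3,6)^{\mathrm{sd}}.$$ This tropical variety is linearly isomorphic to the tropical Grassmannian $\mathrm{trop}(\mathrm{Gr}(2,6))\subset\mathbb{R}^{15}/\mathbb{R}\mathbf{1}$: the linear map $q\mapsto (q_{ij}+q_{ik}+q_{jk})_{ijk}$ (indexed by $3$-subsets $\{i<j<k\}$ of $[6]$) maps $\mathrm{trop}(\mathrm{Gr}(2,6))$ onto it. Modulo lineality spaces one obtains the $3$-dimensional pointed fan $$\mathrm{trop}(\mathcal{R}(2,6))=\mathrm{trop}(\mathcal{S}(3))=\mathrm{trop}(\mathcal{R}(3,6))^{\mathrm{sd}},$$ which is the fan over a $2$-dimensional simplicial complex with $f$-vector $(25,105,105)$. (All fans are taken with their unique coarsest fan structure.)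
   Context: Work over the field $K=\mathbb{C}\{\!\{t\}\!\}$ of Puiseux series with the $t$-adic valuation. $\mathrm{Gr}(n,2n)\subset\mathbb{P}^{\binom{2n}{n}-1}$ has Plücker coordinates $p_I$, $I\in\binom{[2n]}{n}$; $\mathrm{Gr}(n,2n)^o$ is the open subset where all $p_I\neq0$, and the torus $(K^* )^{2n}$ acts by $p_{i_1\cdots i_n}\mapsto\lambda_{i_1}\cdots\lambda_{i_n}p_{i_1\cdots i_n}$. The Hodge star is $p^*_{I^c}=\mathrm{sign}(I,I^c)\,p_I$, where $I^c=[2n]\setminus I$ and $\mathrm{sign}(I,I^c)$ is the sign of the permutation sending $(1,\dots,2n)$ to the concatenation of $I$ and $I^c$ (each increasing). A point $p\in\mathrm{Gr}(n,2n)$ is self-dual if $p^*=\lambda p$ for some $\lambda\in(K^* )^{2n}$; $\mathrm{SGr}(n,2n)$ is the subvariety of self-dual points, $\mathrm{SGr}(n,2n)^o=\mathrm{SGr}(n,2n)\cap\mathrm{Gr}(n,2n)^o$, $\mathcal{R}(n,2n)=\mathrm{Gr}(n,2n)^o/(K^* )^{2n}$, and $\mathcal{S}(n)=\mathrm{SGr}(n,2n)^o/(K^* )^{2n}$. The tropical Grassmannian $\mathrm{trop}(\mathrm{Gr}(n,2n))$ and $\mathrm{trop}(\mathrm{SGr}(n,2n))$ are the tropicalizations of $\mathrm{Gr}(n,2n)^o$ and $\mathrm{SGr}(n,2n)^o$ in $\mathbb{R}^{\binom{2n}{n}}/\mathbb{R}\mathbf{1}$; $\mathrm{trop}(\mathcal{R}(n,2n))$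 and $\mathrm{trop}(\mathcal{S}(n))$ are their quotients by the lineality space $L=\{(\sum_{i\in I}\mu_i)_I:\mu\in\mathbb{R}^{2n}\}$. The Dressian $\mathrm{Dr}(n,2n)$ is the set of valuated matroids, i.e. vectors $q$ satisfying the tropical quadratic Plücker relations (the minimum in each is attained at least twice). For tropical coordinates define $q^*_I=q_{I^c}$; $q$ is self-dual if $q-q^*\in L$, i.e. $q$ lies in the linear space $L_{\mathrm{sd}}(n,2n)$ spanned by $L$ and the vectors $e_I+e_{I^c}$. The superscript $\mathrm{sd}$ denotes intersection with $L_{\mathrm{sd}}(n,2n)$ (respectively with $L_{\mathrm{sd}}(n,2n)/L$ for the quotient spaces). *)

theory Defs
  imports
    "HOL-Analysis.Analysis"
    "HOL-Computational_Algebra.Formal_Laurent_Series"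
    "HOL-Combinatorics.Permutations"
    "HOL-Library.Numeral_Type"
begin

section \<open>Complex Puiseux series\<close>

text \<open>
  The pair \<open>(m, f)\<close> with \<open>m > 0\<close> stands for the Puiseux series \<open>f(t\<^bsup>1/m\<^esup>)\<close>, so
  \<open>(m, f)\<close> and \<open>(n, g)\<close> agree iff \<open>f(s\<^sup>n) = g(s\<^sup>m)\<close>, where \<open>s = t\<^bsup>1/(m n)\<^esup>\<close>.
\<close>

definition puiseux_rel :: "nat \<times> complex fls \<Rightarrow> nat \<times> complex fls \<Rightarrow> bool" where
  "puiseux_rel = (\<lambda>(m, f) (n, g). m > 0 \<and> n > 0 \<and> fls_compose_power f n = fls_compose_power g m)"

lemma fls_compose_power_compose:
  assumes "a > 0" "b > 0"
  shows "fls_compose_power (fls_compose_power f a) b = fls_compose_power f (a * b)"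
proof (rule fls_eqI)
  fix n :: int
  show "fls_nth (fls_compose_power (fls_compose_power f a) b) n = fls_nth (fls_compose_power f (a * b)) n"
  proof (cases "int b dvd n")
    case True
    then obtain k where k: "n = int b * k" by auto
    have "int (a * b) dvd n \<longleftrightarrow> int a dvd k" using assms k by (auto simp: mult.commute)
    moreover have "n div int b = k" using assms k by simp
    moreover have "n div int (a * b) = k div int a" using assms k by (simp add: mult.commute)
    ultimately show ?thesis using assms True by (simp add: fls_nth_compose_power)
  next
    case False
    hence "\<not> int (a * b) dvd n" by (metis dvd_mult_right of_nat_mult)
    thus ?thesis using assms False by (simp add: fls_nth_compose_power)
  qed
qed

lemma fls_compose_power_inject:
  assumes "d > 0" "fls_compose_power f d = fls_compose_power g d"
  shows "f = g"
proof (rule fls_eqI)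
  fix n :: int
  have "fls_nth (fls_compose_power f d) (int d * n) = fls_nth (fls_compose_power g d) (int d * n)"
    using assms(2) by simp
  thus "fls_nth f n = fls_nth g n" using assms(1) by (simp add: fls_nth_compose_power)
qed

lemma fls_compose_power_one [simp]: "fls_compose_power f (Suc 0) = f"
  by (rule fls_eqI) (simp add: fls_nth_compose_power)

lemma fls_compose_power_inverse:
  fixes f :: "'a :: field fls"
  assumes "d > 0"
  shows "fls_compose_power (inverse f) d = inverse (fls_compose_power f d)"
proof (cases "f = 0")
  case False
  have "fls_compose_power f d * fls_compose_power (inverse f) d = fls_compose_power (f * inverse f) d"
    by simp
  also have "\<dots> = 1" using False assms by simp
  finally show ?thesis by (metis inverse_unique)
qed simp

lemma fls_compose_power_eq_0_iff:
  assumes "d > 0"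
  shows "fls_compose_power f d = 0 \<longleftrightarrow> f = 0"
  using fls_compose_power_inject[OF assms, of f 0] by auto

lemma fls_subdegree_compose_power:
  assumes "d > 0"
  shows "fls_subdegree (fls_compose_power f d) = int d * fls_subdegree f"
proof (cases "f = 0")
  case False
  show ?thesis
  proof (rule fls_subdegree_eqI)
    show "fls_nth (fls_compose_power f d) (int d * fls_subdegree f) \<noteq> 0"
      using assms False by (simp add: fls_nth_compose_power)
    fix k assume k: "k < int d * fls_subdegree f"
    show "fls_nth (fls_compose_power f d) k = 0"
    proof (cases "int d dvd k")
      case True
      then obtain j where "k = int d * j" by auto
      with k assms show ?thesis by (simp add: fls_nth_compose_power)
    qed (use assms in \<open>simp add: fls_nth_compose_power\<close>)
  qed
qed simp

quotient_type puiseux = "nat \<times> complex fls" / partial: puiseux_rel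
proof (rule part_equivpI)
  show "\<exists>x. puiseux_rel x x"
    by (rule exI[of _ "(1, 0)"]) (simp add: puiseux_rel_def)
  show "symp puiseux_rel"
    by (auto simp: symp_def puiseux_rel_def)
  show "transp puiseux_rel"
  proof (rule transpI, clarsimp simp: puiseux_rel_def)
    fix m n p :: nat and f g h :: "complex fls"
    assume *: "m > 0" "n > 0" "p > 0"
      "fls_compose_power f n = fls_compose_power g m" "fls_compose_power g p = fls_compose_power h n"
    have comm: "fls_compose_power (fls_compose_power k a) b = fls_compose_power (fls_compose_power k b) a"
      if "a > 0" "b > 0" for k :: "complex fls" and a b
      using that by (simp add: fls_compose_power_compose mult.commute)
    have "fls_compose_power (fls_compose_power f p) n = fls_compose_power (fls_compose_power g p) m"
      using * comm by metis
    also have "\<dots> = fls_compose_power (fls_compose_power h m) n"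
      using * comm by metis
    finally show "fls_compose_power f p = fls_compose_power h m"
      using * fls_compose_power_inject by blast
  qed
qed

lemma puiseux_rel_scale:
  assumes "puiseux_rel (m, f) (m', f')" "a > 0"
  shows "fls_compose_power f (m' * a) = fls_compose_power f' (m * a)"
  using assms by (auto simp: puiseux_rel_def simp flip: fls_compose_power_compose)

instantiation puiseux :: field
begin

lift_definition zero_puiseux :: puiseux is "(1, 0)"
  by (simp add: puiseux_rel_def)

lift_definition one_puiseux :: puiseux is "(1, 1)"
  by (simp add: puiseux_rel_def)

lift_definition plus_puiseux :: "puiseux \<Rightarrow> puiseux \<Rightarrow> puiseux" is
  "\<lambda>(m, f) (n, g). (m * n, fls_compose_power f n + fls_compose_power g m)"
  apply (clarsimp simp: puiseux_rel_def fls_compose_power_compose)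
  subgoal for m f m' f' n g n' g'
    using puiseux_rel_scale[of m f m' f' "n * n'"] puiseux_rel_scale[of n g n' g' "m * m'"]
    by (simp add: puiseux_rel_def mult_ac)
  done

lift_definition times_puiseux :: "puiseux \<Rightarrow> puiseux \<Rightarrow> puiseux" is
  "\<lambda>(m, f) (n, g). (m * n, fls_compose_power f n * fls_compose_power g m)"
  apply (clarsimp simp: puiseux_rel_def fls_compose_power_compose)
  subgoal for m f m' f' n g n' g'
    using puiseux_rel_scale[of m f m' f' "n * n'"] puiseux_rel_scale[of n g n' g' "m * m'"]
    by (simp add: puiseux_rel_def mult_ac)
  done

lift_definition uminus_puiseux :: "puiseux \<Rightarrow> puiseux" is "\<lambda>(m, f). (m, - f)"
  by (clarsimp simp: puiseux_rel_def)

lift_definition inverse_puiseux :: "puiseux \<Rightarrow> puiseux" is "\<lambda>(m, f). (m, inverse f)"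
  by (clarsimp simp: puiseux_rel_def fls_compose_power_inverse)

definition minus_puiseux :: "puiseux \<Rightarrow> puiseux \<Rightarrow> puiseux" where
  "minus_puiseux x y = x + (- y)"

definition divide_puiseux :: "puiseux \<Rightarrow> puiseux \<Rightarrow> puiseux" where
  "divide_puiseux x y = x * inverse y"

instance
proof
  fix a b c :: puiseux
  show "a * b * c = a * (b * c)"
    by transfer (clarsimp simp: puiseux_rel_def fls_compose_power_compose mult_ac)
  show "a * b = b * a"
    by transfer (clarsimp simp: puiseux_rel_def fls_compose_power_compose mult_ac)
  show "1 * a = a"
    by transfer (clarsimp simp: puiseux_rel_def fls_compose_power_compose)
  show "a + b + c = a + (b + c)"
    by transfer (clarsimp simp: puiseux_rel_def fls_compose_power_compose mult_ac add_ac)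
  show "a + b = b + a"
    by transfer (clarsimp simp: puiseux_rel_def fls_compose_power_compose mult_ac add_ac)
  show "0 + a = a"
    by transfer (clarsimp simp: puiseux_rel_def fls_compose_power_compose)
  show "- a + a = 0"
    by transfer (clarsimp simp: puiseux_rel_def fls_compose_power_compose)
  show "a - b = a + - b"
    by (simp add: minus_puiseux_def)
  show "(a + b) * c = a * c + b * c"
    by transfer (clarsimp simp: puiseux_rel_def fls_compose_power_compose algebra_simps)
  show "(0 :: puiseux) \<noteq> 1"
    by transfer (simp add: puiseux_rel_def)
  show "inverse a * a = 1" if "a \<noteq> 0"
    using that
    by transfer
      (auto simp: puiseux_rel_def fls_compose_power_compose fls_compose_power_inverse
        fls_compose_power_eq_0_iff)
  show "a div b = a * inverse b"
    by (simp add: divide_puiseux_def)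
  show "inverse (0 :: puiseux) = 0"
    by transfer (simp add: puiseux_rel_def)
qed

end

text \<open>The \<open>t\<close>-adic valuation; its value at \<open>0\<close> is the junk value \<open>0\<close>.\<close>

lift_definition puiseux_val :: "puiseux \<Rightarrow> real" is
  "\<lambda>(m, f). of_int (fls_subdegree f) / of_nat m"
proof (clarsimp simp: puiseux_rel_def)
  fix m n :: nat and f g :: "complex fls"
  assume *: "m > 0" "n > 0" "fls_compose_power f n = fls_compose_power g m"
  hence "int n * fls_subdegree f = int m * fls_subdegree g"
    by (metis fls_subdegree_compose_power)
  hence "real n * of_int (fls_subdegree f) = real m * of_int (fls_subdegree g)"
    by (metis of_int_mult of_int_of_nat_eq)
  thus "of_int (fls_subdegree f) / real m = of_int (fls_subdegree g) / real n"
    using * by (simp add: field_simps)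
qed


section \<open>Index types and ambient spaces\<close>

text \<open>
  The \<open>k\<close>-subsets of \<open>[n] = {1, \<dots>, n}\<close>, with \<open>k\<close> and \<open>n\<close> the cardinalities of the type
  arguments. Only \<open>k \<le> n\<close> is of interest; the minimum keeps the type inhabited otherwise.
\<close>

typedef ('k, 'n) ksub =
  "{S :: nat set. S \<subseteq> {1..CARD('n)} \<and> card S = min CARD('k) CARD('n)}"
  morphisms elems Ksub
  by (rule exI[of _ "{1..min CARD('k) CARD('n)}"]) auto

setup_lifting type_definition_ksub

instance ksub :: (type, type) finite
proof
  have "elems ` (UNIV :: ('a, 'b) ksub set) \<subseteq> Pow {1..CARD('b)}"
    using elems by blast
  hence "finite (elems ` (UNIV :: ('a, 'b) ksub set))"
    by (rule finite_subset) simp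
  thus "finite (UNIV :: ('a, 'b) ksub set)"
    by (rule finite_imageD) (simp add: inj_on_def elems_inject)
qed

lemma finite_elems [simp]: "finite (elems I)"
  using elems[of I] finite_subset by auto

lemma card_elems: "card (elems (I :: ('k, 'n) ksub)) = min CARD('k) CARD('n)"
  using elems[of I] by auto

text \<open>As \<open>CARD('k bit0) = 2 * CARD('k)\<close>, the \<open>n\<close>-subsets of \<open>[2n]\<close> are the type \<open>('k, 'k bit0) ksub\<close>.\<close>

lift_definition ksub_compl :: "('k :: finite, 'k bit0) ksub \<Rightarrow> ('k, 'k bit0) ksub" is
  "\<lambda>S. {1..CARD('k bit0)} - S"
  by (auto simp: card_Diff_subset finite_subset[of _ "{1.._}"])

definition ones_line :: "(real ^ 'i) set" where
  "ones_line = range (\<lambda>c. \<chi> i. c)"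

definition lineality :: "(real ^ ('k, 'n) ksub) set" where
  "lineality = range (\<lambda>\<mu> :: nat \<Rightarrow> real. \<chi> I. \<Sum>i\<in>elems I. \<mu> i)"

lemma subspace_ones_line: "subspace ones_line"
proof (rule subspaceI)
  show "0 \<in> ones_line"
    unfolding ones_line_def by (rule image_eqI[of _ _ 0]) (auto simp: vec_eq_iff)
  show "x + y \<in> ones_line" if "x \<in> ones_line" "y \<in> ones_line" for x y :: "real ^ 'i"
  proof -
    from that obtain a b where "x = (\<chi> i. a)" "y = (\<chi> i. b)" by (auto simp: ones_line_def)
    thus ?thesis
      unfolding ones_line_def by (intro image_eqI[of _ _ "a + b"]) (auto simp: vec_eq_iff)
  qed
  show "c *\<^sub>R x \<in> ones_line" if "x \<in> ones_line" for c and x :: "real ^ 'i"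
  proof -
    from that obtain a where "x = (\<chi> i. a)" by (auto simp: ones_line_def)
    thus ?thesis
      unfolding ones_line_def by (intro image_eqI[of _ _ "c * a"]) (auto simp: vec_eq_iff)
  qed
qed

lemma subspace_lineality: "subspace lineality"
proof (rule subspaceI)
  show "0 \<in> lineality"
    unfolding lineality_def by (rule image_eqI[of _ _ "\<lambda>_. 0"]) (auto simp: vec_eq_iff)
  show "x + y \<in> lineality" if "x \<in> lineality" "y \<in> lineality"
    for x y :: "real ^ ('k, 'n) ksub"
  proof -
    from that obtain a b where "x = (\<chi> I. \<Sum>i\<in>elems I. a i)" "y = (\<chi> I. \<Sum>i\<in>elems I. b i)"
      by (auto simp: lineality_def)
    thus ?thesis
      unfolding lineality_def
      by (intro image_eqI[of _ _ "\<lambda>i. a i + b i"]) (auto simp: vec_eq_iff sum.distrib)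
  qed
  show "c *\<^sub>R x \<in> lineality" if "x \<in> lineality" for c and x :: "real ^ ('k, 'n) ksub"
  proof -
    from that obtain a where "x = (\<chi> I. \<Sum>i\<in>elems I. a i)" by (auto simp: lineality_def)
    thus ?thesis
      unfolding lineality_def
      by (intro image_eqI[of _ _ "\<lambda>i. c * a i"]) (auto simp: vec_eq_iff sum_distrib_left)
  qed
qed

lemma ones_line_subset_lineality: "(ones_line :: (real ^ ('k :: finite, 'n :: finite) ksub) set) \<subseteq> lineality"
proof
  fix x :: "real ^ ('k, 'n) ksub"
  assume "x \<in> ones_line"
  then obtain c where "x = (\<chi> i. c)" by (auto simp: ones_line_def)
  moreover have "min CARD('k) CARD('n) \<noteq> 0" by (simp add: min_def)
  ultimately show "x \<in> lineality"
    unfolding lineality_def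
    by (intro image_eqI[of _ _ "\<lambda>_. c / real (min CARD('k) CARD('n))"])
      (auto simp: vec_eq_iff card_elems)
qed

lemma equivp_mod_subspace:
  assumes "subspace U"
  shows "equivp (\<lambda>x y. x - y \<in> U)"
proof (rule equivpI)
  show "reflp (\<lambda>x y. x - y \<in> U)"
    using assms by (simp add: reflp_def subspace_0)
  show "symp (\<lambda>x y. x - y \<in> U)"
  proof (rule sympI)
    fix x y assume "x - y \<in> U"
    thus "y - x \<in> U" using subspace_neg[OF assms, of "x - y"] by simp
  qed
  show "transp (\<lambda>x y. x - y \<in> U)"
  proof (rule transpI)
    fix x y z assume "x - y \<in> U" "y - z \<in> U"
    thus "x - z \<in> U" using subspace_add[OF assms, of "x - y" "y - z"] by simp
  qed
qed

text \<open>\<open>'i tpt\<close> is \<open>\<real>\<^sup>i / \<real>1\<close>, and \<open>('k, 'n) tmod\<close> is the quotient by the lineality space \<open>L\<close>.\<close>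

quotient_type (overloaded) 'i tpt = "real ^ ('i :: finite)" / "\<lambda>x y. x - y \<in> ones_line"
  by (rule equivp_mod_subspace) (rule subspace_ones_line)

quotient_type (overloaded) ('k, 'n) tmod = "real ^ ('k, 'n) ksub" / "\<lambda>x y. x - y \<in> lineality"
  by (rule equivp_mod_subspace) (rule subspace_lineality)

lemma mod_subspace_add:
  assumes "subspace U" "x - x' \<in> U" "y - y' \<in> U"
  shows "(x + y) - (x' + y') \<in> U"
  using subspace_add[OF assms] by (simp add: algebra_simps)

lemma mod_subspace_diff:
  assumes "subspace U" "x - x' \<in> U" "y - y' \<in> U"
  shows "(x - y) - (x' - y') \<in> U"
  using subspace_diff[OF assms] by (simp add: algebra_simps)

lemma mod_subspace_neg:
  assumes "subspace U" "x - x' \<in> U"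
  shows "(- x) - (- x') \<in> U"
  using subspace_neg[OF assms] by (simp add: algebra_simps)

lemma mod_subspace_scale:
  assumes "subspace U" "x - x' \<in> U"
  shows "c *\<^sub>R x - c *\<^sub>R x' \<in> U"
  using subspace_scale[OF assms, of c] by (simp add: algebra_simps)

instantiation tpt :: (finite) real_vector
begin

lift_definition zero_tpt :: "'a tpt" is 0 .
lift_definition plus_tpt :: "'a tpt \<Rightarrow> 'a tpt \<Rightarrow> 'a tpt" is "(+)"
  by (rule mod_subspace_add[OF subspace_ones_line])
lift_definition minus_tpt :: "'a tpt \<Rightarrow> 'a tpt \<Rightarrow> 'a tpt" is "(-)"
  by (rule mod_subspace_diff[OF subspace_ones_line])
lift_definition uminus_tpt :: "'a tpt \<Rightarrow> 'a tpt" is uminus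
  by (rule mod_subspace_neg[OF subspace_ones_line])
lift_definition scaleR_tpt :: "real \<Rightarrow> 'a tpt \<Rightarrow> 'a tpt" is scaleR
  by (rule mod_subspace_scale[OF subspace_ones_line])

instance
  by standard (transfer; simp add: algebra_simps subspace_0[OF subspace_ones_line])+

end

instantiation tmod :: (type, type) real_vector
begin

lift_definition zero_tmod :: "('a, 'b) tmod" is 0 .
lift_definition plus_tmod :: "('a, 'b) tmod \<Rightarrow> ('a, 'b) tmod \<Rightarrow> ('a, 'b) tmod" is "(+)"
  by (rule mod_subspace_add[OF subspace_lineality])
lift_definition minus_tmod :: "('a, 'b) tmod \<Rightarrow> ('a, 'b) tmod \<Rightarrow> ('a, 'b) tmod" is "(-)"
  by (rule mod_subspace_diff[OF subspace_lineality])
lift_definition uminus_tmod :: "('a, 'b) tmod \<Rightarrow> ('a, 'b) tmod" is uminus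
  by (rule mod_subspace_neg[OF subspace_lineality])
lift_definition scaleR_tmod :: "real \<Rightarrow> ('a, 'b) tmod \<Rightarrow> ('a, 'b) tmod" is scaleR
  by (rule mod_subspace_scale[OF subspace_lineality])

instance
  by standard (transfer; simp add: algebra_simps subspace_0[OF subspace_lineality])+

end

lift_definition tpt_proj :: "real ^ 'i \<Rightarrow> ('i :: finite) tpt" is "\<lambda>x :: real ^ 'i. x" .

lift_definition tmod_proj :: "real ^ ('k, 'n) ksub \<Rightarrow> ('k, 'n) tmod" is
  "\<lambda>x :: real ^ ('k, 'n) ksub. x" .

lift_definition mod_lineality :: "('k :: finite, 'n :: finite) ksub tpt \<Rightarrow> ('k, 'n) tmod" is
  "\<lambda>x :: real ^ ('k, 'n) ksub. x"
  using ones_line_subset_lineality by blast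

definition int_lattice :: "('i :: finite) tpt set" where
  "int_lattice = tpt_proj ` {x. \<forall>i. x $ i \<in> \<int>}"


section \<open>Tropicalization\<close>

text \<open>
  A Laurent polynomial over the Puiseux series in variables indexed by \<open>'i\<close> is given by its
  coefficient function on exponent vectors, which must have finite support.
\<close>

definition laurent_supp :: "(('i \<Rightarrow> int) \<Rightarrow> puiseux) \<Rightarrow> ('i \<Rightarrow> int) set" where
  "laurent_supp f = {u. f u \<noteq> 0}"

definition laurent_eval :: "(('i :: finite \<Rightarrow> int) \<Rightarrow> puiseux) \<Rightarrow> ('i \<Rightarrow> puiseux) \<Rightarrow> puiseux" where
  "laurent_eval f x = (\<Sum>u\<in>laurent_supp f. f u * (\<Prod>i\<in>UNIV. x i powi u i))"

definition min_attained_twice :: "'b set \<Rightarrow> ('b \<Rightarrow> real) \<Rightarrow> bool" where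
  "min_attained_twice A h \<longleftrightarrow>
     (\<exists>a\<in>A. \<exists>b\<in>A. a \<noteq> b \<and> (\<forall>c\<in>A. h a \<le> h c) \<and> (\<forall>c\<in>A. h b \<le> h c))"

definition trop_hypersurface :: "(('i :: finite \<Rightarrow> int) \<Rightarrow> puiseux) \<Rightarrow> (real ^ 'i) set" where
  "trop_hypersurface f =
     {w. min_attained_twice (laurent_supp f)
           (\<lambda>u. puiseux_val (f u) + (\<Sum>i\<in>UNIV. of_int (u i) * w $ i))}"

text \<open>The intersection of the tropical hypersurfaces of all Laurent polynomials in the ideal of \<open>X\<close>.\<close>

definition tropicalization :: "('i :: finite \<Rightarrow> puiseux) set \<Rightarrow> (real ^ 'i) set" where
  "tropicalization X =
     (\<Inter>f\<in>{f. finite (laurent_supp f) \<and> laurent_supp f \<noteq> {} \<and> (\<forall>x\<in>X. laurent_eval f x = 0)}.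
        trop_hypersurface f)"


section \<open>Grassmannians and self-dual points\<close>

text \<open>
  Points of projective space are given by their nonzero homogeneous coordinate vectors, so all
  sets of points below are the affine cones without the origin.
  The maximal minors of a matrix \<open>M\<close> with rows \<open>0, \<dots>, k - 1\<close> and columns \<open>1, \<dots>, n\<close>:
\<close>

definition plucker :: "(nat \<Rightarrow> nat \<Rightarrow> puiseux) \<Rightarrow> ('k, 'n) ksub \<Rightarrow> puiseux" where
  "plucker M I =
     (let k = card (elems I); cs = sorted_list_of_set (elems I)
      in \<Sum>\<pi> | \<pi> permutes {..<k}. of_int (sign \<pi>) * (\<Prod>i<k. M i (cs ! \<pi> i)))"

definition Gr :: "(('k, 'n) ksub \<Rightarrow> puiseux) set" where
  "Gr = {p. (\<exists>I. p I \<noteq> 0) \<and> (\<exists>M. p = plucker M)}"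

definition Gr_open :: "(('k, 'n) ksub \<Rightarrow> puiseux) set" where
  "Gr_open = {p \<in> Gr. \<forall>I. p I \<noteq> 0}"

definition torus_act :: "(nat \<Rightarrow> puiseux) \<Rightarrow> (('k, 'n) ksub \<Rightarrow> puiseux) \<Rightarrow> ('k, 'n) ksub \<Rightarrow> puiseux" where
  "torus_act lam p I = (\<Prod>i\<in>elems I. lam i) * p I"

definition concat_sign :: "('k :: finite, 'k bit0) ksub \<Rightarrow> int" where
  "concat_sign I =
     sign (\<lambda>j. if j \<in> {1..CARD('k bit0)}
               then (sorted_list_of_set (elems I) @ sorted_list_of_set (elems (ksub_compl I))) ! (j - 1)
               else j)"

definition hodge_star ::
    "(('k :: finite, 'k bit0) ksub \<Rightarrow> puiseux) \<Rightarrow> ('k, 'k bit0) ksub \<Rightarrow> puiseux" where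
  "hodge_star p J = of_int (concat_sign (ksub_compl J)) * p (ksub_compl J)"

text \<open>The factor \<open>c\<close> expresses equality of points in projective space.\<close>

definition self_dual :: "(('k :: finite, 'k bit0) ksub \<Rightarrow> puiseux) \<Rightarrow> bool" where
  "self_dual p \<longleftrightarrow>
     (\<exists>lam c. (\<forall>i\<in>{1..CARD('k bit0)}. lam i \<noteq> 0) \<and> c \<noteq> 0 \<and>
        (\<forall>I. hodge_star p I = c * torus_act lam p I))"

definition SGr :: "(('k :: finite, 'k bit0) ksub \<Rightarrow> puiseux) set" where
  "SGr = {p \<in> Gr. self_dual p}"

definition SGr_open :: "(('k :: finite, 'k bit0) ksub \<Rightarrow> puiseux) set" where
  "SGr_open = SGr \<inter> Gr_open"


section \<open>Tropical Grassmannians, Dressians and self-duality\<close>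

definition trop_Gr :: "('k, 'n) ksub tpt set" where
  "trop_Gr = tpt_proj ` tropicalization Gr_open"

definition trop_SGr :: "('k :: finite, 'k bit0) ksub tpt set" where
  "trop_SGr = tpt_proj ` tropicalization SGr_open"

definition trop_R :: "('k :: finite, 'n :: finite) tmod set" where
  "trop_R = mod_lineality ` trop_Gr"

definition trop_S :: "('k :: finite, 'k bit0) tmod set" where
  "trop_S = mod_lineality ` trop_SGr"

text \<open>
  The quadratic Pluecker relation of \<open>S\<close> and \<open>T\<close> is
  \<open>\<Sum>j\<in>T-S. \<plusminus> p\<^bsub>S\<union>j\<^esub> p\<^bsub>T-j\<^esub> = 0\<close>, where \<open>card S = k - 1\<close> and \<open>card T = k + 1\<close>.
\<close>

definition Dressian :: "('k, 'n) ksub tpt set" where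
  "Dressian = tpt_proj ` {q :: real ^ ('k, 'n) ksub.
     \<forall>S T. S \<subseteq> {1..CARD('n)} \<and> T \<subseteq> {1..CARD('n)} \<and>
           card S + 1 = CARD('k) \<and> card T = CARD('k) + 1 \<longrightarrow>
       min_attained_twice (T - S) (\<lambda>j. q $ Ksub (insert j S) + q $ Ksub (T - {j}))}"

definition L_sd :: "(real ^ ('k :: finite, 'k bit0) ksub) set" where
  "L_sd = span (lineality \<union> range (\<lambda>I. axis I 1 + axis (ksub_compl I) 1))"

definition sd_tpt :: "('k :: finite, 'k bit0) ksub tpt set \<Rightarrow> ('k, 'k bit0) ksub tpt set" where
  "sd_tpt X = X \<inter> tpt_proj ` L_sd"

definition sd_tmod :: "('k :: finite, 'k bit0) tmod set \<Rightarrow> ('k, 'k bit0) tmod set" where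
  "sd_tmod X = X \<inter> tmod_proj ` L_sd"

lemma ksub_compl_ksub_compl [simp]: "ksub_compl (ksub_compl I) = I"
  by transfer auto

lemma mem_L_sd_iff: "q \<in> L_sd \<longleftrightarrow> q - (\<chi> I. q $ ksub_compl I) \<in> lineality"
proof
  let ?star = "\<lambda>q :: real ^ ('a, 'a bit0) ksub. \<chi> I. q $ ksub_compl I"
  have lin: "linear (\<lambda>q. q - ?star q)"
    by (rule linearI) (auto simp: vec_eq_iff algebra_simps)
  have sub: "subspace {q. q - ?star q \<in> lineality}"
    using linear_subspace_vimage[OF lin subspace_lineality] by (simp add: vimage_def)
  have sub1: "lineality \<subseteq> {q. q - ?star q \<in> lineality}"
  proof
    fix x :: "real ^ ('a, 'a bit0) ksub"
    assume x: "x \<in> lineality"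
    then obtain \<mu> where \<mu>: "x = (\<chi> I. \<Sum>i\<in>elems I. \<mu> i)" by (auto simp: lineality_def)
    have "x $ I + x $ ksub_compl I = sum \<mu> {1..CARD('a bit0)}" for I
      using elems[of I] sum.subset_diff[of "elems I" "{1..CARD('a bit0)}" \<mu>]
      by (simp add: \<mu> ksub_compl.rep_eq add.commute)
    hence "?star x = (\<chi> i. sum \<mu> {1..CARD('a bit0)}) - x"
      by (simp add: vec_eq_iff eq_diff_eq add.commute)
    moreover have "(\<chi> i. sum \<mu> {1..CARD('a bit0)}) \<in> (lineality :: (real ^ ('a, 'a bit0) ksub) set)"
      using ones_line_subset_lineality by (auto simp: ones_line_def)
    ultimately have "?star x \<in> lineality" by (simp add: subspace_diff[OF subspace_lineality] x)
    thus "x \<in> {q. q - ?star q \<in> lineality}" by (simp add: subspace_diff[OF subspace_lineality] x)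
  qed
  have sub2: "range (\<lambda>I. axis I 1 + axis (ksub_compl I) 1) \<subseteq> {q. q - ?star q \<in> lineality}"
  proof clarify
    fix I :: "('a, 'a bit0) ksub"
    have eq: "ksub_compl J = I \<longleftrightarrow> J = ksub_compl I" "ksub_compl J = ksub_compl I \<longleftrightarrow> J = I" for J
      by (metis ksub_compl_ksub_compl)+
    have "?star (axis I 1 + axis (ksub_compl I) 1) = axis I 1 + axis (ksub_compl I) 1"
      by (simp add: vec_eq_iff axis_def eq)
    thus "axis I 1 + axis (ksub_compl I) 1 - ?star (axis I 1 + axis (ksub_compl I) 1) \<in> lineality"
      using subspace_0[OF subspace_lineality] by simp
  qed
  assume "q \<in> L_sd"
  hence "q \<in> {q. q - ?star q \<in> lineality}"
    unfolding L_sd_def using span_minimal[OF Un_least[OF sub1 sub2] sub] by (rule rev_subsetD)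
  thus "q - ?star q \<in> lineality" by simp
next
  let ?star = "\<lambda>q :: real ^ ('a, 'a bit0) ksub. \<chi> I. q $ ksub_compl I"
  assume "q - ?star q \<in> lineality"
  hence "(1/2) *\<^sub>R (q - ?star q) \<in> L_sd"
    unfolding L_sd_def by (intro span_scale span_base) auto
  moreover have "q + ?star q = (\<Sum>I\<in>UNIV. (q $ I) *\<^sub>R (axis I 1 + axis (ksub_compl I) 1))"
  proof -
    have "(\<Sum>I\<in>UNIV. if J = ksub_compl I then q $ I else 0) = q $ ksub_compl J" for J
    proof -
      have "(\<lambda>I. J = ksub_compl I) = (\<lambda>I. I = ksub_compl J)"
        by (metis ksub_compl_ksub_compl)
      hence "(\<Sum>I\<in>UNIV. if J = ksub_compl I then q $ I else 0) =
          (\<Sum>I\<in>UNIV. if I = ksub_compl J then q $ I else 0)"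
        by (metis (mono_tags))
      thus ?thesis by simp
    qed
    moreover have "c * (if P then 1 else 0) = (if P then c else 0)" for c :: real and P
      by simp
    ultimately show ?thesis
      by (simp add: vec_eq_iff axis_def distrib_left sum.distrib)
  qed
  hence "(1/2) *\<^sub>R (q + ?star q) \<in> L_sd"
    unfolding L_sd_def by (simp only:) (intro span_scale span_sum span_base UnI2 rangeI)
  ultimately have "(1/2) *\<^sub>R (q - ?star q) + (1/2) *\<^sub>R (q + ?star q) \<in> L_sd"
    unfolding L_sd_def by (rule span_add)
  moreover have "(1/2) *\<^sub>R (q - ?star q) + (1/2) *\<^sub>R (q + ?star q) = q"
    by (simp add: vec_eq_iff field_simps)
  ultimately show "q \<in> L_sd" by simp
qed


section \<open>The linear map from pairs to triples\<close>

definition pairs_to_triples :: "real ^ (2, 6) ksub \<Rightarrow> real ^ (3, 6) ksub" where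
  "pairs_to_triples q = (\<chi> I. \<Sum>J | elems J \<subseteq> elems I. q $ J)"

lemma elems_Ksub_pair:
  assumes "elems (I :: (3, 6) ksub) = {a, b, c}" "a \<noteq> b"
  shows "elems (Ksub {a, b} :: (2, 6) ksub) = {a, b}"
  using assms elems[of I] by (intro Ksub_inverse) auto

lemma pairs_to_triples_nth:
  assumes I: "elems I = {a, b, c}" and ne: "a \<noteq> b" "a \<noteq> c" "b \<noteq> c"
  shows "pairs_to_triples q $ I = q $ Ksub {a, b} + q $ Ksub {a, c} + q $ Ksub {b, c}"
proof -
  have perm: "elems I = {a, c, b}" "elems I = {b, c, a}" using I by auto
  note el = elems_Ksub_pair[OF I ne(1)] elems_Ksub_pair[OF perm(1) ne(2)] elems_Ksub_pair[OF perm(2) ne(3)]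
  have "{J :: (2, 6) ksub. elems J \<subseteq> elems I} = {Ksub {a, b}, Ksub {a, c}, Ksub {b, c}}"
  proof (intro equalityI subsetI)
    fix J :: "(2, 6) ksub"
    assume "J \<in> {J. elems J \<subseteq> elems I}"
    hence sub: "elems J \<subseteq> {a, b, c}" using I by simp
    obtain x y where "elems J = {x, y}" "x \<noteq> y"
      using card_elems[of J] by (auto simp: card_2_iff)
    with sub have "elems J \<in> {{a, b}, {a, c}, {b, c}}" by auto
    thus "J \<in> {Ksub {a, b}, Ksub {a, c}, Ksub {b, c}}"
      by (metis elems_inverse insert_iff singletonD)
  qed (use el I in auto)
  moreover have "(Ksub {a, b} :: (2, 6) ksub) \<noteq> Ksub {a, c}" "(Ksub {a, b} :: (2, 6) ksub) \<noteq> Ksub {b, c}"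
      "(Ksub {a, c} :: (2, 6) ksub) \<noteq> Ksub {b, c}"
    using el ne by (metis doubleton_eq_iff)+
  ultimately show ?thesis by (simp add: pairs_to_triples_def add.assoc)
qed

lemma elems_tripleE:
  obtains a b c where "elems (I :: (3, 6) ksub) = {a, b, c}" "a \<noteq> b" "a \<noteq> c" "b \<noteq> c"
  using card_elems[of I] by (auto simp: card_3_iff)

lemma linear_pairs_to_triples: "linear pairs_to_triples"
  by (rule linearI) (auto simp: pairs_to_triples_def vec_eq_iff sum.distrib sum_distrib_left)

lift_definition pairs_to_triples_tpt :: "(2, 6) ksub tpt \<Rightarrow> (3, 6) ksub tpt" is pairs_to_triples
proof -
  fix x y :: "real ^ (2, 6) ksub"
  assume "x - y \<in> ones_line"
  then obtain c where c: "x - y = (\<chi> i. c)" by (auto simp: ones_line_def)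
  have "pairs_to_triples (x - y) $ I = 3 * c" for I
    by (rule elems_tripleE[of I]) (simp add: pairs_to_triples_nth c)
  hence "pairs_to_triples x - pairs_to_triples y = (\<chi> i. 3 * c)"
    by (simp add: vec_eq_iff linear_diff[OF linear_pairs_to_triples])
  thus "pairs_to_triples x - pairs_to_triples y \<in> ones_line" by (auto simp: ones_line_def)
qed

lift_definition pairs_to_triples_tmod :: "(2, 6) tmod \<Rightarrow> (3, 6) tmod" is pairs_to_triples
proof -
  fix x y :: "real ^ (2, 6) ksub"
  assume "x - y \<in> lineality"
  then obtain \<mu> where \<mu>: "x - y = (\<chi> I. \<Sum>i\<in>elems I. \<mu> i)" by (auto simp: lineality_def)
  have "pairs_to_triples (x - y) $ I = (\<Sum>i\<in>elems I. 2 * \<mu> i)" for I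
  proof (rule elems_tripleE[of I])
    fix a b c assume *: "elems I = {a, b, c}" "a \<noteq> b" "a \<noteq> c" "b \<noteq> c"
    have perm: "elems I = {a, c, b}" "elems I = {b, c, a}" using * by auto
    note el = elems_Ksub_pair[OF *(1,2)] elems_Ksub_pair[OF perm(1) *(3)] elems_Ksub_pair[OF perm(2) *(4)]
    show ?thesis using * by (simp add: pairs_to_triples_nth[OF *] \<mu> el)
  qed
  hence "pairs_to_triples x - pairs_to_triples y = (\<chi> I. \<Sum>i\<in>elems I. 2 * \<mu> i)"
    by (simp add: vec_eq_iff linear_diff[OF linear_pairs_to_triples])
  thus "pairs_to_triples x - pairs_to_triples y \<in> lineality" by (auto simp: lineality_def)
qed


section \<open>Polyhedral fans\<close>

definition polyhedral_cone :: "'a :: real_vector set \<Rightarrow> bool" where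
  "polyhedral_cone C \<longleftrightarrow> (\<exists>S. finite S \<and> C = convex_cone hull S)"

definition fan :: "'a :: real_vector set set \<Rightarrow> bool" where
  "fan F \<longleftrightarrow> finite F \<and> F \<noteq> {} \<and> (\<forall>C\<in>F. polyhedral_cone C) \<and>
     (\<forall>C\<in>F. \<forall>D. D face_of C \<and> D \<noteq> {} \<longrightarrow> D \<in> F) \<and>
     (\<forall>C\<in>F. \<forall>D\<in>F. (C \<inter> D) face_of C \<and> (C \<inter> D) face_of D)"

definition fan_structure :: "'a :: real_vector set \<Rightarrow> 'a set set \<Rightarrow> bool" where
  "fan_structure X F \<longleftrightarrow> fan F \<and> \<Union>F = X"

definition coarsest_fan_structure :: "'a :: real_vector set \<Rightarrow> 'a set set \<Rightarrow> bool" where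
  "coarsest_fan_structure X F \<longleftrightarrow> fan_structure X F \<and>
     (\<forall>G. fan_structure X G \<longrightarrow> (\<forall>D\<in>G. \<exists>C\<in>F. D \<subseteq> C))"

definition maximal_cones :: "'a set set \<Rightarrow> 'a set set" where
  "maximal_cones F = {C \<in> F. \<forall>D\<in>F. C \<subseteq> D \<longrightarrow> D = C}"

definition pure_dim :: "nat \<Rightarrow> 'a :: real_vector set set \<Rightarrow> bool" where
  "pure_dim d F \<longleftrightarrow> (\<forall>C\<in>maximal_cones F. dim C = d)"

definition fan_dim :: "'a :: real_vector set set \<Rightarrow> nat" where
  "fan_dim F = Max (dim ` F)"

definition pointed :: "'a :: real_vector set set \<Rightarrow> bool" where
  "pointed F \<longleftrightarrow> (\<forall>C\<in>F. \<forall>x. x \<in> C \<and> - x \<in> C \<longrightarrow> x = 0)"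

text \<open>
  \<open>u\<close> is a lattice vector in \<open>C\<close> whose class generates the rank one group
  \<open>(\<Lambda> \<inter> span C) / (\<Lambda> \<inter> span T)\<close>, for a facet \<open>T\<close> of \<open>C\<close>.
\<close>

definition primitive_generator ::
    "'a :: real_vector set \<Rightarrow> 'a set \<Rightarrow> 'a set \<Rightarrow> 'a \<Rightarrow> bool" where
  "primitive_generator \<Lambda> T C u \<longleftrightarrow> u \<in> \<Lambda> \<inter> C \<and>
     (\<forall>x\<in>\<Lambda> \<inter> span C. \<exists>z :: int. x - of_int z *\<^sub>R u \<in> \<Lambda> \<inter> span T)"

definition balanced :: "'a :: real_vector set \<Rightarrow> 'a set set \<Rightarrow> bool" where
  "balanced \<Lambda> F \<longleftrightarrow>
     (\<forall>C\<in>F. \<exists>S. finite S \<and> S \<subseteq> \<Lambda> \<and> C = convex_cone hull S) \<and>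
     (\<exists>m :: 'a set \<Rightarrow> nat. (\<forall>C\<in>maximal_cones F. m C > 0) \<and>
        (\<forall>T\<in>F. dim T + 1 = fan_dim F \<longrightarrow>
           (\<exists>u. (\<forall>C\<in>maximal_cones F. T \<subseteq> C \<longrightarrow> primitive_generator \<Lambda> T C (u C)) \<and>
                (\<Sum>C | C \<in> maximal_cones F \<and> T \<subseteq> C. of_nat (m C) *\<^sub>R u C) \<in> span T)))"

text \<open>Abstract simplicial complexes, including the empty face, with vectors as vertices.\<close>

definition abstract_simplicial_complex :: "'a set set \<Rightarrow> bool" where
  "abstract_simplicial_complex K \<longleftrightarrow> finite K \<and> {} \<in> K \<and> (\<forall>s\<in>K. finite s) \<and>
     (\<forall>s\<in>K. \<forall>r. r \<subseteq> s \<longrightarrow> r \<in> K)"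

definition fan_over :: "'a :: real_vector set set \<Rightarrow> 'a set set \<Rightarrow> bool" where
  "fan_over K F \<longleftrightarrow> abstract_simplicial_complex K \<and> (\<forall>s\<in>K. independent s) \<and>
     bij_betw (\<lambda>s. convex_cone hull s) K F"

definition complex_dim :: "'a set set \<Rightarrow> int" where
  "complex_dim K = Max ((\<lambda>s. int (card s) - 1) ` K)"

definition f_vector :: "'a set set \<Rightarrow> nat list" where
  "f_vector K = map (\<lambda>i. card {s \<in> K. card s = i + 1}) [0..<nat (complex_dim K + 1)]"

lemma cone_subset_face:
  assumes F: "F face_of D" and CD: "convex_cone hull S \<subseteq> D" and D: "convex_cone D"
    and fin: "finite S" and x: "\<Sum>S \<in> F" and F': "convex_cone F"
  shows "convex_cone hull S \<subseteq> F"
proof (rule hull_minimal)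
  show "S \<subseteq> F"
  proof
    fix s assume s: "s \<in> S"
    let ?r = "\<Sum>(S - {s})"
    have SD: "s' \<in> D" if "s' \<in> S" for s' using that CD hull_inc[of s' S] by blast
    have r: "?r \<in> D"
    proof -
      have "\<Sum>A \<in> D" if "finite A" "A \<subseteq> S" for A
        using that
        by (induction rule: finite_induct)
          (use D SD in \<open>auto simp: convex_cone_contains_0 intro: convex_cone_add\<close>)
      thus ?thesis using fin by blast
    qed
    have sum: "\<Sum>S = s + ?r" using fin s by (rule sum.remove)
    show "s \<in> F"
    proof (cases "s = ?r")
      case True
      hence "\<Sum>S = 2 *\<^sub>R s" using sum by (simp add: scaleR_2)
      thus ?thesis using x convex_cone_scaleR[OF F', of "1/2" "2 *\<^sub>R s"] by simp
    next
      case False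
      have "\<Sum>S \<in> open_segment (2 *\<^sub>R s) (2 *\<^sub>R ?r)"
        using False sum by (auto simp: in_segment intro!: exI[of _ "1/2"])
      moreover have "2 *\<^sub>R s \<in> D" "2 *\<^sub>R ?r \<in> D" using SD[OF s] r D by (auto intro: convex_cone_scaleR)
      ultimately have "2 *\<^sub>R s \<in> F" using F x unfolding face_of_def by blast
      thus ?thesis using convex_cone_scaleR[OF F', of "1/2" "2 *\<^sub>R s"] by simp
    qed
  qed
qed (rule F')

lemma polyhedral_cone_imp_convex_cone: "polyhedral_cone C \<Longrightarrow> convex_cone C"
  by (auto simp: polyhedral_cone_def convex_cone_convex_cone_hull)

lemma fanD:
  assumes "fan F"
  shows fan_finite: "finite F"
    and fan_polyhedral: "C \<in> F \<Longrightarrow> polyhedral_cone C"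
    and fan_convex_cone: "C \<in> F \<Longrightarrow> convex_cone C"
    and fan_face: "C \<in> F \<Longrightarrow> D face_of C \<Longrightarrow> D \<noteq> {} \<Longrightarrow> D \<in> F"
    and fan_Int1: "C \<in> F \<Longrightarrow> D \<in> F \<Longrightarrow> (C \<inter> D) face_of C"
    and fan_Int2: "C \<in> F \<Longrightarrow> D \<in> F \<Longrightarrow> (C \<inter> D) face_of D"
  using assms polyhedral_cone_imp_convex_cone unfolding fan_def by blast+

lemma coarsest_fan_structure_subset:
  assumes F: "coarsest_fan_structure X F" and G: "coarsest_fan_structure X G"
  shows "F \<subseteq> G"
proof
  fix C assume C: "C \<in> F"
  have fF: "fan F" "\<Union>F = X" and fG: "fan G" "\<Union>G = X"
    using F G unfolding coarsest_fan_structure_def fan_structure_def by blast+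
  have FG: "\<exists>D\<in>G. C \<subseteq> D" if "C \<in> F" for C
    using F G that unfolding coarsest_fan_structure_def by blast
  have GF: "\<exists>D\<in>F. C \<subseteq> D" if "C \<in> G" for C
    using F G that unfolding coarsest_fan_structure_def by blast
  obtain S where S: "finite S" "C = convex_cone hull S"
    using fan_polyhedral[OF fF(1) C] unfolding polyhedral_cone_def by blast
  define x where "x = \<Sum>S"
  have "\<Sum>A \<in> C" if "finite A" "A \<subseteq> S" for A
    using that
    by (induction rule: finite_induct)
      (auto simp: S convex_cone_hull_contains_0 intro: convex_cone_hull_add hull_inc)
  hence xC: "x \<in> C" using S by (simp add: x_def)
  have "finite {D \<in> G. x \<in> D}" using fan_finite[OF fG(1)] by simp
  moreover have "{D \<in> G. x \<in> D} \<noteq> {}" using xC C fF(2) fG(2) by blast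
  ultimately obtain C' where C': "C' \<in> {D \<in> G. x \<in> D}"
    and min: "\<forall>D\<in>{D \<in> G. x \<in> D}. D \<subseteq> C' \<longrightarrow> C' = D"
    using finite_has_minimal[of "{D \<in> G. x \<in> D}"] by blast
  have C'G: "C' \<in> G" "x \<in> C'" using C' by auto
  have face_eq: "D = C'" if D: "D face_of C'" "x \<in> D" for D
  proof -
    have "D \<noteq> {}" using D(2) by blast
    hence "D \<in> G" using fan_face[OF fG(1) C'G(1) D(1)] by blast
    thus ?thesis using min D face_of_imp_subset[OF D(1)] by blast
  qed
  have "C' \<subseteq> C"
  proof -
    obtain C2 where C2: "C2 \<in> F" "C' \<subseteq> C2" using GF[OF C'G(1)] by blast
    note int = fan_Int1[OF fF(1) C C2(1)] fan_Int2[OF fF(1) C C2(1)]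
    have xi: "x \<in> C \<inter> C2" using xC C'G(2) C2(2) by blast
    hence "C \<inter> C2 \<in> F" using fan_face[OF fF(1) C int(1)] by blast
    hence "convex_cone hull S \<subseteq> C \<inter> C2"
      using xi S by (intro cone_subset_face[OF int(1) _ fan_convex_cone[OF fF(1) C] S(1)]
          fan_convex_cone[OF fF(1)]) (auto simp: x_def)
    hence "C \<inter> C2 = C" using S(2) by blast
    hence "C face_of C2" using int(2) by simp
    hence "(C \<inter> C') face_of (C2 \<inter> C')"
      using fan_convex_cone[OF fG(1) C'G(1)] by (intro face_of_slice) (auto simp: convex_cone_def)
    moreover have "C2 \<inter> C' = C'" using C2(2) by blast
    ultimately have "C \<inter> C' = C'" using face_eq C'G(2) xC by simp
    thus ?thesis by blast
  qed
  moreover have "C \<subseteq> C'"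
  proof -
    obtain D where D: "D \<in> G" "C \<subseteq> D" using FG[OF C] by blast
    note int = fan_Int1[OF fG(1) C'G(1) D(1)] fan_Int2[OF fG(1) C'G(1) D(1)]
    have "C' \<inter> D = C'" using face_eq[OF int(1)] D(2) C'G(2) xC by blast
    hence face: "C' face_of D" using int(2) by simp
    have "convex_cone hull S \<subseteq> C'"
      using D(2) S C'G(2)
      by (intro cone_subset_face[OF face _ fan_convex_cone[OF fG(1) D(1)] S(1)]
          fan_convex_cone[OF fG(1) C'G(1)]) (auto simp: x_def)
    thus ?thesis using S(2) by simp
  qed
  ultimately have "C = C'" by blast
  thus "C \<in> G" using C'G(1) by simp
qed

lemma coarsest_fan_structure_unique:
  assumes "coarsest_fan_structure X F" "coarsest_fan_structure X G"
  shows "F = G"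
  using assms coarsest_fan_structure_subset by blast

end

theory Submission
  imports Defs
begin

text \<open>
  Adding a vector of the lineality space, a vector \<open>q\<close> satisfying the four-point condition becomes an
  ultrametric \<open>u\<close> on \<open>{1,\<dots>,5}\<close>, and ultrametrics are nonnegative combinations of the indicators of
  the clusters of a laminar family. Ultrametrics with rational values are the valuations of
  \<open>x\<^sub>i - x\<^sub>j\<close> for suitable Puiseux series \<open>x\<^sub>i\<close>, so the three-term relations cut out
  \<open>trop(Gr(2,6))\<close>. Six points on a conic are self-dual, with \<open>p\<^bsub>ijk\<^esub> = p\<^bsub>ij\<^esub> p\<^bsub>ik\<^esub> p\<^bsub>jk\<^esub>\<close>;
  hence the linear map sends \<open>trop(Gr(2,6))\<close> into \<open>trop(SGr(3,6))\<close>. Conversely a self-dual \<open>w\<close> is the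
  image of a unique \<open>q\<close>, and the three-term relations of \<open>w\<close> are the four-point conditions of \<open>q\<close>.

  The cones of the fan are spanned by the laminar families of subsets of \<open>{1,\<dots>,5}\<close> with two to
  four elements; there are 25, 105 and 105 families of size 1, 2 and 3. Every convex cone in the
  support lies in one of them: on a triangle \<open>abc\<close>, the values of an ultrametric form a point of a
  tropical line, and a convex subset of a tropical line lies in one of its three rays.
\<close>

text \<open>A tropicalization is defined by all Laurent polynomials of an ideal. Here it is caught
  between two bounds: explicit relations with coefficients 1 and -1 bound it from above, valuation
  vectors of actual points from below. Valuations of Puiseux series are rational, so real points
  enter through closedness and approximation.

  The torus element of a self-dual point is unknown and has to be eliminated. Passing to complements
  multiplies \<open>p I * p J\<close>, up to sign, by a factor that depends only on the multiset
  union of \<open>I\<close> and \<open>J\<close>; exchanging an element between the triples thus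
  gives a binomial free of the torus element.

  The sixth point serves as a root at infinity, whence families on five points. A cluster is
  recognised by strict inequalities between values of the ultrametric, whose differences are linear
  functionals vanishing on the lineality space. These functionals yield uniqueness of weights,
  independence of rays, coarseness and integrality; the argument is run once for a general lineality
  space \<open>N\<close> and applied with dimensions 0 and 5, whence 8 = 5 + 3.\<close>

no_notation fps_nth (infixl "$" 75)

section \<open>The valuation on Puiseux series\<close>

definition puiseux_of :: "nat \<Rightarrow> complex fls \<Rightarrow> puiseux" where
  "puiseux_of m f = abs_puiseux (m, f)"

lemma puiseux_of_eq_iff:
  assumes "m > 0" "n > 0"
  shows "puiseux_of m f = puiseux_of n g \<longleftrightarrow> fls_compose_power f n = fls_compose_power g m"
  using assms Quotient_rel[OF Quotient_puiseux, of "(m, f)" "(n, g)"]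
  by (auto simp: puiseux_of_def puiseux_rel_def)

lemma puiseux_exE:
  obtains m f where "m > 0" "x = puiseux_of m f"
proof -
  have *: "puiseux_rel (rep_puiseux x) (rep_puiseux x)"
    using Quotient_rep_reflp[OF Quotient_puiseux] .
  obtain m f where mf: "rep_puiseux x = (m, f)" by (cases "rep_puiseux x")
  have "x = abs_puiseux (m, f)"
    using Quotient_abs_rep[OF Quotient_puiseux, of x] mf by simp
  moreover have "m > 0" using * mf by (auto simp: puiseux_rel_def)
  ultimately show ?thesis using that by (simp add: puiseux_of_def)
qed

lemma puiseux_of_expand:
  assumes "m > 0" "n > 0"
  shows "puiseux_of m f = puiseux_of (m * n) (fls_compose_power f n)"
  using assms by (subst puiseux_of_eq_iff) (auto simp: fls_compose_power_compose mult.commute)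

text \<open>A common denominator of the exponents turns statements about two Puiseux series into
  statements about Laurent series in one variable.\<close>

lemma puiseux_exE2:
  obtains m f g where "m > 0" "x = puiseux_of m f" "y = puiseux_of m g"
proof -
  obtain k f where 1: "k > 0" "x = puiseux_of k f" by (rule puiseux_exE)
  obtain n g where 2: "n > 0" "y = puiseux_of n g" by (rule puiseux_exE)
  show ?thesis
    using that[of "k * n" "fls_compose_power f n" "fls_compose_power g k"] 1 2
      puiseux_of_expand[of k n f] puiseux_of_expand[of n k g] by (simp add: mult.commute)
qed

lemma puiseux_of_0: "m > 0 \<Longrightarrow> puiseux_of m 0 = 0"
  unfolding zero_puiseux_def puiseux_of_def[symmetric]
  by (subst puiseux_of_eq_iff) auto

lemma puiseux_of_1: "m > 0 \<Longrightarrow> puiseux_of m 1 = 1"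
  unfolding one_puiseux_def puiseux_of_def[symmetric]
  by (subst puiseux_of_eq_iff) auto

lemma puiseux_of_eq_0_iff: "m > 0 \<Longrightarrow> puiseux_of m f = 0 \<longleftrightarrow> f = 0"
  using puiseux_of_eq_iff[of m m f 0] fls_compose_power_inject[of m f 0]
  by (auto simp: puiseux_of_0)

lemma puiseux_of_add:
  assumes "m > 0"
  shows "puiseux_of m f + puiseux_of m g = puiseux_of m (f + g)"
proof -
  have "puiseux_of m f + puiseux_of m g =
      puiseux_of (m * m) (fls_compose_power f m + fls_compose_power g m)"
    using plus_puiseux.abs_eq[of "(m, f)" "(m, g)"] assms
    by (simp add: puiseux_of_def puiseux_rel_def eq_onp_def)
  also have "\<dots> = puiseux_of m (f + g)"
    using puiseux_of_expand[of m m "f + g"] assms by simp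
  finally show ?thesis .
qed

lemma puiseux_of_mult:
  assumes "m > 0"
  shows "puiseux_of m f * puiseux_of m g = puiseux_of m (f * g)"
proof -
  have "puiseux_of m f * puiseux_of m g =
      puiseux_of (m * m) (fls_compose_power f m * fls_compose_power g m)"
    using times_puiseux.abs_eq[of "(m, f)" "(m, g)"] assms
    by (simp add: puiseux_of_def puiseux_rel_def eq_onp_def)
  also have "\<dots> = puiseux_of m (f * g)"
    using puiseux_of_expand[of m m "f * g"] assms by simp
  finally show ?thesis .
qed

lemma puiseux_val_of: "m > 0 \<Longrightarrow> puiseux_val (puiseux_of m f) = of_int (fls_subdegree f) / of_nat m"
  using puiseux_val.abs_eq[of "(m, f)"] by (simp add: puiseux_of_def puiseux_rel_def eq_onp_def)

lemma puiseux_val_mult: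
  assumes "x \<noteq> 0" "y \<noteq> 0"
  shows "puiseux_val (x * y) = puiseux_val x + puiseux_val y"
  by (rule puiseux_exE2[of x y])
    (use assms in \<open>auto simp: puiseux_of_mult puiseux_val_of puiseux_of_eq_0_iff add_divide_distrib\<close>)

lemma puiseux_val_add_ge:
  assumes "x + y \<noteq> 0" "x = 0 \<or> puiseux_val x \<ge> r" "y = 0 \<or> puiseux_val y \<ge> r"
  shows "puiseux_val (x + y) \<ge> r"
proof (rule puiseux_exE2[of x y])
  fix m f g assume m: "m > 0" and xy: "x = puiseux_of m f" "y = puiseux_of m g"
  show ?thesis
  proof (cases "f = 0 \<or> g = 0")
    case True
    thus ?thesis using assms xy m by (auto simp: puiseux_of_0)
  next
    case False
    have "f + g \<noteq> 0" using assms(1) xy m by (auto simp: puiseux_of_add puiseux_of_0)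
    hence "min (fls_subdegree f) (fls_subdegree g) \<le> fls_subdegree (f + g)"
      by (rule fls_plus_subdegree)
    moreover have "r * m \<le> fls_subdegree f" "r * m \<le> fls_subdegree g"
      using assms(2,3) False m
      by (auto simp: xy puiseux_val_of puiseux_of_eq_0_iff field_simps)
    ultimately have "r * m \<le> fls_subdegree (f + g)" by linarith
    thus ?thesis using m by (simp add: xy puiseux_of_add puiseux_val_of field_simps)
  qed
qed

lemma puiseux_val_1 [simp]: "puiseux_val 1 = 0"
  using puiseux_val_mult[of 1 1] by simp

lemma puiseux_val_minus [simp]: "puiseux_val (- x) = puiseux_val x"
proof (cases "x = 0")
  case False
  have "puiseux_val ((-1) * (-1)) = puiseux_val (-1) + puiseux_val (-1)"
    by (rule puiseux_val_mult) auto
  hence "puiseux_val (-1) = 0" by simp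
  thus ?thesis using puiseux_val_mult[of "-1" x] False by simp
qed simp

lemma puiseux_val_inverse: "puiseux_val (inverse x) = - puiseux_val x"
proof (cases "x = 0")
  case False
  thus ?thesis using puiseux_val_mult[of x "inverse x"] by simp
next
  case True
  have "puiseux_val 0 = 0" using puiseux_val_of[of 1 0] by (simp add: puiseux_of_0)
  with True show ?thesis by simp
qed

lemma puiseux_val_power: "x \<noteq> 0 \<Longrightarrow> puiseux_val (x ^ n) = of_nat n * puiseux_val x"
  by (induction n) (auto simp: puiseux_val_mult algebra_simps)

lemma puiseux_val_power_int: "x \<noteq> 0 \<Longrightarrow> puiseux_val (x powi k) = of_int k * puiseux_val x"
  by (auto simp: power_int_def puiseux_val_power puiseux_val_inverse)

lemma puiseux_val_prod:
  "(\<And>i. i \<in> A \<Longrightarrow> f i \<noteq> 0) \<Longrightarrow> puiseux_val (\<Prod>i\<in>A. f i) = (\<Sum>i\<in>A. puiseux_val (f i))"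
  by (induction A rule: infinite_finite_induct) (auto simp: puiseux_val_mult)

text \<open>This leads to positive integers being nonzero of valuation 0. They supply the infinitely
  many leading coefficients among which \<open>ultra_realizable\<close> chooses.\<close>

lemma puiseux_of_of_nat: "puiseux_of 1 (of_nat n) = of_nat n"
  by (induction n) (auto simp: puiseux_of_0 puiseux_of_1 simp flip: puiseux_of_add)

lemma puiseux_of_nat_neq_0: "n > 0 \<Longrightarrow> (of_nat n :: puiseux) \<noteq> 0"
  by (simp add: puiseux_of_eq_0_iff flip: puiseux_of_of_nat)

lemma puiseux_val_of_nat: "puiseux_val (of_nat n) = 0"
  unfolding puiseux_of_of_nat[symmetric] by (subst puiseux_val_of) (auto simp: fls_of_nat)

text \<open>The denominator of \<open>r\<close> becomes the ramification index, the numerator the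
  exponent.\<close>

lemma puiseux_val_rational:
  assumes "r \<in> \<rat>"
  obtains x where "x \<noteq> 0" "puiseux_val x = r"
proof -
  from assms obtain a b :: int where "b > 0" "r = of_int a / of_int b"
    by (elim Rats_cases') auto
  hence "puiseux_of (nat b) (fls_X_intpow a) \<noteq> 0" "puiseux_val (puiseux_of (nat b) (fls_X_intpow a)) = r"
    by (auto simp: puiseux_of_eq_0_iff puiseux_val_of)
  thus ?thesis using that by blast
qed

section \<open>Sums and terms of smallest valuation\<close>

lemma puiseux_val_add_gt:
  assumes "x + y \<noteq> 0" "x = 0 \<or> puiseux_val x > r" "y = 0 \<or> puiseux_val y > r"
  shows "puiseux_val (x + y) > r"
proof -
  define s where "s = (if x = 0 then puiseux_val y else if y = 0 then puiseux_val x
    else min (puiseux_val x) (puiseux_val y))"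
  have "puiseux_val (x + y) \<ge> s" by (rule puiseux_val_add_ge) (use assms in \<open>auto simp: s_def\<close>)
  moreover have "s > r" using assms by (auto simp: s_def)
  ultimately show ?thesis by linarith
qed

lemma puiseux_val_sum_gt:
  assumes "\<And>i. i \<in> A \<Longrightarrow> f i = 0 \<or> puiseux_val (f i) > r" "(\<Sum>i\<in>A. f i) \<noteq> 0"
  shows "puiseux_val (\<Sum>i\<in>A. f i) > r"
  using assms
proof (induction A rule: infinite_finite_induct)
  case (insert a A)
  have "puiseux_val (f a + sum f A) > r"
    by (rule puiseux_val_add_gt) (use insert in auto)
  thus ?case using insert by simp
qed auto

text \<open>A term of strictly smallest valuation cannot be cancelled. The upper bound comes from
  recovering \<open>x\<close> as \<open>(x + y) + (- y)\<close>.\<close>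

lemma puiseux_val_add_eq:
  assumes "x \<noteq> 0" "y = 0 \<or> puiseux_val x < puiseux_val y"
  shows "x + y \<noteq> 0" "puiseux_val (x + y) = puiseux_val x"
proof -
  show ne: "x + y \<noteq> 0"
  proof
    assume "x + y = 0"
    hence "x = - y" by (simp add: add_eq_0_iff2)
    thus False using assms by auto
  qed
  show "puiseux_val (x + y) = puiseux_val x"
  proof (cases "y = 0")
    case False
    have "puiseux_val (x + y) \<ge> puiseux_val x"
      by (rule puiseux_val_add_ge) (use assms ne in auto)
    moreover have "\<not> puiseux_val (x + y) > puiseux_val x"
    proof
      assume *: "puiseux_val (x + y) > puiseux_val x"
      have "puiseux_val ((x + y) + (- y)) > puiseux_val x"
        by (rule puiseux_val_add_gt) (use assms ne * False in auto)
      thus False by simp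
    qed
    ultimately show ?thesis by linarith
  qed simp
qed

text \<open>A single term of smallest valuation would be minus a sum of terms of larger valuation,
  and such a sum has larger valuation again.\<close>

lemma min_attained_twice_val:
  assumes "finite A" "A \<noteq> {}" "\<And>i. i \<in> A \<Longrightarrow> f i \<noteq> 0" "(\<Sum>i\<in>A. f i) = 0"
  shows "min_attained_twice A (\<lambda>i. puiseux_val (f i))"
proof -
  obtain a where a: "a \<in> A" "\<And>c. c \<in> A \<Longrightarrow> puiseux_val (f a) \<le> puiseux_val (f c)"
    using arg_min_if_finite[OF assms(1,2), of "\<lambda>i. puiseux_val (f i)"]
    by (metis linorder_not_le)
  have "\<exists>b\<in>A. b \<noteq> a \<and> puiseux_val (f b) \<le> puiseux_val (f a)"
  proof (rule ccontr)
    assume *: "\<not> ?thesis"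
    have s: "f a + sum f (A - {a}) = 0"
      using assms(1,4) a(1) by (simp add: sum.remove)
    hence s': "sum f (A - {a}) = - f a" by (simp add: add_eq_0_iff)
    have "puiseux_val (sum f (A - {a})) > puiseux_val (f a)"
      by (rule puiseux_val_sum_gt) (use * s' assms(3) a in force)+
    with s' show False by simp
  qed
  then obtain b where "b \<in> A" "b \<noteq> a" "puiseux_val (f b) \<le> puiseux_val (f a)" by blast
  thus ?thesis unfolding min_attained_twice_def using a by (meson order_trans)
qed


section \<open>Tropicalization\<close>

text \<open>Finite support makes this a finite union of finite intersections of closed half-spaces.
  Closedness later carries membership from rational to real points.\<close>

lemma closed_trop_hypersurface:
  assumes "finite (laurent_supp f)"
  shows "closed (trop_hypersurface f)"
proof -
  let ?S = "laurent_supp f"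
  let ?h = "\<lambda>w :: real ^ 'a. \<lambda>u. puiseux_val (f u) + (\<Sum>i\<in>UNIV. of_int (u i) * w $ i)"
  have "trop_hypersurface f = (\<Union>a\<in>?S. \<Union>b\<in>?S - {a}. \<Inter>c\<in>?S. {w. ?h w a \<le> ?h w c} \<inter> {w. ?h w b \<le> ?h w c})"
    unfolding trop_hypersurface_def min_attained_twice_def by blast
  moreover have "closed \<dots>"
    using assms by (intro closed_UN closed_INT ballI closed_Int closed_Collect_le continuous_intros) auto
  ultimately show ?thesis by simp
qed

lemma closed_tropicalization: "closed (tropicalization X)"
  unfolding tropicalization_def by (intro closed_INT ballI closed_trop_hypersurface) auto

lemma tropicalization_mono: "X \<subseteq> Y \<Longrightarrow> tropicalization X \<subseteq> tropicalization Y"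
  unfolding tropicalization_def by blast

text \<open>A polynomial of the ideal vanishes at \<open>p\<close>, so no single one of its terms at
  \<open>p\<close> can have the smallest valuation. This is the source of all lower bounds on
  tropicalizations.\<close>

lemma val_mem_tropicalization:
  assumes "p \<in> X" "\<And>i. p i \<noteq> 0"
  shows "(\<chi> i. puiseux_val (p i)) \<in> tropicalization X"
  unfolding tropicalization_def
proof clarify
  fix f :: "('a \<Rightarrow> int) \<Rightarrow> puiseux"
  assume f: "finite (laurent_supp f)" "laurent_supp f \<noteq> {}" "\<forall>x\<in>X. laurent_eval f x = 0"
  let ?m = "\<lambda>u. \<Prod>i\<in>UNIV. p i powi u i"
  have ne: "?m u \<noteq> 0" for u using assms(2) by (simp add: power_int_eq_0_iff)
  have "min_attained_twice (laurent_supp f) (\<lambda>u. puiseux_val (f u * ?m u))"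
    by (rule min_attained_twice_val) (use f assms ne in \<open>auto simp: laurent_eval_def laurent_supp_def\<close>)
  moreover have "puiseux_val (f u * ?m u) =
      puiseux_val (f u) + (\<Sum>i\<in>UNIV. of_int (u i) * puiseux_val (p i))" if "u \<in> laurent_supp f" for u
    using that ne assms(2)
    by (simp add: laurent_supp_def puiseux_val_mult puiseux_val_prod puiseux_val_power_int power_int_eq_0_iff)
  ultimately show "(\<chi> i. puiseux_val (p i)) \<in> trop_hypersurface f"
    unfolding trop_hypersurface_def min_attained_twice_def by simp
qed

text \<open>Coefficients 1 and -1 have valuation 0, so the tropical condition involves only
  exponents. Injectivity of \<open>u\<close> keeps the monomials from merging, which would change
  support and coefficients.\<close>

lemma tropicalization_relation:
  fixes u :: "'b \<Rightarrow> 'i :: finite \<Rightarrow> int"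
  assumes w: "w \<in> tropicalization X" and A: "finite A" "A \<noteq> {}" "inj_on u A"
    and \<epsilon>: "\<And>j. j \<in> A \<Longrightarrow> \<epsilon> j \<in> {1, -1}"
    and rel: "\<And>p. p \<in> X \<Longrightarrow> (\<Sum>j\<in>A. \<epsilon> j * (\<Prod>i\<in>UNIV. p i powi u j i)) = 0"
  shows "min_attained_twice A (\<lambda>j. \<Sum>i\<in>UNIV. of_int (u j i) * w $ i)"
proof -
  define f where "f = (\<lambda>v. if v \<in> u ` A then \<epsilon> (the_inv_into A u v) else 0)"
  have fu: "f (u j) = \<epsilon> j" if "j \<in> A" for j
    using that A(3) by (simp add: f_def the_inv_into_f_f)
  have \<epsilon>0: "\<epsilon> j \<noteq> 0" "puiseux_val (\<epsilon> j) = 0" if "j \<in> A" for j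
    using \<epsilon>[OF that] by auto
  have supp: "laurent_supp f = u ` A"
    using fu \<epsilon>0 by (auto simp: laurent_supp_def) (auto simp: f_def split: if_splits)
  have ev: "laurent_eval f p = 0" if "p \<in> X" for p
    using rel[OF that] A(3) fu by (simp add: laurent_eval_def supp sum.reindex)
  let ?h = "\<lambda>v. puiseux_val (f v) + (\<Sum>i\<in>UNIV. of_int (v i) * w $ i)"
  have "w \<in> trop_hypersurface f"
    using w A supp ev unfolding tropicalization_def by auto
  then obtain a b where ab: "a \<in> A" "b \<in> A" "u a \<noteq> u b"
    and le: "\<And>c. c \<in> A \<Longrightarrow> ?h (u a) \<le> ?h (u c)" "\<And>c. c \<in> A \<Longrightarrow> ?h (u b) \<le> ?h (u c)"
    unfolding trop_hypersurface_def min_attained_twice_def supp by blast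
  have "?h (u c) = (\<Sum>i\<in>UNIV. of_int (u c i) * w $ i)" if "c \<in> A" for c
    using fu[OF that] \<epsilon>0[OF that] by simp
  hence "\<forall>c\<in>A. (\<Sum>i\<in>UNIV. of_int (u a i) * w $ i) \<le> (\<Sum>i\<in>UNIV. of_int (u c i) * w $ i)"
    "\<forall>c\<in>A. (\<Sum>i\<in>UNIV. of_int (u b i) * w $ i) \<le> (\<Sum>i\<in>UNIV. of_int (u c i) * w $ i)"
    using le ab by simp_all
  moreover have "a \<noteq> b" using ab by auto
  ultimately show ?thesis unfolding min_attained_twice_def using ab by blast
qed

text \<open>For two distinct monomials, a minimum attained twice is an equality. Equal exponents are
  split off, as they do not give a polynomial with two terms.\<close>

lemma tropicalization_binomial:
  fixes u v :: "'i :: finite \<Rightarrow> int"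
  assumes w: "w \<in> tropicalization X" and \<epsilon>: "\<epsilon> \<in> {1, -1}"
    and rel: "\<And>p. p \<in> X \<Longrightarrow> (\<Prod>i\<in>UNIV. p i powi u i) = \<epsilon> * (\<Prod>i\<in>UNIV. p i powi v i)"
  shows "(\<Sum>i\<in>UNIV. of_int (u i) * w $ i) = (\<Sum>i\<in>UNIV. of_int (v i) * w $ i)"
proof (cases "u = v")
  case False
  have "min_attained_twice UNIV (\<lambda>b. \<Sum>i\<in>UNIV. of_int ((if b then u else v) i) * w $ i)"
    by (rule tropicalization_relation[OF w, where \<epsilon> = "\<lambda>b. if b then 1 else - \<epsilon>"])
      (use False rel \<epsilon> in \<open>auto simp: UNIV_bool inj_on_def\<close>)
  thus ?thesis by (auto simp: min_attained_twice_def UNIV_bool)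
qed simp

section \<open>Ultrametrics and laminar families\<close>

text \<open>The convention is that of valuations of differences: large values mean close points. The
  diagonal stays unconstrained, as only distinct points have a nonzero difference.\<close>

definition ultra :: "'b set \<Rightarrow> ('b \<Rightarrow> 'b \<Rightarrow> real) \<Rightarrow> bool" where
  "ultra P u \<longleftrightarrow> (\<forall>i\<in>P. \<forall>j\<in>P. i \<noteq> j \<longrightarrow> u i j = u j i) \<and>
     (\<forall>i\<in>P. \<forall>j\<in>P. \<forall>k\<in>P. i \<noteq> j \<longrightarrow> i \<noteq> k \<longrightarrow> j \<noteq> k \<longrightarrow> min (u i k) (u k j) \<le> u i j)"

definition laminar :: "'b set set \<Rightarrow> bool" where
  "laminar s \<longleftrightarrow> (\<forall>A\<in>s. \<forall>B\<in>s. A \<subseteq> B \<or> B \<subseteq> A \<or> A \<inter> B = {})"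

text \<open>In the rooted tree of a laminar family with edge lengths \<open>c\<close>, this is the
  distance from the root to the branching point of \<open>i\<close> and \<open>j\<close>.\<close>

definition cluster_sum :: "'b set \<Rightarrow> ('b set \<Rightarrow> real) \<Rightarrow> 'b \<Rightarrow> 'b \<Rightarrow> real" where
  "cluster_sum P c i j = (\<Sum>A | A \<subseteq> P \<and> i \<in> A \<and> j \<in> A. c A)"

lemma ultra_sym: "ultra P u \<Longrightarrow> i \<in> P \<Longrightarrow> j \<in> P \<Longrightarrow> i \<noteq> j \<Longrightarrow> u i j = u j i"
  by (auto simp: ultra_def)

lemma ultraD:
  "ultra P u \<Longrightarrow> i \<in> P \<Longrightarrow> j \<in> P \<Longrightarrow> k \<in> P \<Longrightarrow> i \<noteq> j \<Longrightarrow> i \<noteq> k \<Longrightarrow> j \<noteq> k \<Longrightarrow>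
    u i k \<le> u i j \<or> u k j \<le> u i j"
  unfolding ultra_def by (metis min_le_iff_disj)

lemma ultra_subset: "ultra P u \<Longrightarrow> Q \<subseteq> P \<Longrightarrow> ultra Q u"
  unfolding ultra_def by blast

text \<open>
  The new point is placed at distance \<open>r\<close> from its nearest neighbour; the coefficient of \<open>t\<^sup>r\<close>
  only has to avoid finitely many values.
\<close>

lemma ultra_realizable:
  assumes "finite P" "ultra P u" "\<And>i j. i \<in> P \<Longrightarrow> j \<in> P \<Longrightarrow> i \<noteq> j \<Longrightarrow> u i j \<in> \<rat>"
  shows "\<exists>x. \<forall>i\<in>P. \<forall>j\<in>P. i \<noteq> j \<longrightarrow> x i - x j \<noteq> 0 \<and> puiseux_val (x i - x j) = u i j"
  using assms
proof (induction P rule: finite_induct)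
  case (insert m P)
  have "\<exists>x. \<forall>i\<in>P. \<forall>j\<in>P. i \<noteq> j \<longrightarrow> x i - x j \<noteq> 0 \<and> puiseux_val (x i - x j) = u i j"
    using insert.prems by (intro insert.IH ultra_subset[OF insert.prems(1)]) auto
  then obtain x where x: "\<And>i j. i \<in> P \<Longrightarrow> j \<in> P \<Longrightarrow> i \<noteq> j \<Longrightarrow> x i - x j \<noteq> 0"
    "\<And>i j. i \<in> P \<Longrightarrow> j \<in> P \<Longrightarrow> i \<noteq> j \<Longrightarrow> puiseux_val (x i - x j) = u i j" by blast
  show ?case
  proof (cases "P = {}")
    case False
    obtain k where k: "k \<in> P" "\<And>j. j \<in> P \<Longrightarrow> u j m \<le> u k m"
    proof -
      have "finite ((\<lambda>j. u j m) ` P)" "(\<lambda>j. u j m) ` P \<noteq> {}" using insert.hyps False by auto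
      from Max_in[OF this] Max_ge[OF this(1)] show ?thesis using that by fastforce
    qed
    define r where "r = u k m"
    have "r \<in> \<rat>" unfolding r_def using insert.hyps k insert.prems(2) by auto
    then obtain z where z: "z \<noteq> 0" "puiseux_val z = r" by (rule puiseux_val_rational)
    define y where "y = (\<lambda>j n. x k - x j + of_nat n * z)"
    have nz: "of_nat n * z \<noteq> 0" "puiseux_val (of_nat n * z) = r" if "n > 0" for n
      using that z by (auto simp: puiseux_of_nat_neq_0 puiseux_val_mult puiseux_val_of_nat)
    define bad where "bad = (\<lambda>j. {n. n > 0 \<and> \<not> (y j n \<noteq> 0 \<and> puiseux_val (y j n) = u j m)})"
    have bad: "finite (bad j)" if j: "j \<in> P" for j
    proof (cases "j = k")
      case True
      hence "bad j = {}" using nz by (auto simp: bad_def y_def r_def)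
      thus ?thesis by simp
    next
      case False
      have jm: "j \<noteq> m" "k \<noteq> m" using insert.hyps j k by auto
      note P = j k(1)
      note sym = ultra_sym[OF insert.prems(1), of j k] ultra_sym[OF insert.prems(1), of m j]
          ultra_sym[OF insert.prems(1), of m k]
      note u1 = ultraD[OF insert.prems(1), of j m k] and u2 = ultraD[OF insert.prems(1), of j k m]
      have x1: "x k - x j \<noteq> 0" "puiseux_val (x k - x j) = u k j"
        using x[OF k(1) j] False by auto
      have le: "u j m \<le> r" using k j by (auto simp: r_def)
      \<comment> \<open>Isosceles triangles fix \<open>u j m\<close>: it is the smaller of
        \<open>u k j\<close> and \<open>r\<close>. Only if the two agree can
        \<open>x k - x j\<close> and \<open>of_nat n * z\<close> cancel.\<close>
      consider "u k j < r" | "u k j > r" | "u k j = r" by linarith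
      thus ?thesis
      proof cases
        case 1
        have "u j m = u k j"
          using u1 u2 sym 1 le P False jm by (auto simp: r_def)
        hence "bad j = {}" using puiseux_val_add_eq[OF x1(1)] x1 nz 1 by (auto simp: bad_def y_def)
        thus ?thesis by simp
      next
        case 2
        have "u j m = r"
          using u1 u2 sym 2 le P False jm by (auto simp: r_def)
        hence "bad j = {}"
          using puiseux_val_add_eq[OF nz(1), of _ "x k - x j"] x1 nz 2
          by (auto simp: bad_def y_def add.commute)
        thus ?thesis by simp
      next
        case 3
        have uj: "u j m = r"
          using u1 u2 sym 3 le P False jm by (auto simp: r_def)
        have gt: "y j n = 0 \<or> puiseux_val (y j n) > r" if "n \<in> bad j" for n
        proof (cases "y j n = 0")
          case False
          have "puiseux_val (y j n) \<ge> r"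
            using False that nz[of n] x1 3 unfolding y_def
            by (intro puiseux_val_add_ge) (auto simp: bad_def)
          thus ?thesis using that uj False by (auto simp: bad_def)
        qed simp
        \<comment> \<open>Two bad coefficients for the same \<open>j\<close> would give
          \<open>of_nat (n' - n) * z\<close> a valuation above \<open>r\<close>, so at most one is
          bad.\<close>
        have "\<not> n < n'" if n: "n \<in> bad j" "n' \<in> bad j" for n n'
        proof
          assume less: "n < n'"
          have eq: "y j n' + (- y j n) = of_nat (n' - n) * z"
            using less by (simp add: y_def of_nat_diff algebra_simps)
          have "puiseux_val (y j n' + (- y j n)) > r"
            using gt[OF n(1)] gt[OF n(2)] nz(1)[of "n' - n"] less eq
            by (intro puiseux_val_add_gt) auto
          thus False using nz(2)[of "n' - n"] less eq by simp
        qed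
        hence "bad j \<subseteq> {n}" if "n \<in> bad j" for n
          using that by (metis insertI1 linorder_neqE_nat subsetI)
        thus ?thesis by (metis finite.emptyI finite.insertI finite_subset equals0I)
      qed
    qed
    hence "finite (insert 0 (\<Union>j\<in>P. bad j))" using insert.hyps by simp
    then obtain n where n: "n \<notin> insert 0 (\<Union>j\<in>P. bad j)"
      using infinite_UNIV_nat by (metis UNIV_I finite_subset subsetI)
    define x' where "x' = x(m := x k + of_nat n * z)"
    have 1: "x' m - x' j \<noteq> 0 \<and> puiseux_val (x' m - x' j) = u j m" if "j \<in> P" for j
    proof -
      have "x' m - x' j = y j n" using that insert.hyps by (auto simp: x'_def y_def)
      thus ?thesis using n that by (auto simp: bad_def)
    qed
    have 2: "x' j - x' m \<noteq> 0 \<and> puiseux_val (x' j - x' m) = u j m" if "j \<in> P" for j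
      using 1[OF that] puiseux_val_minus[of "x' m - x' j"] by auto
    have 3: "x' i = x i" if "i \<in> P" for i using that insert.hyps by (auto simp: x'_def)
    have 4: "u m j = u j m" if "j \<in> P" for j
      using ultra_sym[OF insert.prems(1), of m j] that insert.hyps by auto
    show ?thesis
    proof (intro exI[of _ x'] ballI impI)
      fix i j assume "i \<in> insert m P" "j \<in> insert m P" "i \<noteq> j"
      thus "x' i - x' j \<noteq> 0 \<and> puiseux_val (x' i - x' j) = u i j"
        using 1 2 3 4 x by (metis insertE)
    qed
  qed auto
qed auto

section \<open>Ultrametrics as sums over clusters\<close>

lemma cluster_sum_add: "cluster_sum P (\<lambda>A. c A + d A) i j = cluster_sum P c i j + cluster_sum P d i j"
  by (simp add: cluster_sum_def sum.distrib)

lemma cluster_sum_subset: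
  assumes "finite P" "Q \<subseteq> P" "\<And>A. c A \<noteq> 0 \<Longrightarrow> A \<subseteq> Q"
  shows "cluster_sum P c i j = cluster_sum Q c i j"
  unfolding cluster_sum_def
  by (rule sum.mono_neutral_right) (use assms in \<open>auto intro: finite_subset[of _ "Pow P"]\<close>)

lemma cluster_sum_eq_0:
  assumes "\<And>A. c A \<noteq> 0 \<Longrightarrow> A \<subseteq> Q" "i \<notin> Q \<or> j \<notin> Q"
  shows "cluster_sum P c i j = 0"
  unfolding cluster_sum_def using assms by (intro sum.neutral) auto

lemma cluster_sum_whole:
  assumes "finite P" "i \<in> P" "j \<in> P"
  shows "cluster_sum P (\<lambda>A. if A = P then m else 0) i j = m"
  unfolding cluster_sum_def using assms by (simp add: sum.delta' finite_subset[of _ "Pow P"])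

text \<open>
  After subtracting the minimum \<open>m\<close> of \<open>u\<close>, the pairs of value \<open>0\<close> separate the class \<open>Q\<close> of a point
  from its complement, and \<open>u\<close> is decomposed on the two parts separately.
\<close>

lemma ultra_decomposition:
  assumes "finite P" "ultra P u" "\<And>i j. i \<in> P \<Longrightarrow> j \<in> P \<Longrightarrow> i \<noteq> j \<Longrightarrow> u i j \<ge> 0"
  shows "\<exists>c. (\<forall>A. c A \<ge> 0) \<and> (\<forall>A. c A \<noteq> 0 \<longrightarrow> A \<subseteq> P \<and> card A \<ge> 2) \<and> laminar {A. c A \<noteq> 0} \<and>
    (\<forall>i\<in>P. \<forall>j\<in>P. i \<noteq> j \<longrightarrow> u i j = cluster_sum P c i j)"
  using assms
proof (induction "card P" arbitrary: P u rule: less_induct)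
  case less
  show ?case
  proof (cases "\<exists>i\<in>P. \<exists>j\<in>P. i \<noteq> j")
    case False
    thus ?thesis by (intro exI[of _ "\<lambda>_. 0"]) (auto simp: laminar_def)
  next
    case True
    let ?V = "{u i j | i j. i \<in> P \<and> j \<in> P \<and> i \<noteq> j}"
    define m where "m = Min ?V"
    have fin: "finite ?V"
      by (rule finite_subset[of _ "(\<lambda>(i, j). u i j) ` (P \<times> P)"]) (use less.prems in auto)
    moreover have "?V \<noteq> {}" using True by blast
    ultimately have "m \<in> ?V" unfolding m_def by (rule Min_in)
    then obtain i0 j0 where ij0: "i0 \<in> P" "j0 \<in> P" "i0 \<noteq> j0" "m = u i0 j0" by blast
    have m_le: "m \<le> u i j" if "i \<in> P" "j \<in> P" "i \<noteq> j" for i j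
      unfolding m_def using fin that by (intro Min_le) auto
    have m0: "m \<ge> 0" using ij0 less.prems(3) by simp
    define Q where "Q = {k \<in> P. k = i0 \<or> u i0 k > m}"
    define R where "R = P - Q"
    \<comment> \<open>\<open>i0\<close> lies in \<open>Q\<close> and \<open>j0\<close> outside, so
      both parts are smaller than \<open>P\<close> and the induction applies to each.\<close>
    have Q: "Q \<subset> P" "i0 \<in> Q" "Q \<subseteq> P" using ij0 by (auto simp: Q_def)
    have R: "R \<subset> P" "R \<subseteq> P" "Q \<inter> R = {}" "Q \<union> R = P" using Q by (auto simp: R_def)
    have cross: "u a b = m" "u b a = m" if "a \<in> Q" "b \<in> R" for a b
    proof -
      have ab: "a \<in> P" "b \<in> P" "a \<noteq> b" "b \<noteq> i0" using that Q R by auto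
      have b: "u i0 b = m" using that ab m_le[of i0 b] ij0 by (auto simp: Q_def R_def)
      show "u a b = m"
      proof (cases "a = i0")
        case False
        have "u i0 a > m" using that False by (auto simp: Q_def)
        thus ?thesis
          using ultraD[OF less.prems(2), of i0 b a] b ab ij0 False m_le[of a b] by auto
      qed (use b in simp)
      thus "u b a = m" using ultra_sym[OF less.prems(2) ab(1,2,3)] by simp
    qed
    define u' where "u' = (\<lambda>i j. u i j - m)"
    have u': "ultra P u'"
      unfolding ultra_def u'_def min_diff_distrib_left[symmetric]
      using ultra_sym[OF less.prems(2)] ultraD[OF less.prems(2)]
      by (auto simp: min_le_iff_disj)
    have "\<exists>c. (\<forall>A. c A \<ge> 0) \<and> (\<forall>A. c A \<noteq> 0 \<longrightarrow> A \<subseteq> Q \<and> card A \<ge> 2) \<and> laminar {A. c A \<noteq> 0} \<and>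
        (\<forall>i\<in>Q. \<forall>j\<in>Q. i \<noteq> j \<longrightarrow> u' i j = cluster_sum Q c i j)"
    proof (rule less.hyps)
      show "card Q < card P" "finite Q"
        using Q(1) less.prems(1) by (auto intro: psubset_card_mono finite_subset)
      show "ultra Q u'" using u' Q(3) by (rule ultra_subset)
      show "0 \<le> u' i j" if "i \<in> Q" "j \<in> Q" "i \<noteq> j" for i j
        using m_le[of i j] that Q(3) by (auto simp: u'_def)
    qed
    then obtain c where c0: "\<forall>A. c A \<ge> 0" "\<forall>A. c A \<noteq> 0 \<longrightarrow> A \<subseteq> Q \<and> card A \<ge> 2"
      and lamc: "laminar {A. c A \<noteq> 0}" and sumc: "\<forall>i\<in>Q. \<forall>j\<in>Q. i \<noteq> j \<longrightarrow> u' i j = cluster_sum Q c i j"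
      by (elim exE conjE) (rule that)
    have c: "\<And>A. c A \<ge> 0" "\<And>A. c A \<noteq> 0 \<Longrightarrow> A \<subseteq> Q" "\<And>A. c A \<noteq> 0 \<Longrightarrow> card A \<ge> 2"
      using c0 by auto
    have "\<exists>c. (\<forall>A. c A \<ge> 0) \<and> (\<forall>A. c A \<noteq> 0 \<longrightarrow> A \<subseteq> R \<and> card A \<ge> 2) \<and> laminar {A. c A \<noteq> 0} \<and>
        (\<forall>i\<in>R. \<forall>j\<in>R. i \<noteq> j \<longrightarrow> u' i j = cluster_sum R c i j)"
    proof (rule less.hyps)
      show "card R < card P" "finite R"
        using R(1) less.prems(1) by (auto intro: psubset_card_mono finite_subset)
      show "ultra R u'" using u' R(2) by (rule ultra_subset)
      show "0 \<le> u' i j" if "i \<in> R" "j \<in> R" "i \<noteq> j" for i j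
        using m_le[of i j] that R(2) by (auto simp: u'_def)
    qed
    then obtain d where d0: "\<forall>A. d A \<ge> 0" "\<forall>A. d A \<noteq> 0 \<longrightarrow> A \<subseteq> R \<and> card A \<ge> 2"
      and lamd: "laminar {A. d A \<noteq> 0}" and sumd: "\<forall>i\<in>R. \<forall>j\<in>R. i \<noteq> j \<longrightarrow> u' i j = cluster_sum R d i j"
      by (elim exE conjE) (rule that)
    have d: "\<And>A. d A \<ge> 0" "\<And>A. d A \<noteq> 0 \<Longrightarrow> A \<subseteq> R" "\<And>A. d A \<noteq> 0 \<Longrightarrow> card A \<ge> 2"
      using d0 by auto
    \<comment> \<open>The weight \<open>m\<close> on \<open>P\<close> restores the minimum
      subtracted in \<open>u'\<close> on all pairs; pairs across the two parts receive nothing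
      else.\<close>
    define e where "e = (\<lambda>A. c A + (d A + (if A = P then m else 0)))"
    have e: "A = P \<or> c A \<noteq> 0 \<or> d A \<noteq> 0" if "e A \<noteq> 0" for A using that by (auto simp: e_def split: if_splits)
    have P2: "card P \<ge> 2"
      using card_mono[of P "{i0, j0}"] less.prems(1) ij0 by auto
    show ?thesis
    proof (intro exI[of _ e] conjI allI impI ballI)
      show "e A \<ge> 0" for A using c(1) d(1) m0 by (auto simp: e_def)
      show "A \<subseteq> P" "2 \<le> card A" if "e A \<noteq> 0" for A
        using e[OF that] c(2,3)[of A] d(2,3)[of A] P2 Q R by auto
      show "laminar {A. e A \<noteq> 0}"
        unfolding laminar_def
      proof (intro ballI)
        fix A B assume "A \<in> {A. e A \<noteq> 0}" "B \<in> {A. e A \<noteq> 0}"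
        hence AB: "A = P \<or> c A \<noteq> 0 \<or> d A \<noteq> 0" "B = P \<or> c B \<noteq> 0 \<or> d B \<noteq> 0" using e by auto
        have sub: "A \<subseteq> P" "B \<subseteq> P" using AB c(2) d(2) Q R by blast+
        show "A \<subseteq> B \<or> B \<subseteq> A \<or> A \<inter> B = {}"
        proof -
          have "A \<subseteq> B \<or> B \<subseteq> A \<or> A \<inter> B = {}" if "c A \<noteq> 0" "c B \<noteq> 0"
            using lamc that unfolding laminar_def by simp
          moreover have "A \<subseteq> B \<or> B \<subseteq> A \<or> A \<inter> B = {}" if "d A \<noteq> 0" "d B \<noteq> 0"
            using lamd that unfolding laminar_def by simp
          moreover have "A \<inter> B = {}" if "c A \<noteq> 0" "d B \<noteq> 0"
            using c(2)[OF that(1)] d(2)[OF that(2)] R(3) by auto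
          moreover have "A \<inter> B = {}" if "c B \<noteq> 0" "d A \<noteq> 0"
            using c(2)[OF that(1)] d(2)[OF that(2)] R(3) by auto
          ultimately show ?thesis using AB sub by metis
        qed
      qed
      fix i j assume ij: "i \<in> P" "j \<in> P" "i \<noteq> j"
      have "cluster_sum P e i j = cluster_sum P c i j + (cluster_sum P d i j + m)"
        unfolding e_def cluster_sum_add using ij less.prems(1) by (simp add: cluster_sum_whole)
      moreover have "cluster_sum P c i j = (if i \<in> Q \<and> j \<in> Q then u' i j else 0)"
        using cluster_sum_subset[of P Q c i j] c(2) sumc less.prems(1) Q(3)
          cluster_sum_eq_0[of c Q i j P] ij by auto
      moreover have "cluster_sum P d i j = (if i \<in> R \<and> j \<in> R then u' i j else 0)"
        using cluster_sum_subset[of P R d i j] d(2) sumd less.prems(1) R(2)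
          cluster_sum_eq_0[of d R i j P] ij by auto
      ultimately show "u i j = cluster_sum P e i j"
        using ij R cross[of i j] cross[of j i] by (auto simp: u'_def)
    qed
  qed
qed

section \<open>Recovering the clusters from the ultrametric\<close>

lemma cluster_sum_mono:
  assumes "finite P" "\<And>A. c A \<ge> 0" "\<And>A. c A \<noteq> 0 \<Longrightarrow> i \<in> A \<Longrightarrow> j \<in> A \<Longrightarrow> k \<in> A \<and> l \<in> A"
  shows "cluster_sum P c i j \<le> cluster_sum P c k l"
proof -
  have "cluster_sum P c i j = (\<Sum>A | A \<subseteq> P \<and> i \<in> A \<and> j \<in> A \<and> c A \<noteq> 0. c A)"
    unfolding cluster_sum_def
    by (rule sum.mono_neutral_right) (use assms(1) in \<open>auto intro: finite_subset[of _ "Pow P"]\<close>)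
  also have "\<dots> \<le> cluster_sum P c k l"
    unfolding cluster_sum_def
    by (rule sum_mono2) (use assms in \<open>auto intro: finite_subset[of _ "Pow P"]\<close>)
  finally show ?thesis .
qed

lemma cluster_sum_commute: "cluster_sum P c i j = cluster_sum P c j i"
  unfolding cluster_sum_def by (intro sum.cong) auto

text \<open>If some cluster contains \<open>i\<close> and \<open>k\<close> but not \<open>j\<close>,
  laminarity puts \<open>i\<close> into every cluster through \<open>k\<close> and \<open>j\<close>;
  otherwise every cluster through \<open>i\<close> and \<open>k\<close> contains \<open>j\<close>.
  Either way one sum is dominated term by term.\<close>

lemma ultra_cluster_sum:
  assumes "finite P" "\<And>A. c A \<ge> 0" "laminar {A. c A \<noteq> 0}"
  shows "ultra P (cluster_sum P c)"
proof -
  have "cluster_sum P c i k \<le> cluster_sum P c i j \<or> cluster_sum P c k j \<le> cluster_sum P c i j" for i j k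
  proof (cases "\<forall>A. c A \<noteq> 0 \<longrightarrow> i \<in> A \<longrightarrow> k \<in> A \<longrightarrow> j \<in> A")
    case True
    thus ?thesis using cluster_sum_mono[of P c i k i j] assms(1,2) by auto
  next
    case False
    then obtain A where A: "c A \<noteq> 0" "i \<in> A" "k \<in> A" "j \<notin> A" by auto
    have "i \<in> B" if "c B \<noteq> 0" "k \<in> B" "j \<in> B" for B
      using A that assms(3) unfolding laminar_def by blast
    thus ?thesis using cluster_sum_mono[of P c k j i j] assms(1,2) by auto
  qed
  thus ?thesis unfolding ultra_def by (auto simp: min_le_iff_disj intro: cluster_sum_commute)
qed

text \<open>\<open>cluster_sum_mono\<close> applies after the weight of \<open>D\<close> is set to
  0. This leaves the sum for \<open>i\<close>, \<open>j\<close> alone and lowers the one for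
  \<open>k\<close>, \<open>l\<close> by exactly \<open>c D\<close>.\<close>

lemma cluster_sum_insert_le:
  assumes "finite P" "\<And>A. c A \<ge> 0" "D \<subseteq> P" "k \<in> D" "l \<in> D" "\<not> (i \<in> D \<and> j \<in> D)"
    "\<And>A. c A \<noteq> 0 \<Longrightarrow> i \<in> A \<Longrightarrow> j \<in> A \<Longrightarrow> k \<in> A \<and> l \<in> A"
  shows "cluster_sum P c i j + c D \<le> cluster_sum P c k l"
proof -
  have fin: "finite {A. A \<subseteq> P \<and> k \<in> A \<and> l \<in> A}" using assms(1) by (auto intro: finite_subset[of _ "Pow P"])
  let ?c = "c(D := 0)"
  have "cluster_sum P c i j = cluster_sum P ?c i j"
    unfolding cluster_sum_def using assms(6) by (intro sum.cong) auto
  also have "\<dots> \<le> cluster_sum P ?c k l"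
    by (rule cluster_sum_mono) (use assms in \<open>auto split: if_splits\<close>)
  also have "\<dots> = cluster_sum P c k l - c D"
    unfolding cluster_sum_def using fin assms(3-5) by (simp add: sum.remove[of _ D])
  finally show ?thesis by simp
qed

text \<open>A cluster through \<open>a\<close> and a point \<open>d\<close> outside \<open>A\<close>
  must contain \<open>A\<close>, hence also \<open>b\<close>; and \<open>A\<close> itself counts
  only for \<open>a\<close>, \<open>b\<close>.\<close>

lemma cluster_isolated:
  assumes "finite P" "\<And>A. c A \<ge> 0" "laminar {A. c A \<noteq> 0}" "c A \<noteq> 0" "A \<subseteq> P"
    "a \<in> A" "b \<in> A" "d \<notin> A"
  shows "cluster_sum P c a d < cluster_sum P c a b"
proof -
  have "cluster_sum P c a d + c A \<le> cluster_sum P c a b"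
    by (rule cluster_sum_insert_le) (use assms in \<open>auto simp: laminar_def\<close>)
  moreover have "c A > 0" using assms(2)[of A] assms(4) by simp
  ultimately show ?thesis by linarith
qed

text \<open>Converse of \<open>cluster_isolated\<close>. Take \<open>b\<close> farthest from
  \<open>a\<close> inside \<open>A\<close> and \<open>d\<close> nearest to \<open>a\<close> outside.
  As \<open>a\<close> is closer to \<open>b\<close> than to \<open>d\<close>, some cluster
  \<open>D\<close> contains \<open>a\<close> and \<open>b\<close> but not \<open>d\<close>; the
  choice of \<open>b\<close> forces all of \<open>A\<close> into \<open>D\<close>, and the choice of
  \<open>d\<close> keeps everything else out.\<close>

lemma isolated_cluster:
  assumes "finite P" "\<And>A. c A \<ge> 0" "laminar {A. c A \<noteq> 0}" "A \<subset> P" "card A \<ge> 2"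
    and iso: "\<And>a b d. a \<in> A \<Longrightarrow> b \<in> A \<Longrightarrow> a \<noteq> b \<Longrightarrow> d \<in> P - A \<Longrightarrow> cluster_sum P c a d < cluster_sum P c a b"
  shows "c A \<noteq> 0"
proof -
  let ?u = "cluster_sum P c"
  have finA: "finite A" using assms by (auto intro: finite_subset)
  obtain a where a: "a \<in> A" using assms(5) by (metis card.empty ex_in_conv not_numeral_le_zero)
  have ne: "A - {a} \<noteq> {}" using assms(5) a finA
    by (metis card.empty card_Suc_Diff1 not_less_eq_eq numeral_2_eq_2 Suc_1 order_refl le_SucI)
  obtain b where b: "b \<in> A - {a}" "\<And>b'. b' \<in> A - {a} \<Longrightarrow> ?u a b \<le> ?u a b'"
    using ne finA by (metis arg_min_if_finite(1,2) finite_Diff linorder_not_le)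
  have ne2: "P - A \<noteq> {}" "finite (P - A)" using assms by auto
  obtain d where d: "d \<in> P - A" "\<And>d'. d' \<in> P - A \<Longrightarrow> ?u a d' \<le> ?u a d"
  proof -
    have "finite (?u a ` (P - A))" "?u a ` (P - A) \<noteq> {}" using ne2 by auto
    from Max_in[OF this] Max_ge[OF this(1)] show ?thesis using that by fastforce
  qed
  have "\<exists>D. c D \<noteq> 0 \<and> a \<in> D \<and> b \<in> D \<and> d \<notin> D \<and> D \<subseteq> P"
  proof (rule ccontr)
    assume *: "\<not> ?thesis"
    have "?u a b \<le> ?u a d"
    proof -
      \<comment> \<open>Weights may sit on sets outside \<open>P\<close>; \<open>cluster_sum\<close>
        ignores them, so they are cut off to obtain \<open>D \<subseteq> P\<close>.\<close>
      let ?c = "\<lambda>A. if A \<subseteq> P then c A else 0"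
      have "cluster_sum P ?c a b \<le> cluster_sum P ?c a d"
        by (rule cluster_sum_mono) (use * assms in \<open>auto split: if_splits\<close>)
      moreover have "cluster_sum P ?c = cluster_sum P c"
        by (intro ext) (auto simp: cluster_sum_def intro!: sum.cong)
      ultimately show ?thesis by simp
    qed
    moreover have "?u a d < ?u a b" by (rule iso) (use a b d in auto)
    ultimately show False by linarith
  qed
  then obtain D where D: "c D \<noteq> 0" "a \<in> D" "b \<in> D" "d \<notin> D" "D \<subseteq> P" by blast
  have cD: "c D > 0" using D(1) assms(2)[of D] by simp
  have chain: "D \<subseteq> B" if "c B \<noteq> 0" "a \<in> B" "\<not> B \<subseteq> D" for B
    using that D assms(3) unfolding laminar_def by blast
  have "b' \<in> D" if "b' \<in> A" for b'
  proof (rule ccontr)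
    assume n: "b' \<notin> D"
    have "?u a b' + c D \<le> ?u a b"
      by (rule cluster_sum_insert_le) (use assms(1,2) D n chain in \<open>blast+\<close>)
    thus False using b(2)[of b'] that cD n D(2) by force
  qed
  moreover have "d' \<in> A" if "d' \<in> D" for d'
  proof (rule ccontr)
    assume n: "d' \<notin> A"
    have "?u a d + c D \<le> ?u a d'"
      by (rule cluster_sum_insert_le) (use assms(1,2) D that chain in \<open>blast+\<close>)
    thus False using d(2)[of d'] that cD n D(5) by force
  qed
  ultimately have "D = A" by blast
  thus ?thesis using D by simp
qed

text \<open>The members of \<open>s\<close> through \<open>a\<close> form a chain. Choose
  \<open>b\<close> in \<open>A\<close> outside the largest member properly below \<open>A\<close>,
  and \<open>d\<close> outside \<open>A\<close> in the smallest one properly above. The indicator of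
  \<open>a\<close>, \<open>b\<close> minus that of \<open>a\<close>, \<open>d\<close> then singles
  out \<open>A\<close>.\<close>

lemma laminar_separate:
  assumes "finite P" "laminar s" "A \<in> s" "A \<subset> P" "card A \<ge> 2" "\<And>D. D \<in> s \<Longrightarrow> D \<subseteq> P"
  obtains a b d where "a \<in> A" "b \<in> A" "a \<noteq> b" "d \<in> P - A"
    "\<And>D. D \<in> s \<Longrightarrow> a \<in> D \<and> b \<in> D \<longleftrightarrow> A \<subseteq> D" "\<And>D. D \<in> s \<Longrightarrow> a \<in> D \<and> d \<in> D \<longleftrightarrow> A \<subset> D"
proof -
  have fin: "finite s" by (rule finite_subset[of _ "Pow P"]) (use assms in auto)
  have finA: "finite A" using assms by (auto intro: finite_subset)
  obtain a where a: "a \<in> A" using assms(5) by (metis card.empty ex_in_conv not_numeral_le_zero)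
  have ne: "A - {a} \<noteq> {}" using assms(5) a finA
    by (metis card.empty card_Suc_Diff1 not_less_eq_eq numeral_2_eq_2 Suc_1 order_refl le_SucI)
  have lam: "D \<subseteq> B \<or> B \<subseteq> D" if "D \<in> s" "B \<in> s" "a \<in> D" "a \<in> B" for B D
    using that assms(2) unfolding laminar_def by blast
  let ?C = "{D \<in> s. a \<in> D \<and> D \<subset> A}"
  have "\<exists>b\<in>A - {a}. \<forall>D\<in>?C. b \<notin> D"
  proof (cases "?C = {}")
    case False
    then obtain M where M: "M \<in> ?C" "\<forall>D\<in>?C. M \<subseteq> D \<longrightarrow> M = D"
      using finite_has_maximal[of ?C] fin by auto
    then obtain b where "b \<in> A - M" by blast
    moreover have "D \<subseteq> M" if "D \<in> ?C" for D using M lam[of D M] that by blast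
    ultimately show ?thesis using M by blast
  qed (use ne in blast)
  then obtain b where b: "b \<in> A" "b \<noteq> a" "\<And>D. D \<in> ?C \<Longrightarrow> b \<notin> D" by blast
  let ?C' = "{D \<in> s. A \<subset> D}"
  have "\<exists>d\<in>P - A. \<forall>D\<in>?C'. d \<in> D"
  proof (cases "?C' = {}")
    case False
    then obtain M where M: "M \<in> ?C'" "\<forall>D\<in>?C'. D \<subseteq> M \<longrightarrow> M = D"
      using finite_has_minimal[of ?C'] fin by auto
    then obtain d where "d \<in> M" "d \<notin> A" by blast
    moreover have "M \<subseteq> D" if "D \<in> ?C'" for D using M lam[of D M] that a by blast
    moreover have "M \<subseteq> P" using M assms(6) by simp
    ultimately show ?thesis by (intro bexI[of _ d]) auto
  qed (use assms(4) in blast)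
  then obtain d where d: "d \<in> P - A" "\<And>D. D \<in> ?C' \<Longrightarrow> d \<in> D" by blast
  show ?thesis
  proof
    show "a \<in> A" "b \<in> A" "a \<noteq> b" "d \<in> P - A" using a b d by auto
    show "a \<in> D \<and> b \<in> D \<longleftrightarrow> A \<subseteq> D" if "D \<in> s" for D
      using a b(1) b(3)[of D] lam[OF that assms(3)] that by blast
    show "a \<in> D \<and> d \<in> D \<longleftrightarrow> A \<subset> D" if "D \<in> s" for D
      using a d(1) d(2)[of D] lam[OF that assms(3)] that by blast
  qed
qed

section \<open>The fan of a system of clusters\<close>

text \<open>Singletons contain no pair of points. All of \<open>P\<close> contributes equally to
  every pair, a shift that the lineality space absorbs in the application.\<close>

definition clusters :: "'b set \<Rightarrow> 'b set set" where
  "clusters P = {A. A \<subset> P \<and> card A \<ge> 2}"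

definition families :: "'b set \<Rightarrow> 'b set set set" where
  "families P = {s. s \<subseteq> clusters P \<and> laminar s}"

lemma finite_clusters: "finite P \<Longrightarrow> finite (clusters P)"
  by (rule finite_subset[of _ "Pow P"]) (auto simp: clusters_def)

lemma finite_families: "finite P \<Longrightarrow> finite (families P)"
  by (rule finite_subset[of _ "Pow (clusters P)"]) (auto simp: families_def finite_clusters)

lemma finite_family: "finite P \<Longrightarrow> s \<in> families P \<Longrightarrow> finite s"
  by (rule finite_subset[of _ "clusters P"]) (auto simp: families_def finite_clusters)

lemma families_subset: "s \<in> families P \<Longrightarrow> r \<subseteq> s \<Longrightarrow> r \<in> families P"
  unfolding families_def laminar_def by (simp add: subset_iff)

lemma cluster_sum_clusters:
  assumes "finite P" "\<And>A. c A \<noteq> 0 \<Longrightarrow> A \<in> clusters P"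
  shows "cluster_sum P c a b = (\<Sum>A\<in>clusters P. c A * of_bool (a \<in> A \<and> b \<in> A))"
proof -
  have "cluster_sum P c a b = (\<Sum>A | A \<in> clusters P \<and> a \<in> A \<and> b \<in> A. c A)"
    unfolding cluster_sum_def
    by (rule sum.mono_neutral_right)
      (use assms in \<open>auto simp: clusters_def intro: finite_subset[of _ "Pow P"]\<close>)
  also have "\<dots> = (\<Sum>A\<in>clusters P. if a \<in> A \<and> b \<in> A then c A else 0)"
    using finite_clusters[OF assms(1)] by (simp add: sum.inter_filter)
  also have "\<dots> = (\<Sum>A\<in>clusters P. c A * of_bool (a \<in> A \<and> b \<in> A))"
    by (intro sum.cong) auto
  finally show ?thesis .
qed

text \<open>The clusters of \<open>c\<close> are isolated for \<open>c\<close>, by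
  \<open>dom\<close> also for \<open>k\<close>, and isolated sets are clusters. Supports are thus
  compared through strict inequalities alone, which serves both uniqueness of weights and absence of
  cancellation.\<close>

lemma supp_subset:
  assumes P: "finite P"
    and c: "\<And>A. c A \<ge> 0" "{A. c A \<noteq> 0} \<in> families P"
    and k: "\<And>A. k A \<ge> 0" "{A. k A \<noteq> 0} \<in> families P"
    and dom: "\<And>a b d. a \<in> P \<Longrightarrow> b \<in> P \<Longrightarrow> d \<in> P \<Longrightarrow> a \<noteq> b \<Longrightarrow> a \<noteq> d \<Longrightarrow> b \<noteq> d \<Longrightarrow>
      cluster_sum P c a d < cluster_sum P c a b \<Longrightarrow> cluster_sum P c b d < cluster_sum P c b a \<Longrightarrow>
      cluster_sum P k a d < cluster_sum P k a b"
    and A: "c A \<noteq> 0"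
  shows "k A \<noteq> 0"
proof -
  have AP: "A \<subset> P" "card A \<ge> 2" using A c(2) by (auto simp: families_def clusters_def)
  have lam: "laminar {A. c A \<noteq> 0}" "laminar {A. k A \<noteq> 0}" using c(2) k(2) by (auto simp: families_def)
  show ?thesis
  proof (rule isolated_cluster[OF P k(1) lam(2) AP])
    fix a b d assume *: "a \<in> A" "b \<in> A" "a \<noteq> b" "d \<in> P - A"
    have "cluster_sum P c a d < cluster_sum P c a b" "cluster_sum P c b d < cluster_sum P c b a"
      using * AP by (auto intro!: cluster_isolated[OF P c(1) lam(1) A])
    thus "cluster_sum P k a d < cluster_sum P k a b" using * AP by (intro dom) auto
  qed
qed

text \<open>\<open>p + q\<close> is the midpoint of \<open>2 p\<close> and \<open>2 q\<close>. The
  case \<open>p = q\<close> is separate because the open segment is then empty.\<close>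

lemma mem_face_of_cone:
  assumes F: "F face_of D" and D: "convex_cone D" and F': "convex_cone F"
    and pq: "p \<in> D" "q \<in> D" "p + q \<in> F"
  shows "p \<in> F"
proof (cases "p = q")
  case True
  thus ?thesis using convex_cone_scaleR[OF F', of "1/2" "p + q"] pq by (simp flip: scaleR_2)
next
  case False
  have "p + q \<in> open_segment (2 *\<^sub>R p) (2 *\<^sub>R q)"
    using False by (auto simp: in_segment intro!: exI[of _ "1/2"])
  moreover have "2 *\<^sub>R p \<in> D" "2 *\<^sub>R q \<in> D" using pq D by (auto intro: convex_cone_scaleR)
  ultimately have "2 *\<^sub>R p \<in> F" using F pq unfolding face_of_def by blast
  thus ?thesis using convex_cone_scaleR[OF F', of "1/2" "2 *\<^sub>R p"] by simp
qed

lemma convex_cone_sum: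
  assumes "convex_cone D" "\<And>i. i \<in> I \<Longrightarrow> f i \<in> D"
  shows "(\<Sum>i\<in>I. f i) \<in> D"
  using assms(2)
  by (induction I rule: infinite_finite_induct)
    (use assms(1) in \<open>auto simp: convex_cone_contains_0 intro: convex_cone_add\<close>)

text \<open>
  The space carries vectors \<open>e A\<close>, one for each cluster, and a subspace \<open>N\<close>. The functional
  \<open>\<psi> a b d\<close> plays the role of \<open>u \<mapsto> u\<^bsub>ab\<^esub> - u\<^bsub>ad\<^esub>\<close>, for the ultrametric \<open>u\<close> of a point.
\<close>

locale cluster_fan =
  fixes P :: "'b set" and N B :: "'a :: real_vector set"
    and e :: "'b set \<Rightarrow> 'a" and \<psi> :: "'b \<Rightarrow> 'b \<Rightarrow> 'b \<Rightarrow> 'a \<Rightarrow> real"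
  assumes P: "finite P"
    and B: "finite B" "independent B" "N = span B"
    and linear_\<psi>: "\<And>a b d. a \<in> P \<Longrightarrow> b \<in> P \<Longrightarrow> d \<in> P \<Longrightarrow> a \<noteq> b \<Longrightarrow> a \<noteq> d \<Longrightarrow> b \<noteq> d \<Longrightarrow> linear (\<psi> a b d)"
    and \<psi>_N: "\<And>a b d n. a \<in> P \<Longrightarrow> b \<in> P \<Longrightarrow> d \<in> P \<Longrightarrow> a \<noteq> b \<Longrightarrow> a \<noteq> d \<Longrightarrow> b \<noteq> d \<Longrightarrow> n \<in> N \<Longrightarrow> \<psi> a b d n = 0"
    and \<psi>_e: "\<And>a b d A. a \<in> P \<Longrightarrow> b \<in> P \<Longrightarrow> d \<in> P \<Longrightarrow> a \<noteq> b \<Longrightarrow> a \<noteq> d \<Longrightarrow> b \<noteq> d \<Longrightarrow> A \<in> clusters P \<Longrightarrow>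
      \<psi> a b d (e A) = of_bool (a \<in> A \<and> b \<in> A) - of_bool (a \<in> A \<and> d \<in> A)"
begin

text \<open>All cones share this parametrization over all clusters; a cone is singled out by the
  support of \<open>c\<close> only, which makes points of different cones comparable.\<close>

definition pt :: "'a \<Rightarrow> ('b set \<Rightarrow> real) \<Rightarrow> 'a" where
  "pt n c = n + (\<Sum>A\<in>clusters P. c A *\<^sub>R e A)"

definition weights :: "'b set set \<Rightarrow> ('b set \<Rightarrow> real) set" where
  "weights s = {c. (\<forall>A. c A \<ge> 0) \<and> {A. c A \<noteq> 0} \<subseteq> s}"

definition ccone :: "'b set set \<Rightarrow> 'a set" where
  "ccone s = {pt n c | n c. n \<in> N \<and> c \<in> weights s}"

definition cfan :: "'a set set" where "cfan = ccone ` families P"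

definition support :: "'a set" where "support = \<Union>cfan"

lemma subspace_N: "subspace N" using B by simp

lemma supp_family: "c \<in> weights s \<Longrightarrow> s \<in> families P \<Longrightarrow> {A. c A \<noteq> 0} \<in> families P"
  using families_subset by (auto simp: weights_def)

lemma \<psi>_pt:
  assumes "a \<in> P" "b \<in> P" "d \<in> P" "a \<noteq> b" "a \<noteq> d" "b \<noteq> d" "n \<in> N" "\<And>A. c A \<noteq> 0 \<Longrightarrow> A \<in> clusters P"
  shows "\<psi> a b d (pt n c) = cluster_sum P c a b - cluster_sum P c a d"
proof -
  interpret linear "\<psi> a b d" using assms by (intro linear_\<psi>)
  have "\<psi> a b d (pt n c) = (\<Sum>A\<in>clusters P. c A * \<psi> a b d (e A))"
    unfolding pt_def using \<psi>_N assms by (simp add: add sum scale)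
  also have "\<dots> = (\<Sum>A\<in>clusters P. c A * (of_bool (a \<in> A \<and> b \<in> A) - of_bool (a \<in> A \<and> d \<in> A)))"
    using \<psi>_e assms by simp
  also have "\<dots> = cluster_sum P c a b - cluster_sum P c a d"
    using cluster_sum_clusters[OF P, of c] assms(8) by (simp add: right_diff_distrib sum_subtractf)
  finally show ?thesis .
qed

lemma familyD: "s \<in> families P \<Longrightarrow> A \<in> s \<Longrightarrow> A \<in> clusters P"
  by (auto simp: families_def)

text \<open>The points of \<open>laminar_separate\<close> turn \<open>\<psi>\<close> into the
  coordinate functional of \<open>A\<close> on the cone of \<open>s\<close>.\<close>

lemma separating_functional:
  assumes s: "s \<in> families P" "A \<in> s"
  obtains a b d where "a \<in> P" "b \<in> P" "d \<in> P" "a \<noteq> b" "a \<noteq> d" "b \<noteq> d"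
    "\<And>D. D \<in> s \<Longrightarrow> \<psi> a b d (e D) = of_bool (D = A)"
    "\<And>n c. n \<in> N \<Longrightarrow> c \<in> weights s \<Longrightarrow> \<psi> a b d (pt n c) = c A"
proof -
  have lam: "laminar s" "A \<subset> P" "card A \<ge> 2" "\<And>D. D \<in> s \<Longrightarrow> D \<subseteq> P"
    using s by (auto simp: families_def clusters_def)
  obtain a b d where abd: "a \<in> A" "b \<in> A" "a \<noteq> b" "d \<in> P - A"
    and sep: "\<And>D. D \<in> s \<Longrightarrow> a \<in> D \<and> b \<in> D \<longleftrightarrow> A \<subseteq> D" "\<And>D. D \<in> s \<Longrightarrow> a \<in> D \<and> d \<in> D \<longleftrightarrow> A \<subset> D"
    by (rule laminar_separate[OF P lam(1) s(2) lam(2,3)], use lam(4) in blast, rule that)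
  have P3: "a \<in> P" "b \<in> P" "d \<in> P" "a \<noteq> b" "a \<noteq> d" "b \<noteq> d"
    using abd lam(2) by auto
  have 1: "\<psi> a b d (e D) = of_bool (D = A)" if "D \<in> s" for D
    using \<psi>_e[OF P3 familyD[OF s(1) that]] sep[OF that] by auto
  interpret linear "\<psi> a b d" using P3 by (rule linear_\<psi>)
  have 2: "\<psi> a b d (pt n c) = c A" if "n \<in> N" "c \<in> weights s" for n c
  proof -
    have "\<psi> a b d (pt n c) = (\<Sum>D\<in>clusters P. c D * \<psi> a b d (e D))"
      unfolding pt_def using \<psi>_N[OF P3 that(1)] by (simp add: add sum scale)
    also have "\<dots> = (\<Sum>D\<in>clusters P. if D = A then c D else 0)"
      using 1 that(2) by (intro sum.cong) (auto simp: weights_def)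
    also have "\<dots> = c A" using familyD[OF s] finite_clusters[OF P] by simp
    finally show ?thesis .
  qed
  show ?thesis by (rule that[OF P3 1 2])
qed

text \<open>The functionals recover all differences of cluster sums, and these determine the
  support. On the common support the separating functionals read off the weights. The two families
  may differ, so this also controls intersections of cones.\<close>

lemma pt_unique:
  assumes s: "s \<in> families P" "c \<in> weights s" "n \<in> N"
    and t: "t \<in> families P" "d \<in> weights t" "m \<in> N"
    and eq: "pt n c = pt m d"
  shows "c = d" "n = m"
proof -
  have fam: "{A. c A \<noteq> 0} \<in> families P" "{A. d A \<noteq> 0} \<in> families P"
    using s t supp_family by auto
  have cl: "\<And>A. c A \<noteq> 0 \<Longrightarrow> A \<in> clusters P" "\<And>A. d A \<noteq> 0 \<Longrightarrow> A \<in> clusters P"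
    using fam by (auto simp: families_def)
  have nn: "\<And>A. c A \<ge> 0" "\<And>A. d A \<ge> 0" using s t by (auto simp: weights_def)
  have diff: "cluster_sum P c x y - cluster_sum P c x z = cluster_sum P d x y - cluster_sum P d x z"
    if "x \<in> P" "y \<in> P" "z \<in> P" "x \<noteq> y" "x \<noteq> z" "y \<noteq> z" for x y z
    using \<psi>_pt[of x y z n c] \<psi>_pt[of x y z m d] that s(3) t(3) cl eq by simp
  have "d A \<noteq> 0" if "c A \<noteq> 0" for A
    by (rule supp_subset[OF P nn(1) fam(1) nn(2) fam(2) _ that]) (use diff in fastforce)
  moreover have "c A \<noteq> 0" if "d A \<noteq> 0" for A
    by (rule supp_subset[OF P nn(2) fam(2) nn(1) fam(1) _ that]) (use diff in fastforce)
  ultimately have supp: "{A. c A \<noteq> 0} = {A. d A \<noteq> 0}" by blast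
  have "c A = d A" for A
  proof (cases "c A = 0")
    case True
    thus ?thesis using supp by auto
  next
    case False
    hence "A \<in> {A. c A \<noteq> 0}" by simp
    with fam(1) obtain x y z where
      "\<And>n c'. n \<in> N \<Longrightarrow> c' \<in> weights {A. c A \<noteq> 0} \<Longrightarrow> \<psi> x y z (pt n c') = c' A"
      by (rule separating_functional) blast
    moreover have "c \<in> weights {A. c A \<noteq> 0}" "d \<in> weights {A. c A \<noteq> 0}"
      using nn supp by (auto simp: weights_def)
    ultimately show ?thesis using eq s(3) t(3) by metis
  qed
  thus "c = d" by blast
  thus "n = m" using eq by (simp add: pt_def)
qed

section \<open>Generators, faces and intersections of the cones\<close>

lemma pt_add: "pt n c + pt m d = pt (n + m) (\<lambda>A. c A + d A)"
  by (simp add: pt_def sum.distrib scaleR_add_left algebra_simps)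

lemma pt_scale: "r *\<^sub>R pt n c = pt (r *\<^sub>R n) (\<lambda>A. r * c A)"
  by (simp add: pt_def scaleR_add_right scaleR_sum_right)

lemma weights_add: "c \<in> weights s \<Longrightarrow> d \<in> weights s \<Longrightarrow> (\<lambda>A. c A + d A) \<in> weights s"
  unfolding weights_def by (auto simp: add_nonneg_eq_0_iff)

lemma weights_scale: "c \<in> weights s \<Longrightarrow> r \<ge> 0 \<Longrightarrow> (\<lambda>A. r * c A) \<in> weights s"
  unfolding weights_def by auto

lemma weights_mono: "r \<subseteq> s \<Longrightarrow> weights r \<subseteq> weights s"
  unfolding weights_def by auto

lemma ccone_mono: "r \<subseteq> s \<Longrightarrow> ccone r \<subseteq> ccone s"
  unfolding ccone_def using weights_mono by blast

lemma convex_cone_ccone: "convex_cone (ccone s)"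
  unfolding convex_cone_iff
proof (intro conjI ballI allI impI)
  have "pt 0 (\<lambda>_. 0) \<in> ccone s"
    unfolding ccone_def using subspace_0[OF subspace_N] by (auto simp: weights_def)
  thus "0 \<in> ccone s" by (simp add: pt_def)
  fix x assume x: "x \<in> ccone s"
  then obtain n c where nc: "n \<in> N" "c \<in> weights s" "x = pt n c" unfolding ccone_def by blast
  show "x + y \<in> ccone s" if "y \<in> ccone s" for y
  proof -
    obtain m d where md: "m \<in> N" "d \<in> weights s" "y = pt m d" using \<open>y \<in> ccone s\<close> unfolding ccone_def by blast
    have "n + m \<in> N" using nc md subspace_N by (intro subspace_add)
    thus ?thesis using weights_add[OF nc(2) md(2)] unfolding ccone_def nc(3) md(3) pt_add by blast
  qed
  show "r *\<^sub>R x \<in> ccone s" if "r \<ge> 0" for r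
  proof -
    have "r *\<^sub>R n \<in> N" using nc subspace_N by (intro subspace_scale)
    thus ?thesis using weights_scale[OF nc(2) that] unfolding ccone_def nc(3) pt_scale by blast
  qed
qed

lemma N_subset_ccone: "N \<subseteq> ccone s"
proof
  fix n assume "n \<in> N"
  moreover have "pt n (\<lambda>_. 0) = n" by (simp add: pt_def)
  moreover have "(\<lambda>_. 0) \<in> weights s" by (auto simp: weights_def)
  ultimately show "n \<in> ccone s" unfolding ccone_def by force
qed

lemma e_mem_ccone:
  assumes "A \<in> s" "s \<in> families P"
  shows "e A \<in> ccone s"
proof -
  have "e A = (\<Sum>D\<in>clusters P. if D = A then e D else 0)"
    using familyD[OF assms(2,1)] finite_clusters[OF P] by simp
  also have "\<dots> = (\<Sum>D\<in>clusters P. (of_bool (D = A) :: real) *\<^sub>R e D)"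
    by (intro sum.cong) auto
  finally have "pt 0 (\<lambda>D. of_bool (D = A)) = e A" by (simp add: pt_def)
  moreover have "(\<lambda>D. of_bool (D = A)) \<in> weights s" using assms by (auto simp: weights_def)
  ultimately show ?thesis unfolding ccone_def using subspace_0[OF subspace_N] by force
qed

text \<open>A subspace is the cone over a basis and its negatives; hence the cones are finitely
  generated in spite of their lineality.\<close>

lemma ccone_eq_hull:
  assumes "s \<in> families P"
  shows "ccone s = convex_cone hull (B \<union> uminus ` B \<union> e ` s)" (is "_ = ?H")
proof
  have "B \<union> uminus ` B \<subseteq> N" using B span_base[of _ B] span_neg[of _ B] by auto
  thus "?H \<subseteq> ccone s"
    using N_subset_ccone e_mem_ccone assms
    by (intro hull_minimal convex_cone_ccone) (meson Un_least image_subsetI order_trans)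
  have H: "convex_cone ?H" by (rule convex_cone_convex_cone_hull)
  have "n \<in> ?H" if "n \<in> span B" for n
    using that
  proof (induction rule: span_induct_alt)
    case (step c x y)
    have "c *\<^sub>R x \<in> ?H"
    proof (cases "c \<ge> 0")
      case True
      thus ?thesis using step by (intro convex_cone_scaleR[OF H]) (auto intro: hull_inc)
    next
      case False
      have "(- c) *\<^sub>R (- x) \<in> ?H" using step False by (intro convex_cone_scaleR[OF H]) (auto intro: hull_inc)
      thus ?thesis by simp
    qed
    thus ?case using step by (intro convex_cone_add[OF H]) auto
  qed (use H in \<open>simp add: convex_cone_contains_0\<close>)
  moreover have "(\<Sum>A\<in>clusters P. c A *\<^sub>R e A) \<in> ?H" if c: "c \<in> weights s" for c
  proof (rule convex_cone_sum[OF H])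
    fix A
    show "c A *\<^sub>R e A \<in> ?H"
    proof (cases "c A = 0")
      case False
      hence "A \<in> s" using c by (auto simp: weights_def)
      thus ?thesis using c by (intro convex_cone_scaleR[OF H]) (auto simp: weights_def intro: hull_inc)
    qed (use H in \<open>simp add: convex_cone_contains_0\<close>)
  qed
  ultimately show "ccone s \<subseteq> ?H"
    unfolding ccone_def pt_def using B(3) by (auto intro: convex_cone_add[OF H])
qed

text \<open>By uniqueness the weights of an inner point of a segment are the convex combination of
  those at its ends. As weights are nonnegative, one that vanishes inside vanishes at both
  ends.\<close>

lemma ccone_face:
  assumes s: "s \<in> families P" and "r \<subseteq> s"
  shows "ccone r face_of ccone s"
  unfolding face_of_def
proof (intro conjI ballI impI)
  show "ccone r \<subseteq> ccone s" using assms by (intro ccone_mono)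
  show "convex (ccone r)" using convex_cone_ccone by (auto simp: convex_cone_def)
  fix x y z assume xyz: "x \<in> ccone s" "y \<in> ccone s" "z \<in> ccone r" and seg: "z \<in> open_segment x y"
  from seg obtain q where q: "0 < q" "q < 1" "z = (1 - q) *\<^sub>R x + q *\<^sub>R y" by (auto simp: in_segment)
  obtain n c m d k h where nc: "n \<in> N" "c \<in> weights s" "x = pt n c"
    and md: "m \<in> N" "d \<in> weights s" "y = pt m d" and kh: "k \<in> N" "h \<in> weights r" "z = pt k h"
    using xyz unfolding ccone_def by blast
  have w: "(\<lambda>A. (1 - q) * c A + q * d A) \<in> weights s" "h \<in> weights s"
    using nc md q kh assms(2) weights_mono by (auto intro!: weights_add weights_scale)
  have "(1 - q) *\<^sub>R n + q *\<^sub>R m \<in> N"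
    using nc md subspace_N by (intro subspace_add subspace_scale)
  moreover have "pt ((1 - q) *\<^sub>R n + q *\<^sub>R m) (\<lambda>A. (1 - q) * c A + q * d A) = pt k h"
    using q(3) nc(3) md(3) kh(3) by (simp add: pt_add pt_scale)
  ultimately have h: "(\<lambda>A. (1 - q) * c A + q * d A) = h"
    using pt_unique[OF s w(1) _ s w(2) kh(1)] by blast
  have "c A = 0 \<and> d A = 0" if "A \<notin> r" for A
  proof -
    have "(1 - q) * c A + q * d A = 0" using fun_cong[OF h, of A] kh(2) that by (auto simp: weights_def)
    moreover have "(1 - q) * c A \<ge> 0" "q * d A \<ge> 0" using nc md q by (auto simp: weights_def)
    ultimately have "(1 - q) * c A = 0" "q * d A = 0" by linarith+
    thus ?thesis using q by simp
  qed
  hence "c \<in> weights r" "d \<in> weights r" using nc md by (auto simp: weights_def)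
  thus "x \<in> ccone r" "y \<in> ccone r" using nc md unfolding ccone_def by blast+
qed

text \<open>A common point has only one weight function, so its support lies in both
  families.\<close>

lemma ccone_Int:
  assumes "s \<in> families P" "t \<in> families P"
  shows "ccone s \<inter> ccone t = ccone (s \<inter> t)"
proof
  show "ccone s \<inter> ccone t \<subseteq> ccone (s \<inter> t)"
  proof
    fix x assume "x \<in> ccone s \<inter> ccone t"
    then obtain n c m d where nc: "n \<in> N" "c \<in> weights s" "x = pt n c"
      and md: "m \<in> N" "d \<in> weights t" "x = pt m d" unfolding ccone_def by blast
    have "c = d" using pt_unique[OF assms(1) nc(2,1) assms(2) md(2,1)] nc md by simp
    hence "c \<in> weights (s \<inter> t)" using nc md by (auto simp: weights_def)
    thus "x \<in> ccone (s \<inter> t)" using nc unfolding ccone_def by blast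
  qed
qed (use ccone_mono in blast)

text \<open>Let \<open>r\<close> collect the clusters with positive weight at some point of
  \<open>D\<close>. The multiple of \<open>e A\<close> splits off such a point as a summand in the
  cone, so the face contains \<open>e A\<close>; likewise it contains \<open>N\<close>, since
  \<open>n + - n = 0\<close>.\<close>

lemma face_of_ccone:
  assumes s: "s \<in> families P" and D: "D face_of ccone s" "D \<noteq> {}"
  shows "\<exists>r\<subseteq>s. D = ccone r"
proof -
  have "conic (ccone s)" using convex_cone_ccone[of s] by (simp add: convex_cone_def)
  hence "conic D" using D(1) face_of_conic by blast
  hence D': "convex_cone D" using face_of_imp_convex[OF D(1)] D(2) by (auto simp: convex_cone_def)
  note face = mem_face_of_cone[OF D(1) convex_cone_ccone D']
  define r where "r = {A. \<exists>n c. n \<in> N \<and> c \<in> weights s \<and> pt n c \<in> D \<and> c A \<noteq> 0}"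
  have "r \<subseteq> s" by (auto simp: r_def weights_def)
  moreover have "D \<subseteq> ccone r"
  proof
    fix x assume x: "x \<in> D"
    hence "x \<in> ccone s" using face_of_imp_subset[OF D(1)] by blast
    then obtain n c where nc: "n \<in> N" "c \<in> weights s" "x = pt n c" unfolding ccone_def by blast
    hence "c \<in> weights r" using x by (auto simp: r_def weights_def)
    thus "x \<in> ccone r" using nc unfolding ccone_def by blast
  qed
  moreover have "ccone r \<subseteq> D"
  proof -
    have r: "r \<in> families P" using families_subset[OF s] \<open>r \<subseteq> s\<close> by blast
    have N: "n \<in> D" if "n \<in> N" for n
    proof -
      have "n \<in> ccone s" "- n \<in> ccone s" using that N_subset_ccone subspace_neg[OF subspace_N] by blast+
      moreover have "n + - n \<in> D" using D' by (simp add: convex_cone_contains_0)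
      ultimately show ?thesis by (rule face)
    qed
    have e: "e A \<in> D" if A: "A \<in> r" for A
    proof -
      obtain n c where nc: "n \<in> N" "c \<in> weights s" "pt n c \<in> D" "c A \<noteq> 0" using A by (auto simp: r_def)
      have cA: "c A > 0" using nc by (auto simp: weights_def less_le)
      have As: "A \<in> s" using A \<open>r \<subseteq> s\<close> by blast
      have "(\<Sum>D\<in>clusters P. c D *\<^sub>R e D) = c A *\<^sub>R e A + (\<Sum>D\<in>clusters P - {A}. c D *\<^sub>R e D)"
        using finite_clusters[OF P] familyD[OF s As] by (rule sum.remove)
      also have "(\<Sum>D\<in>clusters P - {A}. c D *\<^sub>R e D) = (\<Sum>D\<in>clusters P. (c(A := 0)) D *\<^sub>R e D)"
        using finite_clusters[OF P] by (intro sum.mono_neutral_cong_left) auto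
      finally have "pt n c = c A *\<^sub>R e A + pt n (c(A := 0))" by (simp add: pt_def algebra_simps)
      moreover have "c A *\<^sub>R e A \<in> ccone s"
        using e_mem_ccone[OF As s] cA by (intro convex_cone_scaleR[OF convex_cone_ccone]) auto
      moreover have "c(A := 0) \<in> weights s" using nc by (auto simp: weights_def split: if_splits)
      hence "pt n (c(A := 0)) \<in> ccone s" using nc(1) unfolding ccone_def by blast
      ultimately have "c A *\<^sub>R e A \<in> D" using nc(3) face by metis
      thus ?thesis using convex_cone_scaleR[OF D', of "inverse (c A)" "c A *\<^sub>R e A"] cA by simp
    qed
    have "B \<union> uminus ` B \<subseteq> N" using B span_base[of _ B] span_neg[of _ B] by auto
    thus ?thesis unfolding ccone_eq_hull[OF r] using N e by (intro hull_minimal D') blast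
  qed
  ultimately show ?thesis by blast
qed

lemma fan_cfan: "fan cfan"
  unfolding fan_def
proof (intro conjI ballI allI impI)
  show "finite cfan" unfolding cfan_def using finite_families[OF P] by simp
  show "cfan \<noteq> {}" unfolding cfan_def families_def laminar_def by auto
  show "polyhedral_cone C" if C: "C \<in> cfan" for C
  proof -
    obtain s where s: "s \<in> families P" "C = ccone s" using C unfolding cfan_def by blast
    thus ?thesis unfolding polyhedral_cone_def using ccone_eq_hull[OF s(1)] B(1) finite_family[OF P s(1)]
      by (intro exI[of _ "B \<union> uminus ` B \<union> e ` s"]) auto
  qed
  show "D \<in> cfan" if C: "C \<in> cfan" and D: "D face_of C \<and> D \<noteq> {}" for C D
  proof -
    obtain s where s: "s \<in> families P" "C = ccone s" using C unfolding cfan_def by blast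
    obtain r where "r \<subseteq> s" "D = ccone r" using face_of_ccone[OF s(1)] D s(2) by blast
    thus ?thesis unfolding cfan_def using families_subset[OF s(1)] by blast
  qed
  show "C \<inter> D face_of C" "C \<inter> D face_of D" if CD: "C \<in> cfan" "D \<in> cfan" for C D
  proof -
    obtain s t where "s \<in> families P" "C = ccone s" "t \<in> families P" "D = ccone t"
      using CD unfolding cfan_def by blast
    thus "C \<inter> D face_of C" "C \<inter> D face_of D" by (auto simp: ccone_Int intro: ccone_face)
  qed
qed

text \<open>
  If the ultrametrics \<open>u\<close>, \<open>v\<close> and \<open>u + v\<close> of three points of the support are such that
  \<open>u\<^bsub>ab\<^esub> > u\<^bsub>ad\<^esub> = u\<^bsub>bd\<^esub>\<close>, then \<open>v\<^bsub>ab\<^esub> \<ge> v\<^bsub>ad\<^esub> = v\<^bsub>bd\<^esub>\<close>, as otherwise \<open>u + v\<close> would have a unique minimum on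
  the triangle. Thus no cluster is cancelled in \<open>u + v\<close>.
\<close>

lemma supp_sum:
  assumes s: "s \<in> families P" "c \<in> weights s" "n \<in> N"
    and t: "t \<in> families P" "d \<in> weights t" "m \<in> N"
    and r: "r \<in> families P" "k \<in> weights r" "l \<in> N"
    and eq: "pt n c + pt m d = pt l k" and A: "c A \<noteq> 0"
  shows "k A \<noteq> 0"
proof -
  have fam: "{A. c A \<noteq> 0} \<in> families P" "{A. d A \<noteq> 0} \<in> families P" "{A. k A \<noteq> 0} \<in> families P"
    using s t r supp_family by auto
  have cl: "\<And>A. c A \<noteq> 0 \<Longrightarrow> A \<in> clusters P" "\<And>A. d A \<noteq> 0 \<Longrightarrow> A \<in> clusters P" "\<And>A. k A \<noteq> 0 \<Longrightarrow> A \<in> clusters P"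
    using fam by (auto simp: families_def)
  have nn: "\<And>A. c A \<ge> 0" "\<And>A. d A \<ge> 0" "\<And>A. k A \<ge> 0" using s t r by (auto simp: weights_def)
  have ult: "ultra P (cluster_sum P c)" "ultra P (cluster_sum P d)" "ultra P (cluster_sum P k)"
    using nn fam by (auto simp: families_def intro!: ultra_cluster_sum[OF P])
  have diff: "(cluster_sum P c x y - cluster_sum P c x z) + (cluster_sum P d x y - cluster_sum P d x z)
      = cluster_sum P k x y - cluster_sum P k x z"
    if xyz: "x \<in> P" "y \<in> P" "z \<in> P" "x \<noteq> y" "x \<noteq> z" "y \<noteq> z" for x y z
  proof -
    have "\<psi> x y z (pt n c) + \<psi> x y z (pt m d) = \<psi> x y z (pt l k)"
      unfolding eq[symmetric] using linear_add[OF linear_\<psi>[OF xyz]] by simp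
    thus ?thesis
      using \<psi>_pt[of x y z n c] \<psi>_pt[of x y z m d] \<psi>_pt[of x y z l k] xyz s(3) t(3) r(3) cl by simp
  qed
  show ?thesis
  proof (rule supp_subset[OF P nn(1) fam(1) nn(3) fam(3) _ A])
    fix a b x assume *: "a \<in> P" "b \<in> P" "x \<in> P" "a \<noteq> b" "a \<noteq> x" "b \<noteq> x"
      and less: "cluster_sum P c a x < cluster_sum P c a b" "cluster_sum P c b x < cluster_sum P c b a"
    have sym: "f b a = f a b" "f x a = f a x" "f x b = f b x" if "ultra P f" for f
      using ultra_sym[OF that] * by metis+
    \<comment> \<open>All three ultrametric inequalities of the triangle \<open>a b x\<close>.
      Together with additivity of two differences they reduce the claim to linear arithmetic with
      cases.\<close>
    have tri: "(f a x \<le> f a b \<or> f b x \<le> f a b) \<and> (f a b \<le> f a x \<or> f b x \<le> f a x) \<and>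
        (f a b \<le> f b x \<or> f a x \<le> f b x)" if "ultra P f" for f
      using ultraD[OF that, of a b x] ultraD[OF that, of a x b] ultraD[OF that, of b x a] * sym[OF that] by auto
    show "cluster_sum P k a x < cluster_sum P k a b"
      using tri[OF ult(1)] tri[OF ult(2)] tri[OF ult(3)] less sym(1)[OF ult(1)] sym(1)[OF ult(2)] sym(1)[OF ult(3)]
        diff[of a b x] diff[of b a x] * by argo
  qed
qed

text \<open>The sum of the generators of a cone \<open>D\<close> in the support has a family
  \<open>t\<close> of positive weights. By \<open>supp_sum\<close> no cluster of a generator is lost
  in the sum, so every generator lies in \<open>ccone t\<close>.\<close>

lemma coarsest_cfan: "coarsest_fan_structure support cfan"
  unfolding coarsest_fan_structure_def
proof (intro conjI allI impI ballI)
  show "fan_structure support cfan" by (simp add: fan_structure_def fan_cfan support_def)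
  fix G D assume G: "fan_structure support G" and D: "D \<in> G"
  have "polyhedral_cone D" using G D unfolding fan_structure_def by (blast dest: fan_polyhedral)
  then obtain S where S: "finite S" "D = convex_cone hull S" unfolding polyhedral_cone_def by blast
  have DX: "D \<subseteq> support" using G D unfolding fan_structure_def by blast
  have cD: "convex_cone D" unfolding S(2) by (rule convex_cone_convex_cone_hull)
  have SD: "S \<subseteq> D" unfolding S(2) by (rule hull_subset)
  have ex: "\<exists>s n c. s \<in> families P \<and> c \<in> weights s \<and> n \<in> N \<and> x = pt n c" if "x \<in> D" for x
  proof -
    have "x \<in> \<Union>(ccone ` families P)" using that DX unfolding support_def cfan_def by blast
    thus ?thesis unfolding ccone_def by blast
  qed
  have "\<Sum>S \<in> D" using SD by (intro convex_cone_sum[OF cD]) auto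
  then obtain r l k where r: "r \<in> families P" "k \<in> weights r" "l \<in> N" and xk: "\<Sum>S = pt l k" using ex by blast
  define t where "t = {A. k A \<noteq> 0}"
  have t: "t \<in> families P" using supp_family[OF r(2,1)] by (simp add: t_def)
  have "S \<subseteq> ccone t"
  proof
    fix y assume y: "y \<in> S"
    have eq: "y + \<Sum>(S - {y}) = \<Sum>S" using S(1) y by (simp add: sum.remove)
    have "\<Sum>(S - {y}) \<in> D" using SD by (intro convex_cone_sum[OF cD]) auto
    then obtain s m d where d: "s \<in> families P" "d \<in> weights s" "m \<in> N" "\<Sum>(S - {y}) = pt m d" using ex by blast
    obtain s' n c where c: "s' \<in> families P" "c \<in> weights s'" "n \<in> N" "y = pt n c" using ex y SD by blast
    have "k A \<noteq> 0" if "c A \<noteq> 0" for A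
      using supp_sum[OF c(1-3) d(1-3) r _ that] eq c(4) d(4) xk by simp
    hence "c \<in> weights t" using c(2) by (auto simp: t_def weights_def)
    thus "y \<in> ccone t" unfolding ccone_def using c by blast
  qed
  hence "D \<subseteq> ccone t" unfolding S(2) by (rule hull_minimal) (rule convex_cone_ccone)
  thus "\<exists>C\<in>cfan. D \<subseteq> C" unfolding cfan_def using t by blast
qed

text \<open>The functional separating \<open>A\<close> kills \<open>B\<close> and the other rays of
  \<open>s\<close> but takes the value 1 on \<open>e A\<close>.\<close>

lemma e_notin_span:
  assumes "s \<in> families P" "A \<in> s" "r \<subseteq> s - {A}"
  shows "e A \<notin> span (B \<union> e ` r)"
proof
  assume mem: "e A \<in> span (B \<union> e ` r)"
  obtain a b d where abd: "a \<in> P" "b \<in> P" "d \<in> P" "a \<noteq> b" "a \<noteq> d" "b \<noteq> d"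
    and \<psi>: "\<And>D. D \<in> s \<Longrightarrow> \<psi> a b d (e D) = of_bool (D = A)"
    by (rule separating_functional[OF assms(1,2)], rule that)
  have "\<psi> a b d (e A) = 0"
  proof (rule linear_eq_0_on_span[OF linear_\<psi>[OF abd] _ mem])
    fix x assume "x \<in> B \<union> e ` r"
    thus "\<psi> a b d x = 0"
      using \<psi>_N[OF abd, of x] B(3) span_base[of x B] \<psi> assms(3) by auto
  qed
  thus False using \<psi>[OF assms(2)] by simp
qed

section \<open>Independence, dimension and maximal cones\<close>

lemma independent_family:
  assumes s: "s \<in> families P"
  shows "independent (B \<union> e ` s)" "card (B \<union> e ` s) = card B + card s"
proof -
  have "finite s" using finite_family[OF P s] .
  moreover have "s \<subseteq> s" ..
  ultimately have "independent (B \<union> e ` s) \<and> card (B \<union> e ` s) = card B + card s"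
  proof (induction rule: finite_subset_induct')
    case (insert A r)
    have ni: "e A \<notin> span (B \<union> e ` r)" using insert.hyps by (intro e_notin_span[OF s]) auto
    have "independent (insert (e A) (B \<union> e ` r))"
      using independent_insertI[OF ni] insert.IH by simp
    moreover have "e A \<notin> B \<union> e ` r" using ni span_base[of "e A" "B \<union> e ` r"] by argo
    ultimately show ?case using insert B(1) by simp
  qed (use B in auto)
  thus "independent (B \<union> e ` s)" "card (B \<union> e ` s) = card B + card s" by blast+
qed

lemma span_ccone:
  assumes s: "s \<in> families P"
  shows "span (ccone s) = span (B \<union> e ` s)"
proof (rule span_eq[THEN iffD2], rule conjI)
  have "B \<subseteq> N" using B span_superset by blast
  thus "B \<union> e ` s \<subseteq> span (ccone s)"
    using e_mem_ccone[OF _ s] N_subset_ccone[of s] span_superset[of "ccone s"] by blast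
  have "c A *\<^sub>R e A \<in> span (B \<union> e ` s)" if "c \<in> weights s" for c A
  proof (cases "c A = 0")
    case False
    hence "A \<in> s" using that by (auto simp: weights_def)
    thus ?thesis by (intro span_scale span_base) auto
  qed (simp add: span_0)
  thus "ccone s \<subseteq> span (B \<union> e ` s)"
    unfolding ccone_def pt_def using B(3) span_mono[of B "B \<union> e ` s"] by (auto intro!: span_add span_sum)
qed

lemma dim_ccone: "s \<in> families P \<Longrightarrow> dim (ccone s) = card B + card s"
  by (metis dim_span span_ccone dim_eq_card_independent independent_family)

text \<open>Dimension decides: an inclusion makes the cones of \<open>s \<inter> t\<close> and
  \<open>s\<close> equal, and the dimension counts clusters.\<close>

lemma ccone_subset_iff:
  assumes "s \<in> families P" "t \<in> families P"
  shows "ccone s \<subseteq> ccone t \<longleftrightarrow> s \<subseteq> t"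
proof
  assume "ccone s \<subseteq> ccone t"
  hence "ccone (s \<inter> t) = ccone s" using ccone_Int[OF assms] by blast
  moreover have st: "s \<inter> t \<in> families P" using families_subset[OF assms(1)] by blast
  ultimately have "card (s \<inter> t) = card s" using dim_ccone[OF assms(1)] dim_ccone[OF st] by simp
  thus "s \<subseteq> t" using finite_family[OF P assms(1)] by (metis card_subset_eq inf_le1 inf_le2)
qed (rule ccone_mono)

lemma inj_on_ccone: "inj_on ccone (families P)"
  using ccone_subset_iff by (intro inj_onI) (metis subset_antisym subset_refl)

lemma maximal_cfan: "maximal_cones cfan = ccone ` {s \<in> families P. \<forall>t\<in>families P. s \<subseteq> t \<longrightarrow> t = s}"
proof -
  have "(\<forall>D\<in>cfan. ccone s \<subseteq> D \<longrightarrow> D = ccone s) \<longleftrightarrow> (\<forall>t\<in>families P. s \<subseteq> t \<longrightarrow> t = s)"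
    if s: "s \<in> families P" for s
    using s by (simp add: cfan_def ccone_subset_iff[OF s] inj_on_eq_iff[OF inj_on_ccone])
  hence "ccone ` {s \<in> families P. \<forall>D\<in>cfan. ccone s \<subseteq> D \<longrightarrow> D = ccone s} =
      ccone ` {s \<in> families P. \<forall>t\<in>families P. s \<subseteq> t \<longrightarrow> t = s}"
    by (intro image_cong Collect_cong) auto
  moreover have "{C \<in> ccone ` families P. Q C} = ccone ` {s \<in> families P. Q (ccone s)}" for Q
    by blast
  ultimately show ?thesis unfolding maximal_cones_def cfan_def by simp
qed

text \<open>Opposite points add up to the origin, whose weights are 0 by uniqueness; nonnegative
  weights with sum 0 vanish.\<close>

lemma pointed_cfan:
  assumes "N = {0}"
  shows "pointed cfan"
  unfolding pointed_def
proof (intro ballI allI impI)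
  fix C x assume "C \<in> cfan" and x: "x \<in> C \<and> - x \<in> C"
  then obtain s where s: "s \<in> families P" "C = ccone s" unfolding cfan_def by blast
  obtain n c m d where nc: "n \<in> N" "c \<in> weights s" "x = pt n c"
    and md: "m \<in> N" "d \<in> weights s" "- x = pt m d" using x s(2) unfolding ccone_def by blast
  have "pt (n + m) (\<lambda>A. c A + d A) = pt 0 (\<lambda>_. 0)"
    unfolding pt_add[symmetric] nc(3)[symmetric] md(3)[symmetric] by (simp add: pt_def)
  moreover have "n + m \<in> N" "0 \<in> N" using nc md subspace_N by (auto intro: subspace_add subspace_0)
  moreover have "(\<lambda>A. c A + d A) \<in> weights s" "(\<lambda>_. 0) \<in> weights s"
    using weights_add[OF nc(2) md(2)] by (simp_all add: weights_def)
  ultimately have "(\<lambda>A. c A + d A) = (\<lambda>_. 0)" using pt_unique(1)[OF s(1) _ _ s(1)] by blast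
  hence "c A + d A = 0" for A by (rule fun_cong)
  moreover have "c A \<ge> 0" "d A \<ge> 0" for A using nc md by (auto simp: weights_def)
  ultimately have "c A = 0" for A by (metis add_nonneg_eq_0_iff)
  thus "x = 0" using nc assms by (simp add: pt_def)
qed

lemma fan_dim_cfan:
  assumes "\<And>s. s \<in> families P \<Longrightarrow> card s \<le> d" "s \<in> families P" "card s = d"
  shows "fan_dim cfan = card B + d"
  unfolding fan_dim_def
proof (rule Max_eqI)
  show "finite (dim ` cfan)" using finite_families[OF P] by (simp add: cfan_def)
  show "y \<le> card B + d" if "y \<in> dim ` cfan" for y
    using that assms(1) by (auto simp: cfan_def dim_ccone)
  show "card B + d \<in> dim ` cfan"
    using assms(2,3) dim_ccone[OF assms(2)] unfolding cfan_def image_image by (intro image_eqI[of _ _ s]) auto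
qed

lemma pure_dim_cfan:
  assumes "\<And>s. s \<in> families P \<Longrightarrow> (\<forall>t\<in>families P. s \<subseteq> t \<longrightarrow> t = s) \<Longrightarrow> card s = d"
  shows "pure_dim (card B + d) cfan"
  unfolding pure_dim_def maximal_cfan using assms by (auto simp: dim_ccone)

text \<open>All multiplicities are 1. By purity the maximal cones around the cone of
  \<open>t\<close> arise by adding one cluster \<open>A\<close>, and \<open>e A\<close> serves as
  primitive generator. The balancing condition is then the hypothesis \<open>link\<close>.\<close>

lemma balanced_cfan:
  assumes \<Lambda>: "B \<subseteq> \<Lambda>" "\<And>A. A \<in> clusters P \<Longrightarrow> e A \<in> \<Lambda>" "\<And>x. x \<in> \<Lambda> \<Longrightarrow> - x \<in> \<Lambda>"
      "\<And>x y z. x \<in> \<Lambda> \<Longrightarrow> y \<in> \<Lambda> \<Longrightarrow> x - of_int z *\<^sub>R y \<in> \<Lambda>"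
    and int: "\<And>a b d x. a \<in> P \<Longrightarrow> b \<in> P \<Longrightarrow> d \<in> P \<Longrightarrow> a \<noteq> b \<Longrightarrow> a \<noteq> d \<Longrightarrow> b \<noteq> d \<Longrightarrow> x \<in> \<Lambda> \<Longrightarrow> \<psi> a b d x \<in> \<int>"
    and bound: "\<And>s. s \<in> families P \<Longrightarrow> card s \<le> k" "s0 \<in> families P" "card s0 = k"
    and pure: "\<And>s. s \<in> families P \<Longrightarrow> (\<forall>t\<in>families P. s \<subseteq> t \<longrightarrow> t = s) \<Longrightarrow> card s = k"
    and link: "\<And>t. t \<in> families P \<Longrightarrow> card t + 1 = k \<Longrightarrow>
      (\<Sum>A | A \<notin> t \<and> insert A t \<in> families P. e A) \<in> span (B \<union> e ` t)"
  shows "balanced \<Lambda> cfan"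
  unfolding balanced_def
proof (intro conjI ballI exI[of _ "\<lambda>_. 1"] impI)
  show "\<exists>S. finite S \<and> S \<subseteq> \<Lambda> \<and> C = convex_cone hull S" if C: "C \<in> cfan" for C
  proof -
    obtain s where s: "s \<in> families P" "C = ccone s" using C unfolding cfan_def by blast
    have "e ` s \<subseteq> \<Lambda>" using familyD[OF s(1)] \<Lambda>(2) by blast
    thus ?thesis using \<Lambda>(1,3) ccone_eq_hull[OF s(1)] s(2) B(1) finite_family[OF P s(1)]
      by (intro exI[of _ "B \<union> uminus ` B \<union> e ` s"]) auto
  qed
  fix T assume T: "T \<in> cfan" "dim T + 1 = fan_dim cfan"
  obtain t where t: "t \<in> families P" "T = ccone t" using T(1) unfolding cfan_def by blast
  have cardt: "card t + 1 = k" using T(2) dim_ccone[OF t(1)] t(2) fan_dim_cfan[OF bound] by simp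
  define E where "E = {A. A \<notin> t \<and> insert A t \<in> families P}"
  define h where "h = (\<lambda>A. ccone (insert A t))"
  have inj: "inj_on h E"
  proof (rule inj_onI)
    fix A A' assume "A \<in> E" "A' \<in> E" "h A = h A'"
    hence "insert A t = insert A' t" using inj_on_ccone unfolding E_def h_def inj_on_def by blast
    thus "A = A'" using \<open>A \<in> E\<close> \<open>A' \<in> E\<close> unfolding E_def by blast
  qed
  have max: "{C. C \<in> maximal_cones cfan \<and> T \<subseteq> C} = h ` E"
  proof (intro equalityI subsetI)
    fix C assume "C \<in> {C. C \<in> maximal_cones cfan \<and> T \<subseteq> C}"
    hence C: "C \<in> ccone ` {s \<in> families P. \<forall>t\<in>families P. s \<subseteq> t \<longrightarrow> t = s}" "T \<subseteq> C"
      unfolding maximal_cfan by auto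
    then obtain s where s: "s \<in> families P" "\<forall>t\<in>families P. s \<subseteq> t \<longrightarrow> t = s" "C = ccone s" by blast
    have ts: "t \<subseteq> s" using C(2) s(3) t ccone_subset_iff[OF t(1) s(1)] by simp
    have "card (s - t) = 1"
      using pure[OF s(1,2)] cardt card_Diff_subset[OF finite_family[OF P t(1)] ts] by simp
    then obtain A where "s - t = {A}" by (auto simp: card_1_singleton_iff)
    hence "s = insert A t" "A \<notin> t" using ts by auto
    thus "C \<in> h ` E" using s(1,3) unfolding E_def h_def by blast
  next
    fix C assume "C \<in> h ` E"
    then obtain A where A: "A \<notin> t" "insert A t \<in> families P" "C = ccone (insert A t)"
      unfolding E_def h_def by blast
    have "s = insert A t" if s: "s \<in> families P" "insert A t \<subseteq> s" for s
    proof -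
      have "card s \<le> card (insert A t)"
        using bound(1)[OF s(1)] cardt A(1) finite_family[OF P t(1)] by simp
      thus ?thesis using s(2) finite_family[OF P s(1)] card_seteq by blast
    qed
    hence "C \<in> maximal_cones cfan" unfolding maximal_cfan using A by blast
    moreover have "T \<subseteq> C" using t(2) A(3) ccone_mono[of t "insert A t"] by blast
    ultimately show "C \<in> {C. C \<in> maximal_cones cfan \<and> T \<subseteq> C}" by blast
  qed
  define u where "u = (\<lambda>C. e (the_inv_into E h C))"
  have u: "u (h A) = e A" if "A \<in> E" for A
    using that inj by (simp add: u_def the_inv_into_f_f)
  show "\<exists>u. (\<forall>C\<in>maximal_cones cfan. T \<subseteq> C \<longrightarrow> primitive_generator \<Lambda> T C (u C)) \<and>
      (\<Sum>C | C \<in> maximal_cones cfan \<and> T \<subseteq> C. real 1 *\<^sub>R u C) \<in> span T"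
  proof (intro exI[of _ u] conjI ballI impI)
    have "(\<Sum>C | C \<in> maximal_cones cfan \<and> T \<subseteq> C. real 1 *\<^sub>R u C) = (\<Sum>A\<in>E. e A)"
      unfolding max using inj u by (simp add: sum.reindex)
    thus "(\<Sum>C | C \<in> maximal_cones cfan \<and> T \<subseteq> C. real 1 *\<^sub>R u C) \<in> span T"
      using link[OF t(1) cardt] span_ccone[OF t(1)] t(2) unfolding E_def by simp
    fix C assume "C \<in> maximal_cones cfan" "T \<subseteq> C"
    hence "C \<in> h ` E" using max by blast
    then obtain A where A: "A \<in> E" "C = h A" by blast
    have fam: "insert A t \<in> families P" "A \<notin> t" using A(1) by (auto simp: E_def)
    show "primitive_generator \<Lambda> T C (u C)"
      unfolding primitive_generator_def
    proof (intro conjI ballI)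
      have "e A \<in> C" using e_mem_ccone[OF _ fam(1)] A(2) by (simp add: h_def)
      thus "u C \<in> \<Lambda> \<inter> C" using A u[OF A(1)] \<Lambda>(2) familyD[OF fam(1)] by simp
      fix x assume x: "x \<in> \<Lambda> \<inter> span C"
      obtain a b d where abd: "a \<in> P" "b \<in> P" "d \<in> P" "a \<noteq> b" "a \<noteq> d" "b \<noteq> d"
        and \<psi>: "\<And>D. D \<in> insert A t \<Longrightarrow> \<psi> a b d (e D) = of_bool (D = A)"
        by (rule separating_functional[OF fam(1) insertI1], rule that)
      have "x \<in> span (insert (e A) (B \<union> e ` t))"
        using x A(2) span_ccone[OF fam(1)] by (simp add: h_def)
      then obtain q where q: "x - q *\<^sub>R e A \<in> span (B \<union> e ` t)" by (auto simp: span_breakdown_eq)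
      \<comment> \<open>The functional reads off the coefficient \<open>q\<close> of
        \<open>e A\<close>. Since it is integral on the lattice, \<open>q\<close> is an
        integer.\<close>
      have "\<psi> a b d (x - q *\<^sub>R e A) = 0"
      proof (rule linear_eq_0_on_span[OF linear_\<psi>[OF abd] _ q])
        fix y assume "y \<in> B \<union> e ` t"
        thus "\<psi> a b d y = 0"
          using \<psi>_N[OF abd, of y] B(3) span_base[of y B] \<psi> fam(2) by auto
      qed
      hence "\<psi> a b d x = q"
        using \<psi>[of A] linear_diff[OF linear_\<psi>[OF abd]] linear_scale[OF linear_\<psi>[OF abd]] by simp
      moreover have "\<psi> a b d x \<in> \<int>" using int[OF abd] x by blast
      ultimately obtain z where z: "q = of_int z" by (auto elim: Ints_cases)
      have "x - of_int z *\<^sub>R u C \<in> \<Lambda> \<inter> span T"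
        using q x z \<Lambda>(2,4) A u[OF A(1)] familyD[OF fam(1)] t(2) span_ccone[OF t(1)] by simp
      thus "\<exists>z. x - of_int z *\<^sub>R u C \<in> \<Lambda> \<inter> span T" by blast
    qed
  qed
qed simp

section \<open>The simplicial complex under the fan\<close>

lemma inj_on_e: "s \<in> families P \<Longrightarrow> inj_on e s"
proof (rule inj_onI, rule ccontr)
  fix A D assume s: "s \<in> families P" "A \<in> s" "D \<in> s" "e A = e D" "A \<noteq> D"
  hence "e A \<notin> span (B \<union> e ` {D})" by (intro e_notin_span[OF s(1)]) auto
  moreover have "e A \<in> span (B \<union> e ` {D})" using s(4) by (intro span_base) simp
  ultimately show False by blast
qed

lemma
  assumes "B = {}"
  shows fan_over_cfan: "fan_over ((`) e ` families P) cfan"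
    and card_complex: "card {r \<in> (`) e ` families P. card r = i} = card {s \<in> families P. card s = i}"
proof -
  have hull: "convex_cone hull (e ` s) = ccone s" if "s \<in> families P" for s
    using ccone_eq_hull[OF that] assms by simp
  have inj: "inj_on ((`) e) (families P)"
    using inj_on_ccone hull by (intro inj_onI) (metis inj_onD)
  show "fan_over ((`) e ` families P) cfan"
    unfolding fan_over_def
  proof (intro conjI ballI)
    show "abstract_simplicial_complex ((`) e ` families P)"
      unfolding abstract_simplicial_complex_def
    proof (intro conjI ballI allI impI)
      show "{} \<in> (`) e ` families P" by (auto simp: families_def laminar_def)
      show "finite r" if "r \<in> (`) e ` families P" for r using that finite_family[OF P] by auto
      show "r \<in> (`) e ` families P" if r: "q \<in> (`) e ` families P" "r \<subseteq> q" for q r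
      proof -
        obtain s where s: "s \<in> families P" "q = e ` s" using r by blast
        then obtain s' where "s' \<subseteq> s" "r = e ` s'" using r(2) by (meson subset_imageE)
        thus ?thesis using families_subset[OF s(1)] by blast
      qed
    qed (use finite_families[OF P] in auto)
    show "independent r" if "r \<in> (`) e ` families P" for r
      using that independent_family(1) assms by auto
    show "bij_betw (\<lambda>s. convex_cone hull s) ((`) e ` families P) cfan"
      using inj_on_ccone hull by (auto simp: bij_betw_def inj_on_def cfan_def image_image)
  qed
  have "{r \<in> (`) e ` families P. card r = i} = (`) e ` {s \<in> families P. card s = i}"
    using card_image[OF inj_on_e] by auto
  moreover have "inj_on ((`) e) {s \<in> families P. card s = i}"
    using inj by (rule inj_on_subset) auto
  ultimately show "card {r \<in> (`) e ` families P. card r = i} = card {s \<in> families P. card s = i}"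
    by (simp add: card_image)
qed

lemma complex_dim_cfan:
  assumes "\<And>s. s \<in> families P \<Longrightarrow> card s \<le> d" "s \<in> families P" "card s = d"
  shows "complex_dim ((`) e ` families P) = int d - 1"
  unfolding complex_dim_def
proof (rule Max_eqI)
  show "finite ((\<lambda>s. int (card s) - 1) ` (`) e ` families P)" using finite_families[OF P] by simp
  show "y \<le> int d - 1" if "y \<in> (\<lambda>s. int (card s) - 1) ` (`) e ` families P" for y
    using that assms(1) card_image[OF inj_on_e] by fastforce
  show "int d - 1 \<in> (\<lambda>s. int (card s) - 1) ` (`) e ` families P"
    using assms(2,3) card_image[OF inj_on_e[OF assms(2)]] by (intro image_eqI[of _ _ "e ` s"]) auto
qed

end

section \<open>Laminar families of clusters in five points\<close>

text \<open>Incompatible sublists are pruned during the recursion: the 25 clusters have 2^25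
  sublists, far too many to enumerate and filter.\<close>

fun sorted_sublists :: "('b \<Rightarrow> 'b \<Rightarrow> bool) \<Rightarrow> 'b list \<Rightarrow> 'b list list" where
  "sorted_sublists R [] = [[]]"
| "sorted_sublists R (x # xs) =
    (let r = sorted_sublists R xs in map (Cons x) (filter (list_all (R x)) r) @ r)"

lemma sorted_sublists_eq: "sorted_sublists R xs = filter (sorted_wrt R) (subseqs xs)"
  by (induction xs) (auto simp: Let_def filter_map o_def list_all_iff conj_commute)

lemma subseqs_map: "subseqs (map f xs) = map (map f) (subseqs xs)"
  by (induction xs) (auto simp: Let_def)

text \<open>Membership tests on lists, rather than inclusions of sets, keep the predicate
  executable.\<close>

definition nested_or_disjoint :: "nat list \<Rightarrow> nat list \<Rightarrow> bool" where
  "nested_or_disjoint xs ys \<longleftrightarrow> list_all (\<lambda>x. x \<in> set ys) xs \<or> list_all (\<lambda>y. y \<in> set xs) ys \<or>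
     list_all (\<lambda>x. x \<notin> set ys) xs"

definition cluster_lists :: "nat list list" where
  "cluster_lists = filter (\<lambda>l. 2 \<le> length l \<and> length l \<le> 4) (subseqs [1, 2, 3, 4, 5])"

definition family_lists :: "nat list list list" where
  "family_lists = sorted_sublists nested_or_disjoint cluster_lists"

definition family_of :: "nat list list \<Rightarrow> nat set set" where
  "family_of l = set (map set l)"

definition extensions :: "nat list list \<Rightarrow> nat list list" where
  "extensions l = filter (\<lambda>x. x \<notin> set l \<and> list_all (nested_or_disjoint x) l) cluster_lists"

definition pair_count :: "nat \<times> nat \<Rightarrow> nat list list \<Rightarrow> nat" where
  "pair_count p l = length (filter (\<lambda>x. fst p \<in> set x \<and> snd p \<in> set x) l)"

definition pairs5 :: "(nat \<times> nat) list" where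
  "pairs5 = [(1,2),(1,3),(1,4),(1,5),(2,3),(2,4),(2,5),(3,4),(3,5),(4,5)]"

text \<open>25 = 10 + 10 + 5 subsets of sizes 2, 3 and 4. The last 105 = 7 * 5 * 3 is the number of
  trivalent trees with six labelled leaves.\<close>

lemma family_lists_counts:
  "map (\<lambda>i. length (filter (\<lambda>l. length l = i) family_lists)) [1, 2, 3] = [25, 105, 105]"
  by code_simp

lemma family_lists_length: "list_all (\<lambda>l. length l \<le> 3) family_lists"
  by code_simp

lemma family_lists_extend: "list_all (\<lambda>l. length l < 3 \<longrightarrow> extensions l \<noteq> []) family_lists"
  by code_simp

text \<open>A family of two clusters is a tree in which one node has three children
  \<open>X\<close>, \<open>Y\<close>, \<open>Z\<close>. The clusters that can be added are the
  unions of two of them; together they count each pair as often as \<open>X\<close>,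
  \<open>Y\<close>, \<open>Z\<close> and their union do. That union is in the family or is the whole
  set, so a suitable \<open>S\<close> exists.\<close>

lemma family_lists_link:
  "list_all (\<lambda>l. length l = 2 \<longrightarrow>
     list_ex (\<lambda>S. list_all (\<lambda>p. pair_count p (extensions l) = pair_count p S) pairs5)
       (subseqs ([1, 2, 3, 4, 5] # l))) family_lists"
  by code_simp

section \<open>From lists to laminar families of sets\<close>

lemma in_set_subseqs_subset: "l \<in> set (subseqs xs) \<Longrightarrow> set l \<subseteq> set xs"
  using subseqs_powset[of xs] by blast

lemma inj_on_set_cluster_lists: "distinct (map set cluster_lists)"
proof -
  have "distinct (map set (subseqs [1, 2, 3, 4, 5 :: nat]))"
    by (rule distinct_set_subseqs) simp
  thus ?thesis unfolding cluster_lists_def distinct_map by (auto intro: inj_on_subset)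
qed

lemma clusters_5: "clusters {1..5} = set ` set cluster_lists"
proof -
  have P: "{1..5 :: nat} = set [1, 2, 3, 4, 5]" by auto
  have card: "card (set l) = length l" if "l \<in> set (subseqs [1, 2, 3, 4, 5 :: nat])" for l
    using subseqs_distinctD[OF that] distinct_card[of l] by simp
  have sub: "A \<subset> {1..5} \<longleftrightarrow> A \<subseteq> {1..5} \<and> card A \<le> 4" for A :: "nat set"
  proof
    assume "A \<subset> {1..5}"
    thus "A \<subseteq> {1..5} \<and> card A \<le> 4" using psubset_card_mono[of "{1..5}" A] by auto
  qed auto
  have "clusters {1..5 :: nat} = {A \<in> Pow (set [1, 2, 3, 4, 5]). 2 \<le> card A \<and> card A \<le> 4}"
    unfolding clusters_def sub unfolding P by auto
  also have "\<dots> = set ` set cluster_lists"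
  proof -
    have "{A \<in> set ` Y. 2 \<le> card A \<and> card A \<le> 4} = set ` {l \<in> Y. 2 \<le> length l \<and> length l \<le> 4}"
      if "\<And>l. l \<in> Y \<Longrightarrow> card (set l) = length l" for Y :: "nat list set"
      using that by auto
    from this[OF card] show ?thesis
      unfolding subseqs_powset[symmetric] cluster_lists_def set_filter .
  qed
  finally show ?thesis .
qed

lemma nested_or_disjoint_iff:
  "nested_or_disjoint xs ys \<longleftrightarrow> set xs \<subseteq> set ys \<or> set ys \<subseteq> set xs \<or> set xs \<inter> set ys = {}"
  unfolding nested_or_disjoint_def list_all_iff by (auto simp: subset_iff disjoint_iff)

lemma laminar_family_of: "laminar (family_of l) \<longleftrightarrow> sorted_wrt nested_or_disjoint l"
proof (induction l)
  case (Cons x l)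
  have "laminar (family_of (x # l)) \<longleftrightarrow> laminar (family_of l) \<and> (\<forall>y\<in>set l. nested_or_disjoint x y)"
  proof
    assume "laminar (family_of (x # l))"
    thus "laminar (family_of l) \<and> (\<forall>y\<in>set l. nested_or_disjoint x y)"
      unfolding laminar_def family_of_def nested_or_disjoint_iff by simp
  next
    assume *: "laminar (family_of l) \<and> (\<forall>y\<in>set l. nested_or_disjoint x y)"
    have "\<forall>B\<in>family_of l. set x \<subseteq> B \<or> B \<subseteq> set x \<or> set x \<inter> B = {}"
      using * unfolding nested_or_disjoint_iff family_of_def by simp
    thus "laminar (family_of (x # l))"
      using * unfolding laminar_def family_of_def by (auto simp: Int_commute)
  qed
  thus ?case using Cons by auto
qed (simp add: laminar_def family_of_def)

lemma families_5: "families {1..5} = family_of ` set family_lists"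
proof -
  have "families {1..5} = {s \<in> Pow (set (map set cluster_lists)). laminar s}"
    unfolding families_def clusters_5 by auto
  also have "\<dots> = {s \<in> family_of ` set (subseqs cluster_lists). laminar s}"
    unfolding subseqs_powset[symmetric] subseqs_map by (simp add: family_of_def image_image)
  also have "\<dots> = family_of ` set family_lists"
    unfolding family_lists_def sorted_sublists_eq using laminar_family_of by auto
  finally show ?thesis .
qed

lemma distinct_family_lists: "distinct (map family_of family_lists)"
proof -
  have "distinct (map set (subseqs (map set cluster_lists)))"
    by (rule distinct_set_subseqs) (rule inj_on_set_cluster_lists)
  hence "distinct (map family_of (subseqs cluster_lists))"
    unfolding subseqs_map by (simp add: family_of_def[abs_def] o_def)
  thus ?thesis unfolding family_lists_def sorted_sublists_eq distinct_map by (auto intro: inj_on_subset)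
qed

lemma distinct_family:
  assumes "l \<in> set family_lists"
  shows "distinct (map set l)"
proof -
  have "l \<in> set (subseqs cluster_lists)" using assms by (simp add: family_lists_def sorted_sublists_eq)
  hence "map set l \<in> set (subseqs (map set cluster_lists))" unfolding subseqs_map by simp
  thus ?thesis using inj_on_set_cluster_lists by (rule subseqs_distinctD)
qed

lemma card_family_of: "l \<in> set family_lists \<Longrightarrow> card (family_of l) = length l"
  using distinct_card[OF distinct_family] by (simp add: family_of_def)

lemma card_families_5:
  "card {s \<in> families {1..5 :: nat}. card s = i} = length (filter (\<lambda>l. length l = i) family_lists)"
proof -
  have "{s \<in> families {1..5}. card s = i} = family_of ` set (filter (\<lambda>l. length l = i) family_lists)"
    unfolding families_5 using card_family_of by auto
  moreover have "card \<dots> = length (filter (\<lambda>l. length l = i) family_lists)"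
  proof (subst card_image)
    show "inj_on family_of (set (filter (\<lambda>l. length l = i) family_lists))"
      using distinct_family_lists by (auto simp: distinct_map intro: inj_on_subset)
    have "distinct (filter (\<lambda>l. length l = i) family_lists)"
      using distinct_family_lists by (simp add: distinct_map)
    thus "card (set (filter (\<lambda>l. length l = i) family_lists)) = length (filter (\<lambda>l. length l = i) family_lists)"
      by (rule distinct_card)
  qed
  ultimately show ?thesis by simp
qed

lemma card_family_5_le: "s \<in> families {1..5 :: nat} \<Longrightarrow> card s \<le> 3"
  using family_lists_length card_family_of unfolding families_5 list_all_iff by auto

lemma extensions_5:
  assumes l: "l \<in> set family_lists"
  shows "{A. A \<notin> family_of l \<and> insert A (family_of l) \<in> families {1..5}} = set ` set (extensions l)"
proof -
  have lam: "laminar (family_of l)" "family_of l \<subseteq> clusters {1..5}"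
    using l families_5 by (auto simp: families_def)
  have lcl: "set l \<subseteq> set cluster_lists"
    using l by (auto simp: family_lists_def sorted_sublists_eq dest: in_set_subseqs_subset)
  have 1: "set x \<in> family_of l \<longleftrightarrow> x \<in> set l" if "x \<in> set cluster_lists" for x
    using that lcl inj_on_set_cluster_lists by (auto simp: family_of_def distinct_map dest: inj_onD)
  have 2: "insert (set x) (family_of l) \<in> families {1..5} \<longleftrightarrow> list_all (nested_or_disjoint x) l"
    if "x \<in> set cluster_lists" for x
  proof -
    have "insert (set x) (family_of l) \<in> families {1..5} \<longleftrightarrow> laminar (family_of (x # l))"
      using lam(2) that clusters_5 by (auto simp: families_def family_of_def)
    also have "\<dots> \<longleftrightarrow> list_all (nested_or_disjoint x) l"
      using lam(1) by (simp add: laminar_family_of list_all_iff)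
    finally show ?thesis .
  qed
  show ?thesis
  proof (intro equalityI subsetI)
    fix A assume A: "A \<in> {A. A \<notin> family_of l \<and> insert A (family_of l) \<in> families {1..5}}"
    hence "A \<in> clusters {1..5}" by (auto simp: families_def)
    then obtain x where x: "x \<in> set cluster_lists" "A = set x" using clusters_5 by blast
    with A 1[OF x(1)] 2[OF x(1)] show "A \<in> set ` set (extensions l)" by (auto simp: extensions_def)
  qed (use 1 2 in \<open>auto simp: extensions_def\<close>)
qed

lemma maximal_family_5:
  assumes "s \<in> families {1..5 :: nat}" "\<forall>t\<in>families {1..5}. s \<subseteq> t \<longrightarrow> t = s"
  shows "card s = 3"
proof (rule ccontr)
  assume "card s \<noteq> 3"
  then obtain l where l: "l \<in> set family_lists" "s = family_of l" "length l < 3"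
    using assms(1) card_family_5_le[OF assms(1)] card_family_of unfolding families_5 by fastforce
  hence "extensions l \<noteq> []" using family_lists_extend by (auto simp: list_all_iff)
  then obtain A where "A \<in> set ` set (extensions l)" by (cases "extensions l") auto
  hence "A \<notin> s" "insert A s \<in> families {1..5}" using extensions_5[OF l(1)] l(2) by auto
  thus False using assms(2) by blast
qed

lemma link_family_5:
  assumes t: "t \<in> families {1..5 :: nat}" "card t = 2"
  shows "\<exists>S\<subseteq>insert {1..5} t. \<forall>i\<in>{1..5}. \<forall>j\<in>{1..5}. i \<noteq> j \<longrightarrow>
    (\<Sum>A | A \<notin> t \<and> insert A t \<in> families {1..5}. of_bool (i \<in> A \<and> j \<in> A) :: real) =
    (\<Sum>A\<in>S. of_bool (i \<in> A \<and> j \<in> A))"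
proof -
  obtain l where l: "l \<in> set family_lists" "t = family_of l" using t families_5 by auto
  hence "length l = 2" using card_family_of t by simp
  then obtain S where S: "S \<in> set (subseqs ([1, 2, 3, 4, 5] # l))"
    "\<forall>p\<in>set pairs5. pair_count p (extensions l) = pair_count p S"
    using family_lists_link l(1) unfolding list_all_iff list_ex_iff by blast
  have P: "set [1, 2, 3, 4, 5 :: nat] = {1..5}" by auto
  have cnt: "pair_count (i, j) xs = (\<Sum>A\<in>set ` set xs. of_bool (i \<in> A \<and> j \<in> A) :: real)"
    if "distinct (map set xs)" for i j xs
  proof -
    have "pair_count (i, j) xs = (\<Sum>x\<leftarrow>xs. of_bool (i \<in> set x \<and> j \<in> set x) :: real)"
      by (induction xs) (auto simp: pair_count_def)
    also have "\<dots> = (\<Sum>A\<leftarrow>map set xs. of_bool (i \<in> A \<and> j \<in> A))" by (simp add: o_def)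
    also have "\<dots> = (\<Sum>A\<in>set (map set xs). of_bool (i \<in> A \<and> j \<in> A))"
      using that by (rule sum_list_distinct_conv_sum_set)
    finally show ?thesis by simp
  qed
  \<comment> \<open>The whole set is no cluster, so prepending it keeps the entries distinct as
    sets, and counting list entries equals summing over sets.\<close>
  have "{1..5} \<notin> t" using t(1) by (auto simp: families_def clusters_def)
  hence "distinct (map set ([1, 2, 3, 4, 5] # l))"
    using distinct_family[OF l(1)] P l(2) by (auto simp: family_of_def)
  hence dS: "distinct (map set S)"
  proof (rule subseqs_distinctD[rotated])
    show "map set S \<in> set (subseqs (map set ([1, 2, 3, 4, 5] # l)))"
      unfolding subseqs_map set_map using S(1) by (rule imageI)
  qed
  have dE: "distinct (map set (extensions l))"
    using inj_on_set_cluster_lists unfolding extensions_def distinct_map by (auto intro: inj_on_subset)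
  show ?thesis
  proof (intro exI[of _ "set ` set S"] conjI ballI impI)
    have "set S \<subseteq> set ([1, 2, 3, 4, 5] # l)" using S(1) by (rule in_set_subseqs_subset)
    thus "set ` set S \<subseteq> insert {1..5} t" using P l(2) by (auto simp: family_of_def)
    fix i j :: nat assume ij: "i \<in> {1..5}" "j \<in> {1..5}" "i \<noteq> j"
    have "i \<in> {1, 2, 3, 4, 5}" "j \<in> {1, 2, 3, 4, 5}" using ij by auto
    hence "(i, j) \<in> set pairs5 \<or> (j, i) \<in> set pairs5" using ij(3) by (auto simp: pairs5_def)
    moreover have "pair_count (j, i) xs = pair_count (i, j) xs" for xs
      by (simp add: pair_count_def conj_commute)
    ultimately have "pair_count (i, j) (extensions l) = pair_count (i, j) S" using S(2) by metis
    thus "(\<Sum>A | A \<notin> t \<and> insert A t \<in> families {1..5}. of_bool (i \<in> A \<and> j \<in> A) :: real) =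
        (\<Sum>A\<in>set ` set S. of_bool (i \<in> A \<and> j \<in> A))"
      using cnt[OF dE, of i j] cnt[OF dS, of i j] extensions_5[OF l(1)] l(2) by simp
  qed
qed

section \<open>Pairs and triples\<close>

abbreviation pair :: "nat \<Rightarrow> nat \<Rightarrow> (2, 6) ksub" where "pair a b \<equiv> Ksub {a, b}"

abbreviation triple :: "nat \<Rightarrow> nat \<Rightarrow> nat \<Rightarrow> (3, 6) ksub" where "triple a b c \<equiv> Ksub {a, b, c}"

lemma elems_pair: "a \<in> {1..6} \<Longrightarrow> b \<in> {1..6} \<Longrightarrow> a \<noteq> b \<Longrightarrow> elems (pair a b) = {a, b}"
  by (subst Ksub_inverse) auto

lemma elems_triple:
  "a \<in> {1..6} \<Longrightarrow> b \<in> {1..6} \<Longrightarrow> c \<in> {1..6} \<Longrightarrow> a \<noteq> b \<Longrightarrow> a \<noteq> c \<Longrightarrow> b \<noteq> c \<Longrightarrow>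
    elems (triple a b c) = {a, b, c}"
  by (subst Ksub_inverse) auto

lemma pairE:
  obtains a b where "J = pair a b" "a < b" "a \<in> {1..6}" "b \<in> {1..6}"
proof -
  obtain x y where xy: "elems J = {x, y}" "x \<noteq> y" using card_elems[of J] by (auto simp: card_2_iff)
  hence J: "J = pair x y" "J = pair y x" using elems_inverse[of J] by (simp_all add: insert_commute)
  have "x \<in> {1..6}" "y \<in> {1..6}" using elems[of J] xy by auto
  thus ?thesis using that[of x y] that[of y x] J xy(2) by (cases "x < y") auto
qed

lemma tripleE:
  obtains a b c where "I = triple a b c" "a < b" "b < c" "a \<in> {1..6}" "b \<in> {1..6}" "c \<in> {1..6}"
proof -
  have card: "card (elems I) = 3" using card_elems[of I] by simp
  define l where "l = sorted_list_of_set (elems I)"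
  have l: "length l = 3" "set l = elems I" "sorted_wrt (<) l"
    using card by (auto simp: l_def)
  obtain a b c where abc: "l = [a, b, c]" using l(1) by (auto simp: length_Suc_conv numeral_3_eq_3)
  have "elems I \<subseteq> {1..6}" using elems[of I] by auto
  moreover have "elems I = {a, b, c}" using l(2) abc by simp
  ultimately show ?thesis
    using that[of a b c] l(3) abc elems_inverse[of I] by simp
qed

lemma compl_triple:
  assumes "{a, b, c} \<union> {d, e, f} = {1..6}" "card {a, b, c} = 3" "{a, b, c} \<inter> {d, e, f} = {}"
  shows "ksub_compl (triple a b c) = triple d e f"
proof -
  have "elems (triple a b c) = {a, b, c}" using assms by (subst Ksub_inverse) auto
  hence "elems (ksub_compl (triple a b c)) = {d, e, f}" using assms by (auto simp: ksub_compl.rep_eq)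
  thus ?thesis by (metis elems_inverse)
qed


section \<open>Pluecker coordinates\<close>

text \<open>Columns may come in any order and may coincide, which makes the relations below
  polynomial identities; \<open>plucker\<close> sees increasing columns only.\<close>

definition minor2 :: "(nat \<Rightarrow> nat \<Rightarrow> 'b :: comm_ring_1) \<Rightarrow> nat \<Rightarrow> nat \<Rightarrow> 'b" where
  "minor2 M a b = M 0 a * M 1 b - M 0 b * M 1 a"

definition minor3 :: "(nat \<Rightarrow> nat \<Rightarrow> 'b :: comm_ring_1) \<Rightarrow> nat \<Rightarrow> nat \<Rightarrow> nat \<Rightarrow> 'b" where
  "minor3 M a b c = M 0 a * M 1 b * M 2 c + M 0 b * M 1 c * M 2 a + M 0 c * M 1 a * M 2 b
    - M 0 a * M 1 c * M 2 b - M 0 b * M 1 a * M 2 c - M 0 c * M 1 b * M 2 a"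

lemma plucker_pair:
  assumes "a \<in> {1..6}" "b \<in> {1..6}" "a < b"
  shows "plucker M (pair a b) = minor2 M a b"
proof -
  have el: "elems (pair a b) = {a, b}" using assms by (intro elems_pair) auto
  have l: "sorted_list_of_set {a, b} = [a, b]" using assms by simp
  have c: "card {a, b} = 2" using assms by simp
  have s: "{..<2} = insert 0 {1 :: nat}" by auto
  show ?thesis
    unfolding plucker_def el c l Let_def s
    by (subst sum_over_permutations_insert)
      (auto simp: permutes_sing sign_swap_id transpose_def minor2_def)
qed

lemma plucker_triple:
  assumes "a \<in> {1..6}" "b \<in> {1..6}" "c \<in> {1..6}" "a < b" "b < c"
  shows "plucker M (triple a b c) = minor3 M a b c"
proof -
  have el: "elems (triple a b c) = {a, b, c}" using assms by (intro elems_triple) auto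
  have l: "sorted_list_of_set {a, b, c} = [a, b, c]" using assms by simp
  have c: "card {a, b, c} = 3" using assms by simp
  have s: "{..<3} = insert 0 (insert 1 {2 :: nat})" by auto
  show ?thesis
    unfolding plucker_def el c l Let_def s
    by (subst sum_over_permutations_insert, simp, simp, subst sum_over_permutations_insert)
      (auto simp: permutes_sing sign_compose permutation_swap_id sign_swap_id transpose_def minor3_def
        algebra_simps)
qed

text \<open>The parity of the inversions, that is, the sign of sorting three distinct
  columns.\<close>

definition order_sign :: "nat \<Rightarrow> nat \<Rightarrow> nat \<Rightarrow> 'b :: comm_ring_1" where
  "order_sign a b c = (if a < b then 1 else -1) * (if a < c then 1 else -1) * (if b < c then 1 else -1)"

lemma order_sign: "order_sign a b c \<in> {1, -1}"
  by (auto simp: order_sign_def)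

lemma plucker_triple_order_sign:
  assumes "a \<in> {1..6}" "b \<in> {1..6}" "c \<in> {1..6}" "a \<noteq> b" "a \<noteq> c" "b \<noteq> c"
  shows "minor3 M a b c = order_sign a b c * plucker M (triple a b c)"
proof -
  have perm: "triple b a c = triple a b c" "triple a c b = triple a b c" "triple b c a = triple a b c"
    "triple c a b = triple a b c" "triple c b a = triple a b c"
    by (simp_all add: insert_commute)
  consider "a < b" "b < c" | "a < c" "c < b" | "b < a" "a < c" | "b < c" "c < a" | "c < a" "a < b" | "c < b" "b < a"
    using assms by linarith
  thus ?thesis
    using plucker_triple[of a b c M] plucker_triple[of a c b M] plucker_triple[of b a c M]
      plucker_triple[of b c a M] plucker_triple[of c a b M] plucker_triple[of c b a M] assms
    by cases (auto simp: order_sign_def minor3_def perm)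
qed

lemma plucker_relation:
  "minor3 M s r a * minor3 M b c d - minor3 M s r b * minor3 M a c d
    + minor3 M s r c * minor3 M a b d - minor3 M s r d * minor3 M a b c = 0"
  unfolding minor3_def by (simp add: algebra_simps)

lemma minor2_relation: "minor2 M a b * minor2 M c d - minor2 M a c * minor2 M b d + minor2 M a d * minor2 M b c = 0"
  unfolding minor2_def by (simp add: algebra_simps)

text \<open>A homogeneous Vandermonde determinant: the columns are points
  \<open>(x^2, x * y, y^2)\<close> of a conic.\<close>

lemma minor3_veronese:
  "minor3 (\<lambda>r i. M 0 i ^ (2 - r) * M 1 i ^ r) a b c = minor2 M a b * minor2 M a c * minor2 M b c"
  unfolding minor3_def minor2_def by (simp add: algebra_simps power2_eq_square)

section \<open>Relations and tropical points\<close>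

text \<open>Monomials are encoded as lists of variables with multiplicities as exponents, so
  distinct multisets give distinct exponent vectors.\<close>

lemma prod_power_count_list:
  "(\<Prod>i\<in>UNIV. (p :: 'i :: finite \<Rightarrow> 'b :: field) i powi int (count_list xs i)) = (\<Prod>x\<leftarrow>xs. p x)"
proof (induction xs)
  case (Cons x xs)
  have "(\<Prod>i\<in>UNIV. p i powi int (count_list (x # xs) i)) =
      (\<Prod>i\<in>UNIV. (if i = x then p i else 1) * p i powi int (count_list xs i))"
    by (intro prod.cong) auto
  also have "\<dots> = p x * (\<Prod>i\<in>UNIV. p i powi int (count_list xs i))"
    by (simp add: prod.distrib)
  finally show ?case using Cons by simp
qed simp

lemma sum_count_list:
  "(\<Sum>i\<in>UNIV. of_int (int (count_list xs i)) * (w :: real ^ 'i :: finite) $ i) = (\<Sum>x\<leftarrow>xs. w $ x)"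
proof (induction xs)
  case (Cons x xs)
  have "(\<Sum>i\<in>UNIV. of_int (int (count_list (x # xs) i)) * w $ i) =
      (\<Sum>i\<in>UNIV. (if i = x then w $ i else 0) + of_int (int (count_list xs i)) * w $ i)"
    by (intro sum.cong) (auto simp: algebra_simps)
  also have "\<dots> = w $ x + (\<Sum>i\<in>UNIV. of_int (int (count_list xs i)) * w $ i)"
    by (simp add: sum.distrib)
  finally show ?case using Cons by simp
qed simp

lemma tropicalization_relation_lists:
  fixes w :: "real ^ ('i :: finite)"
  assumes "w \<in> tropicalization X" "finite A" "A \<noteq> {}"
    and "\<And>i j. i \<in> A \<Longrightarrow> j \<in> A \<Longrightarrow> i \<noteq> j \<Longrightarrow> mset (xs i) \<noteq> mset (xs j)"
    and "\<And>j. j \<in> A \<Longrightarrow> \<epsilon> j \<in> {1, -1}"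
    and "\<And>p. p \<in> X \<Longrightarrow> (\<Sum>j\<in>A. \<epsilon> j * (\<Prod>x\<leftarrow>xs j. p x)) = 0"
  shows "min_attained_twice A (\<lambda>j. \<Sum>x\<leftarrow>xs j. w $ x)"
proof -
  have inj: "inj_on (\<lambda>j i. int (count_list (xs j) i)) A"
  proof (rule inj_onI)
    fix i j assume *: "i \<in> A" "j \<in> A" "(\<lambda>k. int (count_list (xs i) k)) = (\<lambda>k. int (count_list (xs j) k))"
    hence "count_list (xs i) k = count_list (xs j) k" for k by (metis of_nat_eq_iff)
    hence "mset (xs i) = mset (xs j)" by (intro multiset_eqI) (simp add: count_mset)
    thus "i = j" using assms(4) * by blast
  qed
  show ?thesis
    using tropicalization_relation[OF assms(1-3) inj, of \<epsilon>] assms(5,6)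
    unfolding prod_power_count_list sum_count_list by simp
qed

lemma tropicalization_binomial_lists:
  fixes w :: "real ^ ('i :: finite)"
  assumes "w \<in> tropicalization X" "\<epsilon> \<in> {1, -1}"
    and "\<And>p. p \<in> X \<Longrightarrow> (\<Prod>x\<leftarrow>xs. p x) = \<epsilon> * (\<Prod>x\<leftarrow>ys. p x)"
  shows "(\<Sum>x\<leftarrow>xs. w $ x) = (\<Sum>x\<leftarrow>ys. w $ x)"
  using tropicalization_binomial[OF assms(1,2), of "\<lambda>i. int (count_list xs i)" "\<lambda>i. int (count_list ys i)"]
    assms(3)
  unfolding prod_power_count_list sum_count_list by simp

text \<open>
  If \<open>S \<subseteq> T\<close>, the relation is trivial and its two terms are the same monomial.
\<close>

lemma tropicalization_Gr_36_relation:
  fixes w :: "real ^ (3, 6) ksub"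
  assumes w: "w \<in> tropicalization Gr_open"
    and S: "S \<subseteq> {1..6}" "card S = 2" and T: "T \<subseteq> {1..6}" "card T = 4"
  shows "min_attained_twice (T - S) (\<lambda>j. w $ Ksub (insert j S) + w $ Ksub (T - {j}))"
proof (cases "S \<subseteq> T")
  case True
  have fin: "finite S" "finite T" using S T by (auto intro: finite_subset)
  have "card (T - S) = 2" using S T True fin by (simp add: card_Diff_subset)
  then obtain j k where jk: "T - S = {j, k}" "j \<noteq> k" by (auto simp: card_2_iff)
  have "T = insert j (insert k S)" using jk(1) True by blast
  hence "T - {j} = insert k S" "T - {k} = insert j S" using jk by auto
  thus ?thesis unfolding min_attained_twice_def jk(1) using jk(2) by auto
next
  case False
  obtain s r where sr: "S = {s, r}" "s \<noteq> r" using S(2) by (auto simp: card_2_iff)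
  obtain a b c d where abcd: "T = {a, b, c, d}" "a \<noteq> b" "a \<noteq> c" "a \<noteq> d" "b \<noteq> c" "b \<noteq> d" "c \<noteq> d"
    using T(2) by (auto simp: card_Suc_eq numeral_eq_Suc)
  have range: "s \<in> {1..6}" "r \<in> {1..6}" "a \<in> {1..6}" "b \<in> {1..6}" "c \<in> {1..6}" "d \<in> {1..6}"
    using S(1) T(1) sr abcd by auto
  define rest where "rest = (\<lambda>j. if j = a then (b, c, d) else if j = b then (a, c, d)
    else if j = c then (a, b, d) else (a, b, c))"
  define \<epsilon> :: "nat \<Rightarrow> puiseux" where "\<epsilon> = (\<lambda>j. (if j = a \<or> j = c then 1 else -1) * order_sign s r j *
    (case rest j of (x, y, z) \<Rightarrow> order_sign x y z))"
  have ne: "T - S \<noteq> {}"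
  proof
    assume "T - S = {}"
    hence "card T \<le> card S" using sr(1) by (intro card_mono) auto
    thus False using S T by simp
  qed
  \<comment> \<open>Since \<open>S\<close> is not contained in \<open>T\<close>, no set
    \<open>insert j S\<close> is of the form \<open>T - {k}\<close>; hence the monomials are
    distinct.\<close>
  have key: "insert j S = insert k S \<or> insert j S = T - {k} \<Longrightarrow> j = k" if "j \<in> T - S" "k \<in> T - S" for j k
    using that False by auto
  have el: "elems (Ksub (insert j S) :: (3, 6) ksub) = insert j S" "elems (Ksub (T - {j}) :: (3, 6) ksub) = T - {j}"
    if "j \<in> T - S" for j
    using that S T finite_subset[OF S(1)] finite_subset[OF T(1)]
    by (subst Ksub_inverse; auto simp: card_Diff_singleton_if)+
  have "min_attained_twice (T - S) (\<lambda>j. \<Sum>x\<leftarrow>[Ksub (insert j S), Ksub (T - {j})]. w $ x)"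
  proof (rule tropicalization_relation_lists[OF w, where \<epsilon> = \<epsilon>])
    show "finite (T - S)" using abcd by simp
    show "T - S \<noteq> {}" by (rule ne)
    show "\<epsilon> j \<in> {1, -1}" for j
    proof -
      obtain x y z where "rest j = (x, y, z)" by (cases "rest j")
      moreover have "order_sign s r j \<in> {1, -1 :: puiseux}" "order_sign x y z \<in> {1, -1 :: puiseux}"
        by (rule order_sign)+
      ultimately show ?thesis unfolding \<epsilon>_def by auto
    qed
    show "mset [Ksub (insert i S), Ksub (T - {i}) :: (3, 6) ksub] \<noteq> mset [Ksub (insert j S), Ksub (T - {j})]"
      if "i \<in> T - S" "j \<in> T - S" "i \<noteq> j" for i j
    proof
      assume "mset [Ksub (insert i S), Ksub (T - {i}) :: (3, 6) ksub] = mset [Ksub (insert j S), Ksub (T - {j})]"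
      hence "(Ksub (insert i S) :: (3, 6) ksub) \<in># mset [Ksub (insert j S), Ksub (T - {j})]"
        by (metis list.set_intros(1) set_mset_mset)
      hence "elems (Ksub (insert i S) :: (3, 6) ksub) \<in>
          {elems (Ksub (insert j S) :: (3, 6) ksub), elems (Ksub (T - {j}) :: (3, 6) ksub)}" by auto
      thus False using key[OF that(1,2)] el that by auto
    qed
    fix p :: "(3, 6) ksub \<Rightarrow> puiseux" assume "p \<in> Gr_open"
    then obtain M where M: "p = plucker M" by (auto simp: Gr_open_def Gr_def)
    define R where "R = (\<lambda>j. (if j = a \<or> j = c then 1 else -1) * minor3 M s r j *
      (case rest j of (x, y, z) \<Rightarrow> minor3 M x y z))"
    have "\<epsilon> j * (\<Prod>x\<leftarrow>[Ksub (insert j S), Ksub (T - {j})]. p x) = R j" if j: "j \<in> T - S" for j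
    proof -
      have 1: "minor3 M s r j = order_sign s r j * p (Ksub (insert j S))"
        using plucker_triple_order_sign[of s r j M] range sr j abcd M by (auto simp: insert_commute)
      have 2: "(case rest j of (x, y, z) \<Rightarrow> minor3 M x y z) =
          (case rest j of (x, y, z) \<Rightarrow> order_sign x y z) * p (Ksub (T - {j}))"
      proof -
        consider "j = a" | "j = b" | "j = c" | "j = d" using j abcd by auto
        thus ?thesis
        proof cases
          case 1
          moreover have "T - {a} = {b, c, d}" using abcd by auto
          ultimately show ?thesis
            using plucker_triple_order_sign[of b c d M] range abcd M by (simp add: rest_def)
        next
          case 2
          moreover have "T - {b} = {a, c, d}" using abcd by auto
          ultimately show ?thesis
            using plucker_triple_order_sign[of a c d M] range abcd M by (simp add: rest_def)
        next
          case 3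
          moreover have "T - {c} = {a, b, d}" using abcd by auto
          ultimately show ?thesis
            using plucker_triple_order_sign[of a b d M] range abcd M by (simp add: rest_def)
        next
          case 4
          moreover have "T - {d} = {a, b, c}" using abcd by auto
          ultimately show ?thesis
            using plucker_triple_order_sign[of a b c M] range abcd M by (simp add: rest_def)
        qed
      qed
      show ?thesis unfolding R_def \<epsilon>_def 1 2 by simp
    qed
    hence "(\<Sum>j\<in>T - S. \<epsilon> j * (\<Prod>x\<leftarrow>[Ksub (insert j S), Ksub (T - {j})]. p x)) = (\<Sum>j\<in>T - S. R j)"
      by (rule sum.cong[OF refl])
    \<comment> \<open>For \<open>j\<close> in \<open>S\<close> the minor has a repeated column and
      vanishes, so the sum extends to the four terms of the polynomial identity.\<close>
    also have "\<dots> = (\<Sum>j\<in>T. R j)"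
    proof (rule sum.mono_neutral_left)
      show "\<forall>j\<in>T - (T - S). R j = 0"
        using sr by (auto simp: R_def minor3_def algebra_simps)
    qed (use abcd in auto)
    also have "\<dots> = R a + R b + R c + R d" using abcd by (simp add: add.assoc)
    also have "\<dots> = 0"
      using plucker_relation[of M s r a b c d] abcd(2-7) by (simp add: R_def rest_def)
    finally show "(\<Sum>j\<in>T - S. \<epsilon> j * (\<Prod>x\<leftarrow>[Ksub (insert j S), Ksub (T - {j})]. p x)) = 0" .
  qed
  thus ?thesis by simp
qed

text \<open>One inequality suffices to express a minimum attained twice, because it is required for
  all labellings of the four points.\<close>

definition four_point :: "real ^ (2, 6) ksub \<Rightarrow> bool" where
  "four_point q \<longleftrightarrow> (\<forall>a b c d. {a, b, c, d} \<subseteq> {1..6} \<and> card {a, b, c, d} = 4 \<longrightarrow>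
     min (q $ pair a c + q $ pair b d) (q $ pair a d + q $ pair b c) \<le> q $ pair a b + q $ pair c d)"

lemma min_attained_twice_3:
  assumes "min_attained_twice {i, j, k} h"
  shows "min (h j) (h k) \<le> h i"
  using assms unfolding min_attained_twice_def by force

lemma tropicalization_Gr_26_four_point:
  fixes q :: "real ^ (2, 6) ksub"
  assumes q: "q \<in> tropicalization Gr_open"
  shows "four_point q"
  unfolding four_point_def
proof (intro allI impI)
  fix a b c d :: nat assume *: "{a, b, c, d} \<subseteq> {1..6} \<and> card {a, b, c, d} = 4"
  hence ne: "a \<noteq> b" "a \<noteq> c" "a \<noteq> d" "b \<noteq> c" "b \<noteq> d" "c \<noteq> d"
    by (auto simp: card_insert_if split: if_splits)
  have range: "a \<in> {1..6}" "b \<in> {1..6}" "c \<in> {1..6}" "d \<in> {1..6}" using * by auto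
  define s :: "nat \<Rightarrow> nat \<Rightarrow> puiseux" where "s = (\<lambda>x y. if x < y then 1 else -1)"
  have s: "s x y \<in> {1, -1}" for x y by (simp add: s_def)
  have minor: "minor2 M x y = s x y * plucker M (pair x y)" if "x \<in> {1..6}" "y \<in> {1..6}" "x \<noteq> y" for x y M
  proof (cases "x < y")
    case False
    hence "plucker M (pair x y) = minor2 M y x"
      using plucker_pair[of y x M] that by (simp add: insert_commute)
    thus ?thesis using False by (simp add: s_def minor2_def)
  qed (use plucker_pair[of x y M] that in \<open>simp add: s_def\<close>)
  define xs where "xs = (\<lambda>j :: nat. if j = 0 then [pair a b, pair c d]
    else if j = 1 then [pair a c, pair b d] else [pair a d, pair b c])"
  define \<epsilon> where "\<epsilon> = (\<lambda>j :: nat. if j = 0 then s a b * s c d else if j = 1 then - (s a c * s b d)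
    else s a d * s b c)"
  have "min_attained_twice {0, 1, 2} (\<lambda>j. \<Sum>x\<leftarrow>xs j. q $ x)"
  proof (rule tropicalization_relation_lists[OF q, where \<epsilon> = \<epsilon>])
    show "\<epsilon> j \<in> {1, -1}" for j
      using s[of a b] s[of c d] s[of a c] s[of b d] s[of a d] s[of b c] by (auto simp: \<epsilon>_def)
    have "elems ` set (xs 0) = {{a, b}, {c, d}}" "elems ` set (xs 1) = {{a, c}, {b, d}}"
      "elems ` set (xs 2) = {{a, d}, {b, c}}"
      using range ne by (simp_all add: xs_def elems_pair)
    hence "elems ` set (xs 0) \<noteq> elems ` set (xs 1)" "elems ` set (xs 0) \<noteq> elems ` set (xs 2)"
      "elems ` set (xs 1) \<noteq> elems ` set (xs 2)"
      using ne by (auto simp: doubleton_eq_iff)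
    thus "mset (xs i) \<noteq> mset (xs j)" if "i \<in> {0, 1, 2}" "j \<in> {0, 1, 2}" "i \<noteq> j" for i j
      using that by (metis insertE mset_eq_setD singletonD)
    fix p :: "(2, 6) ksub \<Rightarrow> puiseux" assume "p \<in> Gr_open"
    then obtain M where M: "p = plucker M" by (auto simp: Gr_open_def Gr_def)
    show "(\<Sum>j\<in>{0, 1, 2}. \<epsilon> j * (\<Prod>x\<leftarrow>xs j. p x)) = 0"
      using minor2_relation[of M a b c d] minor[of a b M] minor[of c d M] minor[of a c M]
        minor[of b d M] minor[of a d M] minor[of b c M] range ne M
      by (simp add: \<epsilon>_def xs_def algebra_simps)
  qed auto
  from min_attained_twice_3[OF this]
  show "min (q $ pair a c + q $ pair b d) (q $ pair a d + q $ pair b c) \<le> q $ pair a b + q $ pair c d"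
    by (simp add: xs_def)
qed

section \<open>Self-dual points\<close>

definition concat_list :: "('k :: finite, 'k bit0) ksub \<Rightarrow> nat list" where
  "concat_list I = sorted_list_of_set (elems I) @ sorted_list_of_set (elems (ksub_compl I))"

definition concat_perm :: "('k :: finite, 'k bit0) ksub \<Rightarrow> nat \<Rightarrow> nat" where
  "concat_perm I = (\<lambda>j. if j \<in> {1..CARD('k bit0)} then concat_list I ! (j - 1) else j)"

lemma concat_sign_eq: "concat_sign I = sign (concat_perm I)"
  unfolding concat_sign_def concat_perm_def concat_list_def ..

lemma concat_list_props:
  fixes I :: "('k :: finite, 'k bit0) ksub"
  shows "set (concat_list I) = {1..CARD('k bit0)}" "distinct (concat_list I)"
    "length (concat_list I) = CARD('k bit0)"
proof -
  have "elems I \<subseteq> {1..CARD('k bit0)}" using elems[of I] by auto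
  thus 1: "set (concat_list I) = {1..CARD('k bit0)}"
    by (auto simp: concat_list_def ksub_compl.rep_eq)
  show 2: "distinct (concat_list I)"
    by (auto simp: concat_list_def ksub_compl.rep_eq)
  show "length (concat_list I) = CARD('k bit0)" using distinct_card[OF 2] 1 by simp
qed

lemma concat_perm_permutes:
  fixes I :: "('k :: finite, 'k bit0) ksub"
  shows "concat_perm I permutes {1..CARD('k bit0)}"
proof (rule bij_imp_permutes)
  let ?n = "CARD('k bit0)"
  have "bij_betw (\<lambda>j. j - 1) {1..?n} {..<?n}"
    by (rule bij_betw_byWitness[where f' = Suc]) auto
  moreover have "bij_betw ((!) (concat_list I)) {..<?n} {1..?n}"
    using concat_list_props[of I] by (intro bij_betw_nth) auto
  ultimately have "bij_betw ((!) (concat_list I) \<circ> (\<lambda>j. j - 1)) {1..?n} {1..?n}"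
    by (rule bij_betw_trans)
  thus "bij_betw (concat_perm I) {1..?n} {1..?n}"
    by (rule bij_betw_cong[THEN iffD1, rotated]) (simp add: concat_perm_def)
qed (auto simp: concat_perm_def)

lemma concat_sign_cases: "concat_sign I \<in> {1, -1}"
  unfolding concat_sign_eq using abs_sign[of "concat_perm I"] by (auto simp: abs_if split: if_splits)

text \<open>An adjacent transposition reverses only the order of \<open>x\<close> and
  \<open>Suc x\<close>, so it is increasing on a set that lacks one of them.\<close>

lemma sorted_list_of_set_transpose:
  assumes "finite A" "\<not> (x \<in> A \<and> Suc x \<in> A)"
  shows "sorted_list_of_set (Transposition.transpose x (Suc x) ` A) = map (Transposition.transpose x (Suc x)) (sorted_list_of_set A)"
proof (rule sorted_distinct_set_unique)
  let ?l = "sorted_list_of_set A"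
  have "sorted_wrt (\<lambda>i j. Transposition.transpose x (Suc x) i < Transposition.transpose x (Suc x) j) ?l"
  proof (rule sorted_wrt_mono_rel)
    show "sorted_wrt (<) ?l" by simp
    show "Transposition.transpose x (Suc x) i < Transposition.transpose x (Suc x) j" if "i \<in> set ?l" "j \<in> set ?l" "i < j" for i j
      using that assms by (auto simp: Transposition.transpose_def)
  qed
  thus "sorted (map (Transposition.transpose x (Suc x)) ?l)"
    by (simp add: sorted_wrt_map) (rule sorted_wrt_mono_rel[rotated], assumption, simp)
  show "distinct (map (Transposition.transpose x (Suc x)) ?l)" by (auto simp: distinct_map intro!: inj_onI)
qed (use assms in auto)

text \<open>The adjacent values lie in different halves. Exchanging them leaves both halves sorted
  and composes the permutation with one transposition.\<close>

lemma concat_sign_step: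
  fixes I I' :: "('k :: finite, 'k bit0) ksub"
  assumes x: "x \<in> elems I" "Suc x \<notin> elems I" "Suc x \<le> CARD('k bit0)"
    and I': "elems I' = insert (Suc x) (elems I - {x})"
  shows "concat_sign I' = - concat_sign I"
proof -
  let ?t = "Transposition.transpose x (Suc x)"
  have sub: "elems I \<subseteq> {1..CARD('k bit0)}" using elems[of I] by auto
  have 1: "elems I' = ?t ` elems I" using x I' by (auto simp: Transposition.transpose_def image_iff)
  have 2: "elems (ksub_compl I') = ?t ` elems (ksub_compl I)"
    using x I' sub by (auto simp: Transposition.transpose_def image_iff ksub_compl.rep_eq split: if_splits)
  have "concat_list I' = map ?t (concat_list I)"
    unfolding concat_list_def 1 2 using x
    by (simp add: sorted_list_of_set_transpose ksub_compl.rep_eq)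
  moreover have "x \<ge> 1" using x(1) sub by auto
  ultimately have "concat_perm I' = ?t \<circ> concat_perm I"
    using x(3) concat_list_props(3)[of I]
    by (intro ext) (auto simp: concat_perm_def Transposition.transpose_def)
  moreover have "permutation (concat_perm I)"
    using concat_perm_permutes[of I] by (auto simp: permutation_permutes)
  ultimately show ?thesis
    unfolding concat_sign_eq by (simp add: sign_compose permutation_swap_id sign_swap_id)
qed

text \<open>Unit steps lead from \<open>{1, 2, 3}\<close> to every triple, moving the largest
  element first and the smallest last. Each step flips the sign and raises the sum by 1; the start
  has the identity permutation and the even sum 6.\<close>

lemma concat_sign_triple:
  assumes "a \<ge> 1" "a < b" "b < c" "c \<le> 6"
  shows "concat_sign (triple a b c) = (-1) ^ (a + b + c)"
proof -
  have el: "elems (triple a b c) = {a, b, c}" if "a \<ge> 1" "a < b" "b < c" "c \<le> 6" for a b c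
    using that by (intro elems_triple) auto
  have card: "CARD(3 bit0) = 6" by simp
  have 0: "concat_sign (triple 1 2 3) = 1"
  proof -
    have "elems (ksub_compl (triple 1 2 3)) = {4, 5, 6}"
      by (auto simp: ksub_compl.rep_eq el)
    hence "concat_list (triple 1 2 3) = [1, 2, 3, 4, 5, 6]"
      using el[of 1 2 3] by (simp add: concat_list_def)
    hence "concat_perm (triple 1 2 3) = id"
      by (auto simp: concat_perm_def fun_eq_iff nth_Cons' )
    thus ?thesis by (simp add: concat_sign_eq)
  qed
  have 1: "c \<le> 6 \<Longrightarrow> concat_sign (triple 1 2 c) = (-1) ^ (1 + 2 + c)" if "c \<ge> 3" for c
    using that
  proof (induction c rule: dec_induct)
    case (step c)
    have "concat_sign (triple 1 2 (Suc c)) = - concat_sign (triple 1 2 c)"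
    proof (rule concat_sign_step)
      show "c \<in> elems (triple 1 2 c)" "Suc c \<notin> elems (triple 1 2 c)"
        "elems (triple 1 2 (Suc c)) = insert (Suc c) (elems (triple 1 2 c) - {c})"
        using step.hyps step.prems by (auto simp: el)
    qed (use step.prems in simp)
    thus ?case using step by simp
  qed (use 0 in simp)
  have 2: "b < c \<Longrightarrow> c \<le> 6 \<Longrightarrow> concat_sign (triple 1 b c) = (-1) ^ (1 + b + c)" if "b \<ge> 2" for b c
    using that
  proof (induction b rule: dec_induct)
    case (step b)
    have "concat_sign (triple 1 (Suc b) c) = - concat_sign (triple 1 b c)"
    proof (rule concat_sign_step)
      show "b \<in> elems (triple 1 b c)" "Suc b \<notin> elems (triple 1 b c)"
        "elems (triple 1 (Suc b) c) = insert (Suc b) (elems (triple 1 b c) - {b})"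
        using step.hyps step.prems by (auto simp: el)
    qed (use step.prems in simp)
    thus ?case using step by simp
  qed (use 1 in simp)
  show ?thesis
    using assms(1,2)
  proof (induction a rule: dec_induct)
    case (step a)
    have "concat_sign (triple (Suc a) b c) = - concat_sign (triple a b c)"
    proof (rule concat_sign_step)
      show "a \<in> elems (triple a b c)" "Suc a \<notin> elems (triple a b c)"
        "elems (triple (Suc a) b c) = insert (Suc a) (elems (triple a b c) - {a})"
        using step.hyps step.prems assms(3,4) by (auto simp: el)
    qed (use step.prems assms in simp)
    thus ?case using step by simp
  qed (use 2 assms in simp)
qed

text \<open>All twenty triples with their complements, both increasing; claims about complementary
  triples become case checks.\<close>

definition splittings :: "(nat \<times> nat \<times> nat \<times> nat \<times> nat \<times> nat) list" where
  "splittings = [(1,2,3,4,5,6), (1,2,4,3,5,6), (1,2,5,3,4,6), (1,2,6,3,4,5), (1,3,4,2,5,6),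
    (1,3,5,2,4,6), (1,3,6,2,4,5), (1,4,5,2,3,6), (1,4,6,2,3,5), (1,5,6,2,3,4),
    (2,3,4,1,5,6), (2,3,5,1,4,6), (2,3,6,1,4,5), (2,4,5,1,3,6), (2,4,6,1,3,5),
    (2,5,6,1,3,4), (3,4,5,1,2,6), (3,4,6,1,2,5), (3,5,6,1,2,4), (4,5,6,1,2,3)]"

lemma splittingE:
  assumes "a < b" "b < c" "a \<in> {1..6}" "b \<in> {1..6}" "c \<in> {1..6}"
  obtains d e f where "(a, b, c, d, e, f) \<in> set splittings"
proof -
  have "a \<in> {1, 2, 3, 4}" "b \<in> {2, 3, 4, 5}" "c \<in> {3, 4, 5, 6}" using assms by auto
  hence "\<exists>d e f. (a, b, c, d, e, f) \<in> set splittings"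
    using assms(1,2) unfolding splittings_def by (elim insertE emptyE; simp)
  thus ?thesis using that by blast
qed

lemma splitting_props:
  assumes "(a, b, c, d, e, f) \<in> set splittings"
  shows "{a, b, c} \<union> {d, e, f} = {1..6}" "{a, b, c} \<inter> {d, e, f} = {}" "a < b" "b < c" "d < e" "e < f"
    "1 \<le> a" "1 \<le> d" "c \<le> 6" "f \<le> 6"
proof -
  have "{1..6 :: nat} = {1, 2, 3, 4, 5, 6}" by auto
  thus "{a, b, c} \<union> {d, e, f} = {1..6}"
    using assms unfolding splittings_def by (simp, elim disjE; auto)
  show "{a, b, c} \<inter> {d, e, f} = {}" "a < b" "b < c" "d < e" "e < f" "1 \<le> a" "1 \<le> d" "c \<le> 6" "f \<le> 6"
    using assms unfolding splittings_def by (simp, elim disjE; simp)+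
qed

text \<open>
  The product of \<open>p\<^bsub>ij\<^esub>\<close> over all \<open>i\<close> in a triple and all \<open>j \<noteq> i\<close> contains each pair inside the triple
  twice and each pair across the splitting once.
\<close>

lemma splitting_product:
  fixes p :: "nat \<Rightarrow> nat \<Rightarrow> 'b :: comm_ring_1"
  assumes anti: "\<And>i j. p j i = - p i j" and sp: "(a, b, c, d, e, f) \<in> set splittings"
  defines "v \<equiv> \<lambda>i. \<Prod>j\<in>{1..6} - {i}. p i j"
  shows "(-1) ^ (d + e + f) * (p d e * p d f * p e f) * (v a * v b * v c) =
    (p 1 2 * p 1 3 * p 1 4 * p 1 5 * p 1 6 * p 2 3 * p 2 4 * p 2 5 * p 2 6 * p 3 4 * p 3 5 * p 3 6 *
      p 4 5 * p 4 6 * p 5 6) * (p a b * p a c * p b c)"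
proof -
  have ivl: "{1..6 :: nat} = {1, 2, 3, 4, 5, 6}" by auto
  have v: "v 1 = p 1 2 * p 1 3 * p 1 4 * p 1 5 * p 1 6" "v 2 = p 2 1 * p 2 3 * p 2 4 * p 2 5 * p 2 6"
    "v 3 = p 3 1 * p 3 2 * p 3 4 * p 3 5 * p 3 6" "v 4 = p 4 1 * p 4 2 * p 4 3 * p 4 5 * p 4 6"
    "v 5 = p 5 1 * p 5 2 * p 5 3 * p 5 4 * p 5 6" "v 6 = p 6 1 * p 6 2 * p 6 3 * p 6 4 * p 6 5"
    unfolding v_def ivl by (simp_all add: insert_Diff_if mult.assoc)
  have sw: "p 2 1 = - p 1 2" "p 3 1 = - p 1 3" "p 4 1 = - p 1 4" "p 5 1 = - p 1 5" "p 6 1 = - p 1 6" "p 3 2 = - p 2 3" "p 4 2 = - p 2 4" "p 5 2 = - p 2 5" "p 6 2 = - p 2 6" "p 4 3 = - p 3 4" "p 5 3 = - p 3 5" "p 6 3 = - p 3 6" "p 5 4 = - p 4 5" "p 6 4 = - p 4 6" "p 6 5 = - p 5 6"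
    by (rule anti)+
  show ?thesis
    \<comment> \<open>Reversing the factors with decreasing indices by \<open>sw\<close> produces
      the sign; it matches \<open>(-1) ^ (d + e + f)\<close> in all twenty cases.\<close>
    using sp unfolding splittings_def
    by (simp only: list.set insert_iff empty_iff prod.inject HOL.simp_thms,
        elim disjE conjE; simp only: v sw; simp add: mult_ac)
qed

text \<open>Solving \<open>splitting_product\<close> for the complementary minor exhibits the torus
  element: \<open>inverse (v i)\<close>, with \<open>v i\<close> the product of the minors through
  \<open>i\<close>, and the projective factor \<open>C\<close>, the product of all fifteen
  minors.\<close>

lemma veronese_mem_SGr:
  fixes M :: "nat \<Rightarrow> nat \<Rightarrow> puiseux"
  assumes ne: "\<And>a b. a \<in> {1..6} \<Longrightarrow> b \<in> {1..6} \<Longrightarrow> a \<noteq> b \<Longrightarrow> minor2 M a b \<noteq> 0"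
  defines "V \<equiv> \<lambda>r i. M 0 i ^ (2 - r) * M 1 i ^ r"
  shows "plucker V \<in> (SGr_open :: ((3, 6) ksub \<Rightarrow> puiseux) set)"
    and "\<And>a b c. a \<in> {1..6} \<Longrightarrow> b \<in> {1..6} \<Longrightarrow> c \<in> {1..6} \<Longrightarrow> a < b \<Longrightarrow> b < c \<Longrightarrow>
      plucker V (triple a b c) = minor2 M a b * minor2 M a c * minor2 M b c"
proof -
  show val: "plucker V (triple a b c) = minor2 M a b * minor2 M a c * minor2 M b c"
    if "a \<in> {1..6}" "b \<in> {1..6}" "c \<in> {1..6}" "a < b" "b < c" for a b c
    using plucker_triple[OF that, of V] minor3_veronese[of M a b c] by (simp add: V_def)
  let ?P = "plucker V :: (3, 6) ksub \<Rightarrow> puiseux"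
  have nz: "?P I \<noteq> 0" for I
  proof (rule tripleE[of I])
    fix a b c assume "I = triple a b c" "a < b" "b < c" "a \<in> {1..6}" "b \<in> {1..6}" "c \<in> {1..6}"
    thus ?thesis using val[of a b c] ne[of a b] ne[of a c] ne[of b c] by simp
  qed
  define p where "p = minor2 M"
  define v where "v = (\<lambda>i. \<Prod>j\<in>{1..6} - {i}. p i j)"
  define C where "C = p 1 2 * p 1 3 * p 1 4 * p 1 5 * p 1 6 * p 2 3 * p 2 4 * p 2 5 * p 2 6 * p 3 4 *
    p 3 5 * p 3 6 * p 4 5 * p 4 6 * p 5 6"
  have anti: "p j i = - p i j" for i j by (simp add: p_def minor2_def)
  have v0: "v i \<noteq> 0" if "i \<in> {1..6}" for i using ne that by (auto simp: v_def p_def)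
  have "self_dual ?P"
    unfolding self_dual_def
  proof (intro exI[of _ "\<lambda>i. inverse (v i)"] exI[of _ C] conjI ballI allI)
    show "inverse (v i) \<noteq> 0" if "i \<in> {1..CARD(3 bit0)}" for i using v0[of i] that by simp
    show "C \<noteq> 0" using ne unfolding C_def p_def by simp
    fix I :: "(3, 6) ksub"
    show "hodge_star ?P I = C * torus_act (\<lambda>i. inverse (v i)) ?P I"
    proof (rule tripleE[of I])
      fix a b c assume I: "I = triple a b c" "a < b" "b < c" and abc: "a \<in> {1..6}" "b \<in> {1..6}" "c \<in> {1..6}"
      obtain d e f where sp: "(a, b, c, d, e, f) \<in> set splittings"
        using splittingE[OF I(2,3) abc] by blast
      note props = splitting_props[OF sp]
      have "{d, e, f} \<subseteq> {1..6}" using props(1) by blast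
      hence def': "d \<in> {1..6}" "e \<in> {1..6}" "f \<in> {1..6}" by auto
      have compl: "ksub_compl I = triple d e f"
        unfolding I(1) using props by (intro compl_triple) auto
      have "hodge_star ?P I = (-1) ^ (d + e + f) * (p d e * p d f * p e f)"
        using concat_sign_triple[of d e f] props val[OF def'] by (simp add: hodge_star_def compl p_def)
      also have "\<dots> = C * (inverse (v a) * inverse (v b) * inverse (v c)) * (p a b * p a c * p b c)"
      proof -
        have "(-1) ^ (d + e + f) * (p d e * p d f * p e f) * (v a * v b * v c) = C * (p a b * p a c * p b c)"
          unfolding v_def C_def by (rule splitting_product[OF anti sp])
        moreover have "X = C * (inverse x * inverse y * inverse z) * Y"
          if "X * (x * y * z) = C * Y" "x \<noteq> 0" "y \<noteq> 0" "z \<noteq> 0" for X Y x y z :: puiseux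
          using that by (simp add: field_simps)
        ultimately show ?thesis using v0 abc by blast
      qed
      also have "\<dots> = C * torus_act (\<lambda>i. inverse (v i)) ?P I"
      proof -
        have "elems I = {a, b, c}" unfolding I(1) using I abc by (intro elems_triple) auto
        thus ?thesis using val[OF abc I(2,3)] I by (simp add: torus_act_def p_def mult.assoc)
      qed
      finally show ?thesis .
    qed
  qed
  thus "?P \<in> SGr_open" using nz unfolding SGr_open_def SGr_def Gr_open_def Gr_def by blast
qed

section \<open>Lineality and self-dual vectors\<close>

definition lin :: "(nat \<Rightarrow> real) \<Rightarrow> real ^ ('k, 'n) ksub" where
  "lin \<mu> = (\<chi> I. \<Sum>i\<in>elems I. \<mu> i)"

lemma lineality_eq: "lineality = range lin"
  unfolding lineality_def lin_def ..

lemma lin_pair: "a \<in> {1..6} \<Longrightarrow> b \<in> {1..6} \<Longrightarrow> a \<noteq> b \<Longrightarrow> lin \<mu> $ pair a b = \<mu> a + \<mu> b"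
  using elems_pair[of a b] by (simp add: lin_def)

lemma lin_triple:
  "a \<in> {1..6} \<Longrightarrow> b \<in> {1..6} \<Longrightarrow> c \<in> {1..6} \<Longrightarrow> a \<noteq> b \<Longrightarrow> a \<noteq> c \<Longrightarrow> b \<noteq> c \<Longrightarrow>
    lin \<mu> $ triple a b c = \<mu> a + \<mu> b + \<mu> c"
  using elems_triple[of a b c] by (simp add: lin_def add.assoc)

lemma pairs_to_triples_triple:
  "a \<in> {1..6} \<Longrightarrow> b \<in> {1..6} \<Longrightarrow> c \<in> {1..6} \<Longrightarrow> a \<noteq> b \<Longrightarrow> a \<noteq> c \<Longrightarrow> b \<noteq> c \<Longrightarrow>
    pairs_to_triples q $ triple a b c = q $ pair a b + q $ pair a c + q $ pair b c"
  by (intro pairs_to_triples_nth elems_triple)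

lemma vec_triple_eqI:
  fixes v w :: "real ^ (3, 6) ksub"
  assumes "\<And>a b c. a \<in> {1..6} \<Longrightarrow> b \<in> {1..6} \<Longrightarrow> c \<in> {1..6} \<Longrightarrow> a < b \<Longrightarrow> b < c \<Longrightarrow>
    v $ triple a b c = w $ triple a b c"
  shows "v = w"
  unfolding vec_eq_iff
proof
  fix I :: "(3, 6) ksub"
  show "v $ I = w $ I" by (rule tripleE[of I]) (use assms in auto)
qed

lemma vec_pair_eqI:
  fixes v w :: "real ^ (2, 6) ksub"
  assumes "\<And>a b. a \<in> {1..6} \<Longrightarrow> b \<in> {1..6} \<Longrightarrow> a < b \<Longrightarrow> v $ pair a b = w $ pair a b"
  shows "v = w"
  unfolding vec_eq_iff
proof
  fix J :: "(2, 6) ksub"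
  show "v $ J = w $ J" by (rule pairE[of J]) (use assms in auto)
qed

lemma pairs_to_triples_lin: "pairs_to_triples (lin \<mu>) = lin (\<lambda>i. 2 * \<mu> i)"
  by (rule vec_triple_eqI) (simp add: pairs_to_triples_triple lin_pair lin_triple)

lemma lin_add: "lin \<mu> + lin \<nu> = lin (\<lambda>i. \<mu> i + \<nu> i)"
  by (simp add: lin_def vec_eq_iff sum.distrib)

text \<open>The hypothesis says that the difference between the entries at \<open>x y a\<close> and
  \<open>x y b\<close> is independent of \<open>x\<close> and \<open>y\<close>; it is therefore a
  difference \<open>m a - m b\<close>. Subtracting the vector of \<open>m\<close> leaves a
  constant.\<close>

lemma lin_of_exchange:
  fixes d :: "real ^ (3, 6) ksub"
  assumes ex: "\<And>x y z u a b. {x, y, z, u, a, b} \<subseteq> {1..6} \<Longrightarrow> x \<noteq> y \<Longrightarrow> z \<noteq> u \<Longrightarrow> a \<noteq> b \<Longrightarrow>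
    a \<notin> {x, y, z, u} \<Longrightarrow> b \<notin> {x, y, z, u} \<Longrightarrow>
    d $ triple x y a + d $ triple z u b = d $ triple x y b + d $ triple z u a"
  shows "\<exists>\<mu>. d = lin \<mu>"
proof -
  \<comment> \<open>Normalised by \<open>m 1 = 0\<close>; the reference pair is taken from
    \<open>{2, 3, 4}\<close> so as to avoid both 1 and \<open>i\<close>.\<close>
  define m where "m = (\<lambda>i. if i = 1 then 0 else
    d $ triple (if i = 2 then 4 else 2) (if i = 3 then 4 else 3) i - d $ triple (if i = 2 then 4 else 2) (if i = 3 then 4 else 3) 1)"
  have m: "d $ triple x y i - d $ triple x y 1 = m i"
    if "{x, y, i} \<subseteq> {1..6}" "x \<noteq> y" "i \<noteq> 1" "x \<notin> {1, i}" "y \<notin> {1, i}" for x y i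
    using ex[of x y 4 3 i 1] ex[of x y 2 4 i 1] ex[of x y 2 3 i 1] that
    by (cases "i = 2"; cases "i = 3") (auto simp: m_def)
  have diff: "d $ triple x y i - d $ triple x y j = m i - m j"
    if xy: "{x, y, i, j} \<subseteq> {1..6}" "x \<noteq> y" "i \<noteq> j" "x \<notin> {i, j}" "y \<notin> {i, j}" for x y i j
  proof (cases "i = 1 \<or> j = 1")
    case True
    thus ?thesis using m[of x y i] m[of x y j] xy by (auto simp: m_def)
  next
    case False
    have "card ({1..6} - {1, i, j}) \<ge> 2"
      using card_Diff_subset[of "{1, i, j}" "{1..6}"] xy(1) card_insert_le_m1[of 3 "{i, j}" 1] False xy(3) by simp
    then obtain A where A: "A \<subseteq> {1..6} - {1, i, j}" "card A = 2"
      by (rule obtain_subset_with_card_n)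
    then obtain z u where "A = {z, u}" and zu: "z \<noteq> u" unfolding card_2_iff by blast
    with A(1) have zu: "{z, u} \<subseteq> {1..6} - {1, i, j}" "z \<noteq> u" by simp_all
    have "d $ triple x y i + d $ triple z u j = d $ triple x y j + d $ triple z u i"
      using xy zu by (intro ex) auto
    moreover have "d $ triple z u i - d $ triple z u 1 = m i" "d $ triple z u j - d $ triple z u 1 = m j"
      using m[of z u i] m[of z u j] zu False xy(1) by auto
    ultimately show ?thesis by linarith
  qed
  define F where "F = (\<lambda>a b c. d $ triple a b c - (m a + m b + m c))"
  have F: "F a b c = F 1 2 3" if abc: "a \<in> {1..6}" "b \<in> {1..6}" "c \<in> {1..6}" "a < b" "b < c" for a b c
  proof -
    have "F a b c = F 1 b c"
      using diff[of b c a 1] abc by (cases "a = 1") (auto simp: F_def insert_commute)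
    also have "\<dots> = F 1 2 c"
      using diff[of 1 c b 2] abc by (cases "b = 2") (auto simp: F_def insert_commute)
    also have "\<dots> = F 1 2 3"
      using diff[of 1 2 c 3] abc by (cases "c = 3") (auto simp: F_def)
    finally show ?thesis .
  qed
  \<comment> \<open>A triple sums three entries, so the remaining constant is spread in
    thirds.\<close>
  have "d = lin (\<lambda>i. m i + F 1 2 3 / 3)"
  proof (rule vec_triple_eqI)
    fix a b c :: nat assume abc: "a \<in> {1..6}" "b \<in> {1..6}" "c \<in> {1..6}" "a < b" "b < c"
    have "F a b c = d $ triple a b c - (m a + m b + m c)" by (simp add: F_def)
    moreover have "lin (\<lambda>i. m i + K / 3) $ triple a b c = m a + m b + m c + K" for K
      using abc by (simp add: lin_triple)
    ultimately show "d $ triple a b c = lin (\<lambda>i. m i + F 1 2 3 / 3) $ triple a b c"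
      unfolding F[OF abc, symmetric] by simp
  qed
  thus ?thesis by blast
qed

text \<open>The products of the torus parameters over \<open>I\<close> and \<open>J\<close> agree
  with those over \<open>I'\<close> and \<open>J'\<close>. Comparing the self-duality equations of
  the four triples hence yields a binomial with coefficient 1 or -1, and its tropical form is the
  hypothesis of \<open>lin_of_exchange\<close>.\<close>

lemma tropicalization_SGr_subset_L_sd: "tropicalization (SGr_open :: ((3, 6) ksub \<Rightarrow> puiseux) set) \<subseteq> L_sd"
proof
  fix w :: "real ^ (3, 6) ksub" assume w: "w \<in> tropicalization SGr_open"
  let ?d = "w - (\<chi> I. w $ ksub_compl I)"
  have "\<exists>\<mu>. ?d = lin \<mu>"
  proof (rule lin_of_exchange)
    fix x y z u a b :: nat
    assume *: "{x, y, z, u, a, b} \<subseteq> {1..6}" "x \<noteq> y" "z \<noteq> u" "a \<noteq> b" "a \<notin> {x, y, z, u}" "b \<notin> {x, y, z, u}"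
    have ne: "x \<noteq> a" "y \<noteq> a" "z \<noteq> a" "u \<noteq> a" "x \<noteq> b" "y \<noteq> b" "z \<noteq> b" "u \<noteq> b" using * by auto
    define I J I' J' where IJ: "I = triple x y a" "J = triple z u b" "I' = triple x y b" "J' = triple z u a"
    have el: "elems I = {x, y, a}" "elems J = {z, u, b}" "elems I' = {x, y, b}" "elems J' = {z, u, a}"
      unfolding IJ using elems_triple[of x y a] elems_triple[of z u b] elems_triple[of x y b] elems_triple[of z u a] *
      by auto
    define \<sigma> :: "(3, 6) ksub \<Rightarrow> puiseux" where "\<sigma> = (\<lambda>I. of_int (concat_sign (ksub_compl I)))"
    have \<sigma>: "\<sigma> I \<in> {1, -1}" for I using concat_sign_cases[of "ksub_compl I"] by (auto simp: \<sigma>_def)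
    have \<sigma>2: "\<sigma> I * \<sigma> I = 1" for I using \<sigma>[of I] by auto
    have "(\<Sum>x\<leftarrow>[ksub_compl I, ksub_compl J, I', J']. w $ x) = (\<Sum>x\<leftarrow>[ksub_compl I', ksub_compl J', I, J]. w $ x)"
    proof (rule tropicalization_binomial_lists[OF w, where \<epsilon> = "\<sigma> I * \<sigma> J * \<sigma> I' * \<sigma> J'"])
      show "\<sigma> I * \<sigma> J * \<sigma> I' * \<sigma> J' \<in> {1, -1}" using \<sigma>[of I] \<sigma>[of J] \<sigma>[of I'] \<sigma>[of J'] by auto
      fix p :: "(3, 6) ksub \<Rightarrow> puiseux" assume "p \<in> SGr_open"
      then obtain l c where "\<forall>I. hodge_star p I = c * torus_act l p I"
        unfolding SGr_open_def SGr_def self_dual_def by blast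
      hence "\<sigma> K * p (ksub_compl K) = c * (\<Prod>i\<in>elems K. l i) * p K" for K
        by (simp add: hodge_star_def torus_act_def \<sigma>_def mult.assoc)
      hence "\<sigma> K * (\<sigma> K * p (ksub_compl K)) = \<sigma> K * (c * (\<Prod>i\<in>elems K. l i) * p K)" for K by simp
      hence star: "p (ksub_compl K) = \<sigma> K * (c * (\<Prod>i\<in>elems K. l i) * p K)" for K
        by (simp add: \<sigma>2 flip: mult.assoc)
      have L: "(\<Prod>i\<in>elems I. l i) * (\<Prod>i\<in>elems J. l i) = (\<Prod>i\<in>elems I'. l i) * (\<Prod>i\<in>elems J'. l i)"
        unfolding el using *(2,3) ne by (simp add: mult_ac)
      have eq: "i * (c * A * pI) * (j * (c * B * pJ)) * pI' * pJ' =
          i * j * i' * j' * (i' * (c * A' * pI') * (j' * (c * B' * pJ')) * pI * pJ)"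
        if "i' * i' = 1" "j' * j' = 1" "A * B = A' * B'" for i j i' j' A B A' B' pI pJ pI' pJ' :: puiseux
      proof -
        have "i * (c * A * pI) * (j * (c * B * pJ)) * pI' * pJ' = i * j * c * c * (A * B) * pI * pJ * pI' * pJ'"
          by (simp add: mult_ac)
        also have "\<dots> = i * j * c * c * (A' * B') * pI * pJ * pI' * pJ' * (i' * i') * (j' * j')"
          using that by simp
        finally show ?thesis by (simp add: mult_ac)
      qed
      show "(\<Prod>x\<leftarrow>[ksub_compl I, ksub_compl J, I', J']. p x) =
          \<sigma> I * \<sigma> J * \<sigma> I' * \<sigma> J' * (\<Prod>x\<leftarrow>[ksub_compl I', ksub_compl J', I, J]. p x)"
        using eq[OF \<sigma>2[of I'] \<sigma>2[of J'] L, of "\<sigma> I" "p I" "\<sigma> J" "p J" "p I'" "p J'"]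
        by (simp add: star mult.assoc)
    qed
    thus "?d $ triple x y a + ?d $ triple z u b = ?d $ triple x y b + ?d $ triple z u a"
      unfolding IJ[symmetric] by simp
  qed
  thus "w \<in> L_sd" unfolding mem_L_sd_iff lineality_eq by blast
qed

text \<open>
  Of two complementary triples, exactly one contains \<open>1\<close> and exactly one meets \<open>abc\<close> in at least two
  points.
\<close>

lemma symmetric_sum:
  fixes f :: "real ^ (3, 6) ksub"
  assumes sym: "\<And>I. f $ ksub_compl I = f $ I" and sp: "(a, b, c, d, e, g) \<in> set splittings"
  shows "f $ triple 1 2 3 + f $ triple 1 2 4 + f $ triple 1 2 5 + f $ triple 1 2 6 + f $ triple 1 3 4 + f $ triple 1 3 5 + f $ triple 1 3 6 + f $ triple 1 4 5 + f $ triple 1 4 6 + f $ triple 1 5 6 =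
    f $ triple a b c + (f $ triple a b d + f $ triple a b e + f $ triple a b g) +
    (f $ triple a c d + f $ triple a c e + f $ triple a c g) +
    (f $ triple b c d + f $ triple b c e + f $ triple b c g)"
proof -
  have eq: "f $ triple d e g = f $ triple a b c" if "(a, b, c, d, e, g) \<in> set splittings" for a b c d e g
  proof -
    note props = splitting_props[OF that]
    have "ksub_compl (triple a b c) = triple d e g" using props by (intro compl_triple) auto
    thus ?thesis using sym[of "triple a b c"] by simp
  qed
  have comp: "f $ triple 4 5 6 = f $ triple 1 2 3" "f $ triple 3 5 6 = f $ triple 1 2 4" "f $ triple 3 4 6 = f $ triple 1 2 5" "f $ triple 3 4 5 = f $ triple 1 2 6" "f $ triple 2 5 6 = f $ triple 1 3 4" "f $ triple 2 4 6 = f $ triple 1 3 5" "f $ triple 2 4 5 = f $ triple 1 3 6" "f $ triple 2 3 6 = f $ triple 1 4 5" "f $ triple 2 3 5 = f $ triple 1 4 6" "f $ triple 2 3 4 = f $ triple 1 5 6"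
    by (rule eq, simp add: splittings_def)+
  show ?thesis
    using sp unfolding splittings_def
    by (simp only: list.set insert_iff empty_iff prod.inject HOL.simp_thms,
        elim disjE conjE; use comp in \<open>simp add: insert_commute\<close>)
qed

text \<open>An explicit preimage. Summing over the three pairs of \<open>abc\<close> counts the
  entry at \<open>abc\<close> three times and the nine triples meeting it in two points once each;
  by \<open>symmetric_sum\<close> this is \<open>U\<close> plus twice the entry. Halving and
  subtracting \<open>U / 6\<close> for each pair leaves the entry.\<close>

lemma symmetric_pairs_to_triples:
  fixes f :: "real ^ (3, 6) ksub"
  assumes sym: "\<And>I. f $ ksub_compl I = f $ I"
  shows "\<exists>q. pairs_to_triples q = f"
proof -
  define U where "U = f $ triple 1 2 3 + f $ triple 1 2 4 + f $ triple 1 2 5 + f $ triple 1 2 6 + f $ triple 1 3 4 + f $ triple 1 3 5 + f $ triple 1 3 6 + f $ triple 1 4 5 + f $ triple 1 4 6 + f $ triple 1 5 6"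
  define q :: "real ^ (2, 6) ksub"
    where "q = (\<chi> J. (\<Sum>k\<in>{1..6} - elems J. f $ Ksub (insert k (elems J))) / 2 - U / 6)"
  have q: "q $ pair a b = (f $ triple a b c + f $ triple a b d + f $ triple a b e + f $ triple a b g) / 2 - U / 6"
    if "{a, b, c, d, e, g} = {1..6}" "card {a, b, c, d, e, g} = 6" for a b c d e g
  proof -
    have ne: "a \<noteq> b" "a \<notin> {c, d, e, g}" "b \<notin> {c, d, e, g}" "c \<notin> {d, e, g}" "d \<notin> {e, g}" "e \<noteq> g"
      using that(2) by (auto simp: card_insert_if split: if_splits)
    have "a \<in> {1..6}" "b \<in> {1..6}" using that(1) by blast+
    hence el: "elems (pair a b) = {a, b}" using ne by (intro elems_pair)
    have "{1..6} - {a, b} = {c, d, e, g}" unfolding that(1)[symmetric] using ne by auto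
    hence "(\<Sum>k\<in>{1..6} - {a, b}. f $ Ksub (insert k {a, b})) =
        f $ Ksub {c, a, b} + f $ Ksub {d, a, b} + f $ Ksub {e, a, b} + f $ Ksub {g, a, b}"
      using ne by simp
    thus ?thesis by (simp add: q_def el insert_commute)
  qed
  have "pairs_to_triples q = f"
  proof (rule vec_triple_eqI)
    fix a b c :: nat assume abc: "a \<in> {1..6}" "b \<in> {1..6}" "c \<in> {1..6}" "a < b" "b < c"
    obtain d e g where sp: "(a, b, c, d, e, g) \<in> set splittings" using splittingE[OF abc(4,5,1-3)] by blast
    note props = splitting_props[OF sp]
    have "{a, b, c, d, e, g} = {1..6}" using props(1) by auto
    hence part: "{a, b, c, d, e, g} = {1..6}" "{a, c, b, d, e, g} = {1..6}" "{b, c, a, d, e, g} = {1..6}"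
      by (simp_all add: insert_commute)
    have card: "card {a, b, c, d, e, g} = 6" "card {a, c, b, d, e, g} = 6" "card {b, c, a, d, e, g} = 6"
      unfolding part by simp_all
    have perm: "triple a c b = triple a b c" "triple b c a = triple a b c" by (simp_all add: insert_commute)
    have "pairs_to_triples q $ triple a b c = q $ pair a b + q $ pair a c + q $ pair b c"
      using abc by (intro pairs_to_triples_triple) auto
    also have "\<dots> = f $ triple a b c"
      using q[OF part(1) card(1)] q[OF part(2) card(2)] q[OF part(3) card(3)]
        symmetric_sum[OF sym sp, folded U_def] unfolding perm by (simp add: field_simps)
    finally show "pairs_to_triples q $ triple a b c = f $ triple a b c" .
  qed
  thus ?thesis by blast
qed

text \<open>A self-dual vector is its average with the dual vector plus half their difference. The
  average is symmetric and the difference lies in the lineality space; quarters of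
  \<open>\<mu>\<close> appear because the map doubles lineality vectors.\<close>

lemma L_sd_pairs_to_triples:
  fixes w :: "real ^ (3, 6) ksub"
  assumes "w \<in> L_sd"
  shows "\<exists>q. pairs_to_triples q = w"
proof -
  let ?s = "\<chi> I. w $ ksub_compl I"
  obtain \<mu> where \<mu>: "w - ?s = lin \<mu>" using assms unfolding mem_L_sd_iff lineality_eq by blast
  define f where "f = (1/2) *\<^sub>R (w + ?s)"
  obtain q where q: "pairs_to_triples q = f"
    using symmetric_pairs_to_triples[of f] by (auto simp: f_def add.commute)
  have "pairs_to_triples (q + lin (\<lambda>i. \<mu> i / 4)) = f + lin (\<lambda>i. \<mu> i / 2)"
    using linear_add[OF linear_pairs_to_triples] q by (simp add: pairs_to_triples_lin)
  also have "lin (\<lambda>i. \<mu> i / 2) = (1/2) *\<^sub>R (lin \<mu> :: real ^ (3, 6) ksub)"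
    by (simp add: lin_def vec_eq_iff sum_divide_distrib)
  also have "f + \<dots> = w" unfolding \<mu>[symmetric] by (simp add: f_def vec_eq_iff field_simps)
  finally show ?thesis by blast
qed

lemma obtain_outside:
  assumes "S \<subseteq> {1..6 :: nat}" "card S + k \<le> 6"
  obtains A where "A \<subseteq> {1..6} - S" "card A = k"
proof -
  have "finite S" using assms(1) finite_subset by blast
  hence "card ({1..6} - S) = 6 - card S" using assms(1) by (simp add: card_Diff_subset)
  hence "k \<le> card ({1..6} - S)" using assms(2) by simp
  thus ?thesis using that by (rule obtain_subset_with_card_n)
qed

text \<open>The equations of the four triples in \<open>{a, b, x, y}\<close> give equal values on
  the opposite pairs \<open>ab\<close> and \<open>xy\<close>. The triple \<open>cde\<close> disjoint
  from \<open>ab\<close> then says that three times this value is 0.\<close>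

lemma pairs_to_triples_eq_0:
  assumes "pairs_to_triples q = 0"
  shows "q = 0"
proof (rule vec_pair_eqI)
  fix a b :: nat assume ab: "a \<in> {1..6}" "b \<in> {1..6}" "a < b"
  obtain A where A: "A \<subseteq> {1..6} - {a, b}" "card A = 3" using obtain_outside[of "{a, b}" 3] ab by auto
  then obtain c d e where "A = {c, d, e}" and ne: "c \<noteq> d" "d \<noteq> e" "c \<noteq> e" unfolding card_3_iff by blast
  hence cde: "c \<in> {1..6}" "d \<in> {1..6}" "e \<in> {1..6}" "a \<notin> {c, d, e}" "b \<notin> {c, d, e}" using A(1) by auto
  have t: "q $ pair x y + q $ pair x z + q $ pair y z = 0"
    if "x \<in> {1..6}" "y \<in> {1..6}" "z \<in> {1..6}" "x \<noteq> y" "x \<noteq> z" "y \<noteq> z" for x y z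
    using pairs_to_triples_triple[OF that, of q] assms by simp
  have opp: "q $ pair a b = q $ pair x y" if "x \<in> {c, d, e}" "y \<in> {c, d, e}" "x \<noteq> y" for x y
  proof -
    have "x \<in> {1..6}" "y \<in> {1..6}" "a \<noteq> x" "a \<noteq> y" "b \<noteq> x" "b \<noteq> y" using that cde by auto
    thus ?thesis using t[of a b x] t[of a b y] t[of a x y] t[of b x y] ab that(3) by simp
  qed
  show "q $ pair a b = 0 $ pair a b"
    using opp[of c d] opp[of c e] opp[of d e] t[of c d e] ne cde by simp
qed

lemma inj_pairs_to_triples: "inj pairs_to_triples"
  using linear_injective_0[OF linear_pairs_to_triples] pairs_to_triples_eq_0 by blast

text \<open>The Dressian before the quotient by constants.\<close>

definition plucker_relations :: "(real ^ (3, 6) ksub) set" where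
  "plucker_relations = {w. \<forall>S T. S \<subseteq> {1..6} \<and> T \<subseteq> {1..6} \<and> card S = 2 \<and> card T = 4 \<longrightarrow>
     min_attained_twice (T - S) (\<lambda>j. w $ Ksub (insert j S) + w $ Ksub (T - {j}))}"

text \<open>An auxiliary point \<open>i\<close> with \<open>S = {a, i}\<close> and
  \<open>T = {b, c, d, i}\<close> gives a three-term relation; all its terms contain the same sum of
  the pairs through \<open>i\<close>.\<close>

lemma four_point_of_plucker_relations:
  assumes "pairs_to_triples q \<in> plucker_relations"
  shows "four_point q"
  unfolding four_point_def
proof (intro allI impI)
  fix a b c d :: nat assume *: "{a, b, c, d} \<subseteq> {1..6} \<and> card {a, b, c, d} = 4"
  hence ne: "a \<noteq> b" "a \<noteq> c" "a \<noteq> d" "b \<noteq> c" "b \<noteq> d" "c \<noteq> d"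
    by (auto simp: card_insert_if split: if_splits)
  have range: "a \<in> {1..6}" "b \<in> {1..6}" "c \<in> {1..6}" "d \<in> {1..6}" using * by auto
  obtain A where A: "A \<subseteq> {1..6} - {a, b, c, d}" "card A = 1" using obtain_outside[of "{a, b, c, d}" 1] * by auto
  then obtain i where "A = {i}" by (auto simp: card_1_singleton_iff)
  hence i: "i \<in> {1..6}" "i \<notin> {a, b, c, d}" using A(1) by auto
  let ?w = "pairs_to_triples q"
  have "{b, c, d, i} \<subseteq> {1..6}" "card {b, c, d, i} = 4" "{a, i} \<subseteq> {1..6}" "card {a, i} = 2"
    using range i ne by auto
  hence "min_attained_twice ({b, c, d, i} - {a, i}) (\<lambda>j. ?w $ Ksub (insert j {a, i}) + ?w $ Ksub ({b, c, d, i} - {j}))"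
    using assms unfolding plucker_relations_def by blast
  moreover have "{b, c, d, i} - {a, i} = {b, c, d}" using ne i by auto
  ultimately have "min_attained_twice {b, c, d} (\<lambda>j. ?w $ Ksub (insert j {a, i}) + ?w $ Ksub ({b, c, d, i} - {j}))"
    by (simp only:)
  note min = min_attained_twice_3[OF this]
  have sets: "{b, c, d, i} - {c} = {b, d, i}" "{b, c, d, i} - {d} = {b, c, i}" "{b, c, d, i} - {b} = {c, d, i}"
    "insert b {a, i} = {a, b, i}" "insert c {a, i} = {a, c, i}" "insert d {a, i} = {a, d, i}"
    using ne i by auto
  have w: "?w $ triple x y i = q $ pair x y + q $ pair x i + q $ pair y i"
    if "x \<in> {a, b, c, d}" "y \<in> {a, b, c, d}" "x \<noteq> y" for x y
    using that range i by (intro pairs_to_triples_triple) auto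
  show "min (q $ pair a c + q $ pair b d) (q $ pair a d + q $ pair b c) \<le> q $ pair a b + q $ pair c d"
    using min[unfolded sets] w[of a b] w[of a c] w[of a d] w[of b c] w[of b d] w[of c d] ne
    by (auto simp: min_le_iff_disj)
qed

lemma tropicalization_Gr_36_subset: "tropicalization Gr_open \<subseteq> plucker_relations"
  using tropicalization_Gr_36_relation unfolding plucker_relations_def by blast

section \<open>Tree vectors\<close>

text \<open>Modulo lineality this is minus half the split metric of \<open>A\<close>: the indicators
  of \<open>A\<close> at the two points add up to \<open>2 * delta\<close> plus the indicator of
  separated pairs.\<close>

definition delta :: "nat set \<Rightarrow> real ^ (2, 6) ksub" where
  "delta A = (\<chi> J. of_bool (elems J \<subseteq> A))"

definition tree_weights :: "(nat set \<Rightarrow> real) \<Rightarrow> bool" where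
  "tree_weights c \<longleftrightarrow> (\<forall>A. 0 \<le> c A) \<and> {A. c A \<noteq> 0} \<in> families {1..5}"

definition tree_vec :: "(nat \<Rightarrow> real) \<Rightarrow> (nat set \<Rightarrow> real) \<Rightarrow> real ^ (2, 6) ksub" where
  "tree_vec \<mu> c = lin \<mu> + (\<Sum>A\<in>clusters {1..5}. c A *\<^sub>R delta A)"

lemma delta_pair:
  "a \<in> {1..6} \<Longrightarrow> b \<in> {1..6} \<Longrightarrow> a \<noteq> b \<Longrightarrow> delta A $ pair a b = of_bool (a \<in> A \<and> b \<in> A)"
  using elems_pair[of a b] by (simp add: delta_def)

lemma tree_weights_clusters: "tree_weights c \<Longrightarrow> c A \<noteq> 0 \<Longrightarrow> A \<in> clusters {1..5}"
  unfolding tree_weights_def families_def by blast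

lemma tree_vec_pair:
  assumes "tree_weights c" "a \<in> {1..6}" "b \<in> {1..6}" "a \<noteq> b"
  shows "tree_vec \<mu> c $ pair a b = \<mu> a + \<mu> b + cluster_sum {1..5} c a b"
  unfolding tree_vec_def
  using assms lin_pair[of a b \<mu>] cluster_sum_clusters[of "{1..5}" c a b] tree_weights_clusters[OF assms(1)]
  by (simp add: sum_component delta_pair)

lemma cluster_sum_6:
  assumes "tree_weights c" "a = 6 \<or> b = 6"
  shows "cluster_sum {1..5} c a b = 0"
proof (rule cluster_sum_eq_0)
  show "A \<subseteq> {1..5}" if "c A \<noteq> 0" for A
    using tree_weights_clusters[OF assms(1) that] by (auto simp: clusters_def)
qed (use assms(2) in auto)

text \<open>
  Adding a vector of the lineality space makes all \<open>q\<^bsub>i6\<^esub>\<close> vanish; the four-point conditions for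
  \<open>i, j, k, 6\<close> then say that \<open>q\<close> is an ultrametric on the remaining points.
\<close>

lemma four_point_tree_vec:
  assumes "four_point q"
  shows "\<exists>\<mu> c. tree_weights c \<and> q = tree_vec \<mu> c"
proof -
  let ?P = "{1..5 :: nat}"
  define u where "u = (\<lambda>a b. q $ pair a b - q $ pair a 6 - q $ pair b 6)"
  \<comment> \<open>A shift large enough for the nonnegativity demanded by
    \<open>ultra_decomposition\<close>.\<close>
  define C where "C = (\<Sum>i\<in>?P. \<Sum>j\<in>?P. \<bar>u i j\<bar>)"
  have C: "u i j + C \<ge> 0" if "i \<in> ?P" "j \<in> ?P" for i j
  proof -
    have "\<bar>u i j\<bar> \<le> (\<Sum>j\<in>?P. \<bar>u i j\<bar>)" using that by (intro member_le_sum) auto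
    also have "\<dots> \<le> C" unfolding C_def using that by (intro member_le_sum[of i]) (auto intro: sum_nonneg)
    finally show ?thesis by linarith
  qed
  have sym: "u i j = u j i" for i j by (simp add: u_def insert_commute)
  have tri: "u i k \<le> u i j \<or> u k j \<le> u i j"
    if "i \<in> ?P" "j \<in> ?P" "k \<in> ?P" "i \<noteq> j" "i \<noteq> k" "j \<noteq> k" for i j k
  proof -
    have "{i, j, k, 6} \<subseteq> {1..6} \<and> card {i, j, k, 6} = 4" using that by auto
    hence "min (q $ pair i k + q $ pair j 6) (q $ pair i 6 + q $ pair j k) \<le> q $ pair i j + q $ pair k 6"
      using assms unfolding four_point_def by blast
    moreover have "pair k j = pair j k" by (simp add: insert_commute)
    ultimately show ?thesis by (auto simp: u_def min_le_iff_disj)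
  qed
  have "ultra ?P (\<lambda>i j. u i j + C)"
    unfolding ultra_def using sym tri by (auto simp: min_le_iff_disj)
  from ultra_decomposition[OF _ this] C
  obtain c0 where c0: "\<forall>A. c0 A \<ge> 0" "\<forall>A. c0 A \<noteq> 0 \<longrightarrow> A \<subseteq> ?P \<and> card A \<ge> 2" "laminar {A. c0 A \<noteq> 0}"
    "\<forall>i\<in>?P. \<forall>j\<in>?P. i \<noteq> j \<longrightarrow> u i j + C = cluster_sum ?P c0 i j"
    by auto
  define c where "c = c0(?P := 0)"
  have tw: "tree_weights c"
  proof -
    have "{A. c A \<noteq> 0} \<subseteq> clusters ?P" using c0(2) by (auto simp: c_def clusters_def split: if_splits)
    moreover have "laminar {A. c A \<noteq> 0}" using c0(3) by (auto simp: laminar_def c_def)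
    ultimately show ?thesis using c0(1) by (auto simp: tree_weights_def families_def c_def)
  qed
  define K where "K = c0 ?P - C"
  have u: "u i j = cluster_sum ?P c i j + K" if "i \<in> ?P" "j \<in> ?P" "i \<noteq> j" for i j
  proof -
    have "c0 = (\<lambda>A. c A + (if A = ?P then c0 ?P else 0))" by (auto simp: c_def)
    hence "cluster_sum ?P c0 i j = cluster_sum ?P c i j + c0 ?P"
      using cluster_sum_add[of ?P c "\<lambda>A. if A = ?P then c0 ?P else 0" i j]
        cluster_sum_whole[of ?P i j "c0 ?P"] that by simp
    thus ?thesis using c0(4) that unfolding K_def by force
  qed
  \<comment> \<open>The constant \<open>K\<close>, from the shift and the weight of the whole set,
    moves into the lineality part: \<open>K / 2\<close> at each point but \<open>- K / 2\<close> at
    6 adds \<open>K\<close> to pairs within \<open>{1..5}\<close> and nothing to pairs with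
    6.\<close>
  define \<mu> where "\<mu> = (\<lambda>i. if i = 6 then - K / 2 else q $ pair i 6 + K / 2)"
  have "q = tree_vec \<mu> c"
  proof (rule vec_pair_eqI)
    fix a b :: nat assume ab: "a \<in> {1..6}" "b \<in> {1..6}" "a < b"
    show "q $ pair a b = tree_vec \<mu> c $ pair a b"
    proof (cases "b = 6")
      case True
      thus ?thesis using tree_vec_pair[OF tw ab(1,2)] cluster_sum_6[OF tw, of a b] ab by (simp add: \<mu>_def)
    next
      case False
      hence "u a b = cluster_sum ?P c a b + K" using ab by (intro u) auto
      thus ?thesis using tree_vec_pair[OF tw ab(1,2)] False ab by (simp add: \<mu>_def u_def)
    qed
  qed
  with tw show ?thesis by blast
qed

text \<open>The columns are \<open>(1, x i)\<close> for \<open>i \<le> 5\<close> and the point at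
  infinity \<open>(0, 1)\<close> for 6, scaled by elements \<open>z i\<close> of valuation
  \<open>\<mu> i\<close>. Minors become scaled differences of the \<open>x i\<close>.\<close>

lemma tree_vec_realizable:
  assumes c: "tree_weights c" and rat: "\<And>i. \<mu> i \<in> \<rat>" "\<And>A. c A \<in> \<rat>"
  shows "\<exists>M. \<forall>a\<in>{1..6}. \<forall>b\<in>{1..6}. a \<noteq> b \<longrightarrow>
    minor2 M a b \<noteq> 0 \<and> puiseux_val (minor2 M a b) = tree_vec \<mu> c $ pair a b"
proof -
  let ?u = "cluster_sum {1..5} c"
  have "laminar {A. c A \<noteq> 0}" "\<And>A. 0 \<le> c A" using c by (auto simp: tree_weights_def families_def)
  hence "ultra {1..5} ?u" by (intro ultra_cluster_sum) auto
  moreover have "?u i j \<in> \<rat>" for i j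
  proof -
    have "(\<Sum>A\<in>F. c A) \<in> \<rat>" for F
      using rat(2) by (induction F rule: infinite_finite_induct) auto
    thus ?thesis by (simp add: cluster_sum_def)
  qed
  ultimately obtain x where x: "\<forall>i\<in>{1..5}. \<forall>j\<in>{1..5}. i \<noteq> j \<longrightarrow> x i - x j \<noteq> 0 \<and> puiseux_val (x i - x j) = ?u i j"
    using ultra_realizable[of "{1..5 :: nat}" ?u] by auto
  have "\<forall>i. \<exists>z. z \<noteq> 0 \<and> puiseux_val z = \<mu> i" using puiseux_val_rational[OF rat(1)] by metis
  then obtain z where z: "\<And>i. z i \<noteq> 0" "\<And>i. puiseux_val (z i) = \<mu> i" by metis
  define M :: "nat \<Rightarrow> nat \<Rightarrow> puiseux" where "M = (\<lambda>r i. if r = 0 then if i = 6 then 0 else z i else if i = 6 then z 6 else z i * x i)"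
  have "minor2 M a b \<noteq> 0 \<and> puiseux_val (minor2 M a b) = tree_vec \<mu> c $ pair a b"
    if ab: "a \<in> {1..6}" "b \<in> {1..6}" "a \<noteq> b" for a b
  proof -
    consider "a \<in> {1..5}" "b \<in> {1..5}" | "a \<noteq> 6" "b = 6" | "a = 6" "b \<noteq> 6" using ab by force
    thus ?thesis
    proof cases
      case 1
      have "minor2 M a b = z a * z b * (x b - x a)" using 1 by (auto simp: minor2_def M_def algebra_simps)
      moreover have "x b - x a \<noteq> 0" "puiseux_val (x b - x a) = ?u a b"
        using x 1 ab cluster_sum_commute[of "{1..5}" c a b] by auto
      ultimately show ?thesis using z tree_vec_pair[OF c ab] by (simp add: puiseux_val_mult)
    next
      case 2
      thus ?thesis using z tree_vec_pair[OF c ab] cluster_sum_6[OF c, of a b]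
        by (simp add: minor2_def M_def puiseux_val_mult)
    next
      case 3
      thus ?thesis using z tree_vec_pair[OF c ab] cluster_sum_6[OF c, of a b]
        by (simp add: minor2_def M_def puiseux_val_mult)
    qed
  qed
  thus ?thesis by blast
qed

lemma rational_tree_vec_tropical:
  assumes c: "tree_weights c" and rat: "\<And>i. \<mu> i \<in> \<rat>" "\<And>A. c A \<in> \<rat>"
  shows "tree_vec \<mu> c \<in> tropicalization Gr_open" "pairs_to_triples (tree_vec \<mu> c) \<in> tropicalization SGr_open"
proof -
  from tree_vec_realizable[OF assms] obtain M where "\<forall>a\<in>{1..6}. \<forall>b\<in>{1..6}. a \<noteq> b \<longrightarrow>
    minor2 M a b \<noteq> 0 \<and> puiseux_val (minor2 M a b) = tree_vec \<mu> c $ pair a b" ..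
  hence M: "\<And>a b. a \<in> {1..6} \<Longrightarrow> b \<in> {1..6} \<Longrightarrow> a \<noteq> b \<Longrightarrow> minor2 M a b \<noteq> 0"
    "\<And>a b. a \<in> {1..6} \<Longrightarrow> b \<in> {1..6} \<Longrightarrow> a \<noteq> b \<Longrightarrow> puiseux_val (minor2 M a b) = tree_vec \<mu> c $ pair a b"
    by simp_all
  let ?p = "plucker M :: (2, 6) ksub \<Rightarrow> puiseux"
  have nz: "?p J \<noteq> 0" for J
    by (rule pairE[of J]) (use M(1) plucker_pair in auto)
  hence "?p \<in> Gr_open" unfolding Gr_open_def Gr_def by blast
  hence "(\<chi> J. puiseux_val (?p J)) \<in> tropicalization Gr_open" using nz by (intro val_mem_tropicalization)
  also have "(\<chi> J. puiseux_val (?p J)) = tree_vec \<mu> c"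
    by (rule vec_pair_eqI) (use M(2) plucker_pair in auto)
  finally show "tree_vec \<mu> c \<in> tropicalization Gr_open" .
  let ?V = "plucker (\<lambda>r i. M 0 i ^ (2 - r) * M 1 i ^ r) :: (3, 6) ksub \<Rightarrow> puiseux"
  have V: "?V \<in> SGr_open" using M(1) by (rule veronese_mem_SGr(1))
  hence "?V I \<noteq> 0" for I unfolding SGr_open_def Gr_open_def by blast
  hence "(\<chi> I. puiseux_val (?V I)) \<in> tropicalization SGr_open" using V by (intro val_mem_tropicalization)
  also have "(\<chi> I. puiseux_val (?V I)) = pairs_to_triples (tree_vec \<mu> c)"
  proof (rule vec_triple_eqI)
    fix a b d :: nat assume *: "a \<in> {1..6}" "b \<in> {1..6}" "d \<in> {1..6}" "a < b" "b < d"
    have "?V (triple a b d) = minor2 M a b * minor2 M a d * minor2 M b d"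
      using M(1) * by (rule veronese_mem_SGr(2))
    thus "(\<chi> I. puiseux_val (?V I)) $ triple a b d = pairs_to_triples (tree_vec \<mu> c) $ triple a b d"
      using * M[of a b] M[of a d] M[of b d] by (simp add: puiseux_val_mult pairs_to_triples_triple)
  qed
  finally show "pairs_to_triples (tree_vec \<mu> c) \<in> tropicalization SGr_open" .
qed

text \<open>Rounding down preserves zero and nonnegativity, so approximated weights stay on the same
  laminar family.\<close>

definition rat_below :: "nat \<Rightarrow> real \<Rightarrow> real" where
  "rat_below n x = of_int \<lfloor>of_nat (Suc n) * x\<rfloor> / of_nat (Suc n)"

lemma rat_below_tendsto: "(\<lambda>n. rat_below n x) \<longlonglongrightarrow> x"
proof (rule LIMSEQ_I)
  fix r :: real assume r: "r > 0"
  obtain N where N: "1 / real (Suc N) < r" using r nat_approx_posE by blast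
  show "\<exists>N. \<forall>n\<ge>N. norm (rat_below n x - x) < r"
  proof (intro exI[of _ N] allI impI)
    fix n assume n: "n \<ge> N"
    define k where "k = real (Suc n)"
    have k: "k > 0" by (simp add: k_def)
    have "k * x - 1 < of_int \<lfloor>k * x\<rfloor>" "of_int \<lfloor>k * x\<rfloor> \<le> k * x" by linarith+
    hence "(k * x - 1) / k < of_int \<lfloor>k * x\<rfloor> / k" "of_int \<lfloor>k * x\<rfloor> / k \<le> k * x / k"
      using k by (simp_all only: divide_strict_right_mono divide_right_mono less_imp_le)
    hence "x - 1 / k < of_int \<lfloor>k * x\<rfloor> / k" "of_int \<lfloor>k * x\<rfloor> / k \<le> x"
      using k by (simp_all add: diff_divide_distrib)
    hence "\<bar>rat_below n x - x\<bar> < 1 / k" by (auto simp: rat_below_def k_def)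
    also have "1 / k \<le> 1 / real (Suc N)" unfolding k_def using n by (intro divide_left_mono) auto
    finally show "norm (rat_below n x - x) < r" using N by simp
  qed
qed

lemma tree_vec_tropical:
  assumes c: "tree_weights c"
  shows "tree_vec \<mu> c \<in> tropicalization Gr_open" "pairs_to_triples (tree_vec \<mu> c) \<in> tropicalization SGr_open"
proof -
  define q where "q = (\<lambda>n. tree_vec (\<lambda>i. rat_below n (\<mu> i)) (\<lambda>A. rat_below n (c A)))"
  have "tree_weights (\<lambda>A. rat_below n (c A))" for n
  proof -
    have "{A. rat_below n (c A) \<noteq> 0} \<subseteq> {A. c A \<noteq> 0}" by (auto simp: rat_below_def)
    moreover have "0 \<le> rat_below n (c A)" for A using c by (simp add: tree_weights_def rat_below_def)
    ultimately show ?thesis using c families_subset unfolding tree_weights_def by blast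
  qed
  moreover have "rat_below n x \<in> \<rat>" for n x by (simp add: rat_below_def)
  ultimately have mem: "q n \<in> tropicalization Gr_open" "pairs_to_triples (q n) \<in> tropicalization SGr_open" for n
    unfolding q_def by (auto intro: rational_tree_vec_tropical)
  have lim: "q \<longlonglongrightarrow> tree_vec \<mu> c"
    unfolding q_def tree_vec_def lin_def
    by (intro tendsto_intros vec_tendstoI) (auto intro!: tendsto_intros rat_below_tendsto)
  have "continuous (at x) pairs_to_triples" for x
    by (intro linear_continuous_at linear_conv_bounded_linear[THEN iffD1] linear_pairs_to_triples)
  hence lim2: "(\<lambda>n. pairs_to_triples (q n)) \<longlonglongrightarrow> pairs_to_triples (tree_vec \<mu> c)"
    using lim by (rule isCont_tendsto_compose)
  show "tree_vec \<mu> c \<in> tropicalization Gr_open"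
    by (rule closed_sequentially[OF closed_tropicalization _ lim]) (rule mem)
  show "pairs_to_triples (tree_vec \<mu> c) \<in> tropicalization SGr_open"
    by (rule closed_sequentially[OF closed_tropicalization _ lim2]) (rule mem)
qed

text \<open>The converse passes through realizability: a tree vector is a tropical point of the
  Grassmannian, hence satisfies the four-point conditions.\<close>

lemma four_point_iff: "four_point q \<longleftrightarrow> (\<exists>\<mu> c. tree_weights c \<and> q = tree_vec \<mu> c)"
  using four_point_tree_vec tropicalization_Gr_26_four_point tree_vec_tropical(1) by blast

lemma tropicalization_Gr_26: "tropicalization Gr_open = {q :: real ^ (2, 6) ksub. four_point q}"
proof (intro equalityI subsetI CollectI)
  fix q :: "real ^ (2, 6) ksub" assume "q \<in> {q. four_point q}"
  then obtain \<mu> c where "tree_weights c" "q = tree_vec \<mu> c" by (auto simp: four_point_iff)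
  thus "q \<in> tropicalization Gr_open" using tree_vec_tropical(1) by simp
qed (rule tropicalization_Gr_26_four_point)

text \<open>The inclusions 1 to 4 form a cycle starting and ending at the image of the four-point
  vectors, so the sets coincide all at once.\<close>

lemma
  shows tropicalization_SGr_36: "tropicalization SGr_open = pairs_to_triples ` {q. four_point q}"
    and tropicalization_Gr_36_sd: "tropicalization Gr_open \<inter> L_sd = pairs_to_triples ` {q. four_point q}"
    and plucker_relations_sd: "plucker_relations \<inter> L_sd = pairs_to_triples ` {q. four_point q}"
proof -
  have 1: "pairs_to_triples ` {q. four_point q} \<subseteq> tropicalization SGr_open"
    by (auto simp: four_point_iff tree_vec_tropical(2))
  have "(SGr_open :: ((3, 6) ksub \<Rightarrow> puiseux) set) \<subseteq> Gr_open" by (auto simp: SGr_open_def)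
  hence 2: "tropicalization (SGr_open :: ((3, 6) ksub \<Rightarrow> puiseux) set) \<subseteq> tropicalization Gr_open \<inter> L_sd"
    using tropicalization_mono tropicalization_SGr_subset_L_sd by blast
  have 3: "tropicalization (Gr_open :: ((3, 6) ksub \<Rightarrow> puiseux) set) \<inter> L_sd \<subseteq> plucker_relations \<inter> L_sd"
    using tropicalization_Gr_36_subset by blast
  have 4: "plucker_relations \<inter> L_sd \<subseteq> pairs_to_triples ` {q. four_point q}"
  proof
    fix w assume w: "w \<in> plucker_relations \<inter> L_sd"
    then obtain q where "pairs_to_triples q = w" using L_sd_pairs_to_triples[of w] by blast
    moreover from this w have "four_point q" by (intro four_point_of_plucker_relations) simp
    ultimately show "w \<in> pairs_to_triples ` {q. four_point q}" by blast
  qed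
  show "tropicalization SGr_open = pairs_to_triples ` {q. four_point q}"
    "tropicalization Gr_open \<inter> L_sd = pairs_to_triples ` {q. four_point q}"
    "plucker_relations \<inter> L_sd = pairs_to_triples ` {q. four_point q}"
    using 1 2 3 4 by blast+
qed

section \<open>Quotients by the lines of constants and by the lineality space\<close>

lemma tpt_proj_eq_iff: "tpt_proj x = tpt_proj y \<longleftrightarrow> x - y \<in> ones_line"
  by transfer simp

lemma tmod_proj_eq_iff: "tmod_proj x = tmod_proj y \<longleftrightarrow> x - y \<in> lineality"
  by transfer simp

lemma tpt_projE: obtains x where "t = tpt_proj x"
proof -
  have "\<exists>x. t = tpt_proj x" by transfer (metis diff_self subspace_0[OF subspace_ones_line])
  thus ?thesis using that by blast
qed

lemma tmod_projE: obtains x where "t = tmod_proj x"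
proof -
  have "\<exists>x. t = tmod_proj x" by transfer (metis diff_self subspace_0[OF subspace_lineality])
  thus ?thesis using that by blast
qed

lemma linear_tpt_proj: "linear tpt_proj"
  by (rule linearI; transfer) (simp_all add: subspace_0[OF subspace_ones_line])

lemma linear_tmod_proj: "linear tmod_proj"
  by (rule linearI; transfer) (simp_all add: subspace_0[OF subspace_lineality])

lemmas tpt_proj_linear = linear_add[OF linear_tpt_proj] linear_scale[OF linear_tpt_proj]
  linear_sum[OF linear_tpt_proj]

lemmas tmod_proj_linear = linear_add[OF linear_tmod_proj] linear_scale[OF linear_tmod_proj]
  linear_sum[OF linear_tmod_proj]

lemma mod_lineality_tpt_proj: "mod_lineality (tpt_proj x) = tmod_proj x"
  by transfer (simp add: subspace_0[OF subspace_lineality])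

lemma linear_mod_lineality: "linear mod_lineality"
  by (rule linearI; transfer) (simp_all add: subspace_0[OF subspace_lineality])

lemma pairs_to_triples_tpt_proj: "pairs_to_triples_tpt (tpt_proj q) = tpt_proj (pairs_to_triples q)"
  by transfer (simp add: subspace_0[OF subspace_ones_line])

lemma pairs_to_triples_tmod_proj: "pairs_to_triples_tmod (tmod_proj q) = tmod_proj (pairs_to_triples q)"
  by transfer (simp add: subspace_0[OF subspace_lineality])

lemma linear_pairs_to_triples_tpt: "linear pairs_to_triples_tpt"
  by (rule linearI; transfer)
    (simp_all add: linear_add[OF linear_pairs_to_triples] linear_scale[OF linear_pairs_to_triples]
      subspace_0[OF subspace_ones_line])

lemma linear_pairs_to_triples_tmod: "linear pairs_to_triples_tmod"
  by (rule linearI; transfer)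
    (simp_all add: linear_add[OF linear_pairs_to_triples] linear_scale[OF linear_pairs_to_triples]
      subspace_0[OF subspace_lineality])

lemma pairs_to_triples_lineality:
  assumes "pairs_to_triples q \<in> lineality"
  shows "q \<in> lineality"
proof -
  obtain \<mu> where "pairs_to_triples q = lin \<mu>" using assms unfolding lineality_eq by blast
  hence "pairs_to_triples q = pairs_to_triples (lin (\<lambda>i. \<mu> i / 2))" by (simp add: pairs_to_triples_lin)
  hence "q = lin (\<lambda>i. \<mu> i / 2)" using inj_pairs_to_triples by (auto dest: injD)
  thus ?thesis unfolding lineality_eq by blast
qed

lemma inj_pairs_to_triples_tmod: "inj pairs_to_triples_tmod"
proof (rule injI)
  fix x y assume eq: "pairs_to_triples_tmod x = pairs_to_triples_tmod y"
  obtain p q where pq: "x = tmod_proj p" "y = tmod_proj q" by (metis tmod_projE)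
  hence "pairs_to_triples p - pairs_to_triples q \<in> lineality"
    using eq by (simp add: pairs_to_triples_tmod_proj tmod_proj_eq_iff)
  hence "p - q \<in> lineality"
    using pairs_to_triples_lineality[of "p - q"] linear_diff[OF linear_pairs_to_triples] by simp
  thus "x = y" by (simp add: pq tmod_proj_eq_iff)
qed

text \<open>Two triples that share a pair and differ in \<open>i\<close> and \<open>j\<close> have
  entries differing by \<open>\<mu> i - \<mu> j\<close>.\<close>

lemma lin_ones_line:
  assumes "(lin \<mu> :: real ^ (3, 6) ksub) \<in> ones_line" "i \<in> {1..6}" "j \<in> {1..6}"
  shows "\<mu> i = \<mu> j"
proof (cases "i = j")
  case False
  obtain A where A: "A \<subseteq> {1..6} - {i, j}" "card A = 2" using obtain_outside[of "{i, j}" 2] assms False by auto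
  then obtain x y where xy: "A = {x, y}" "x \<noteq> y" unfolding card_2_iff by blast
  obtain k where k: "lin \<mu> = (\<chi> I :: (3, 6) ksub. k)" using assms(1) by (auto simp: ones_line_def)
  have "lin \<mu> $ triple x y i = \<mu> x + \<mu> y + \<mu> i" "lin \<mu> $ triple x y j = \<mu> x + \<mu> y + \<mu> j"
    using A xy assms by (auto intro!: lin_triple)
  thus ?thesis using k by simp
qed simp

lemma lin_const: "(lin (\<lambda>_. k) :: real ^ ('k, 'n) ksub) \<in> ones_line"
  unfolding ones_line_def by (rule image_eqI[of _ _ "real (min CARD('k) CARD('n)) * k"])
    (auto simp: lin_def vec_eq_iff card_elems)

lemma inj_pairs_to_triples_tpt: "inj pairs_to_triples_tpt"
proof (rule injI)
  fix x y assume eq: "pairs_to_triples_tpt x = pairs_to_triples_tpt y"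
  obtain p q where pq: "x = tpt_proj p" "y = tpt_proj q" by (metis tpt_projE)
  hence "pairs_to_triples p - pairs_to_triples q \<in> ones_line"
    using eq by (simp add: pairs_to_triples_tpt_proj tpt_proj_eq_iff)
  hence mem: "pairs_to_triples (p - q) \<in> ones_line" using linear_diff[OF linear_pairs_to_triples] by simp
  hence "pairs_to_triples (p - q) \<in> lineality" using ones_line_subset_lineality by blast
  then obtain \<mu> where \<mu>: "p - q = lin \<mu>" using pairs_to_triples_lineality unfolding lineality_eq by blast
  hence const: "2 * \<mu> i = 2 * \<mu> 1" if "i \<in> {1..6}" for i
    using mem that by (intro lin_ones_line[of "\<lambda>i. 2 * \<mu> i"]) (auto simp: pairs_to_triples_lin)
  have "lin \<mu> = (lin (\<lambda>_. \<mu> 1) :: real ^ (2, 6) ksub)"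
  proof (rule vec_pair_eqI)
    fix a b :: nat assume "a \<in> {1..6}" "b \<in> {1..6}" "a < b"
    thus "lin \<mu> $ pair a b = lin (\<lambda>_. \<mu> 1) $ pair a b"
      using const[of a] const[of b] lin_pair[of a b] by simp
  qed
  thus "x = y" using lin_const[of "\<mu> 1"] by (simp add: pq tpt_proj_eq_iff \<mu>)
qed

text \<open>\<open>L_sd\<close> is a union of cosets of the lineality space, so intersecting with it
  commutes with both projections.\<close>

lemma L_sd_lineality:
  assumes "z \<in> L_sd" "w - z \<in> lineality"
  shows "w \<in> L_sd"
proof -
  have "w - z \<in> L_sd" unfolding L_sd_def using assms(2) by (intro span_base) simp
  hence "z + (w - z) \<in> L_sd" using assms(1) unfolding L_sd_def by (rule span_add[rotated])
  thus ?thesis by simp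
qed

lemma sd_tpt_proj: "sd_tpt (tpt_proj ` Y) = tpt_proj ` (Y \<inter> L_sd)"
  unfolding sd_tpt_def
proof (intro equalityI subsetI)
  fix t assume "t \<in> tpt_proj ` Y \<inter> tpt_proj ` L_sd"
  then obtain w z where w: "t = tpt_proj w" "w \<in> Y" "z \<in> L_sd" "tpt_proj w = tpt_proj z" by blast
  hence "w - z \<in> lineality" using ones_line_subset_lineality unfolding tpt_proj_eq_iff by blast
  hence "w \<in> L_sd" using w(3) L_sd_lineality by blast
  thus "t \<in> tpt_proj ` (Y \<inter> L_sd)" using w by blast
qed blast

lemma sd_tmod_proj: "sd_tmod (tmod_proj ` Y) = tmod_proj ` (Y \<inter> L_sd)"
  unfolding sd_tmod_def
proof (intro equalityI subsetI)
  fix t assume "t \<in> tmod_proj ` Y \<inter> tmod_proj ` L_sd"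
  then obtain w z where w: "t = tmod_proj w" "w \<in> Y" "z \<in> L_sd" "tmod_proj w = tmod_proj z" by blast
  hence "w \<in> L_sd" using L_sd_lineality unfolding tmod_proj_eq_iff by blast
  thus "t \<in> tmod_proj ` (Y \<inter> L_sd)" using w by blast
qed blast

section \<open>The tropical varieties as projections of four-point vectors\<close>

lemma trop_SGr_36: "trop_SGr = tpt_proj ` pairs_to_triples ` {q. four_point q}"
  unfolding trop_SGr_def tropicalization_SGr_36 ..

lemma sd_trop_Gr_36: "sd_tpt (trop_Gr :: (3, 6) ksub tpt set) = tpt_proj ` pairs_to_triples ` {q. four_point q}"
  unfolding trop_Gr_def sd_tpt_proj tropicalization_Gr_36_sd ..

lemma sd_Dressian_36: "sd_tpt (Dressian :: (3, 6) ksub tpt set) = tpt_proj ` pairs_to_triples ` {q. four_point q}"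
proof -
  have Dr: "(Dressian :: (3, 6) ksub tpt set) = tpt_proj ` plucker_relations"
    unfolding Dressian_def plucker_relations_def by simp
  show ?thesis unfolding Dr sd_tpt_proj plucker_relations_sd ..
qed

lemma trop_Gr_26: "trop_Gr = tpt_proj ` {q :: real ^ (2, 6) ksub. four_point q}"
  unfolding trop_Gr_def tropicalization_Gr_26 ..

lemma mod_lineality_image: "mod_lineality ` tpt_proj ` Y = tmod_proj ` Y"
  by (simp add: image_image mod_lineality_tpt_proj)

lemma trop_S_36: "trop_S = tmod_proj ` pairs_to_triples ` {q. four_point q}"
  unfolding trop_S_def trop_SGr_36 mod_lineality_image ..

lemma trop_R_36_sd: "sd_tmod (trop_R :: (3, 6) tmod set) = tmod_proj ` pairs_to_triples ` {q. four_point q}"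
  unfolding trop_R_def trop_Gr_def mod_lineality_image sd_tmod_proj tropicalization_Gr_36_sd ..

lemma trop_R_26: "trop_R = tmod_proj ` {q :: real ^ (2, 6) ksub. four_point q}"
  unfolding trop_R_def trop_Gr_26 mod_lineality_image ..


section \<open>The fans of \<open>trop(S(3))\<close> and \<open>trop(SGr(3,6))\<close>\<close>

text \<open>On \<open>pairs_to_triples q\<close> this is \<open>q\<^bsub>ab\<^esub> + q\<^bsub>d6\<^esub> - q\<^bsub>ad\<^esub> - q\<^bsub>b6\<^esub>\<close>; the point \<open>i\<close> is auxiliary.\<close>

definition quartet :: "nat \<Rightarrow> nat \<Rightarrow> nat \<Rightarrow> real ^ (3, 6) ksub \<Rightarrow> real" where
  "quartet a b d w = (let i = Min ({1..5} - {a, b, d}) in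
     w $ triple a b i + w $ triple d 6 i - w $ triple a d i - w $ triple b 6 i)"

text \<open>Evaluation at a representative; for distinct points \<open>quartet\<close> vanishes on
  the lineality space, so the choice does not matter.\<close>

definition quartet_tmod :: "nat \<Rightarrow> nat \<Rightarrow> nat \<Rightarrow> (3, 6) tmod \<Rightarrow> real" where
  "quartet_tmod a b d x = quartet a b d (rep_tmod x)"

lemma linear_quartet: "linear (quartet a b d)"
  by (rule linearI) (simp_all add: quartet_def Let_def algebra_simps)

text \<open>The pairs through the auxiliary point cancel. After subtracting the values at pairs with
  6, what remains is the difference of the ultrametric at \<open>ab\<close> and
  \<open>ad\<close>.\<close>

lemma quartet_eq:
  assumes "a \<in> {1..5}" "b \<in> {1..5}" "d \<in> {1..5}" "a \<noteq> b" "a \<noteq> d" "b \<noteq> d"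
  shows "quartet a b d (pairs_to_triples q) = q $ pair a b + q $ pair d 6 - q $ pair a d - q $ pair b 6"
    and "quartet a b d (lin \<mu>) = 0"
proof -
  define i where "i = Min ({1..5} - {a, b, d})"
  have "card {1..5 :: nat} > card {a, b, d}" using assms by simp
  hence "{1..5} - {a, b, d} \<noteq> {}" using card_mono[of "{a, b, d}" "{1..5}"] by auto
  hence "i \<in> {1..5} - {a, b, d}" unfolding i_def by (intro Min_in) auto
  hence i: "i \<in> {1..6}" "a \<noteq> i" "b \<noteq> i" "d \<noteq> i" "6 \<noteq> i" by auto
  have r: "a \<in> {1..6}" "b \<in> {1..6}" "d \<in> {1..6}" "6 \<in> {1..6 :: nat}" "a \<noteq> 6" "b \<noteq> 6" "d \<noteq> 6"
    using assms by auto
  show "quartet a b d (pairs_to_triples q) = q $ pair a b + q $ pair d 6 - q $ pair a d - q $ pair b 6"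
    unfolding quartet_def i_def[symmetric] Let_def
    using pairs_to_triples_triple[of a b i q] pairs_to_triples_triple[of d 6 i q]
      pairs_to_triples_triple[of a d i q] pairs_to_triples_triple[of b 6 i q] assms r i by simp
  show "quartet a b d (lin \<mu>) = 0"
    unfolding quartet_def i_def[symmetric] Let_def
    using lin_triple[of a b i \<mu>] lin_triple[of d 6 i \<mu>] lin_triple[of a d i \<mu>] lin_triple[of b 6 i \<mu>] assms r i
    by simp
qed

lemma quartet_tmod_proj:
  assumes "a \<in> {1..5}" "b \<in> {1..5}" "d \<in> {1..5}" "a \<noteq> b" "a \<noteq> d" "b \<noteq> d"
  shows "quartet_tmod a b d (tmod_proj w) = quartet a b d w"
proof -
  have "tmod_proj (rep_tmod (tmod_proj w)) = tmod_proj w"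
    by (metis Quotient_abs_rep[OF Quotient_tmod] tmod_proj.abs_eq tmod_projE)
  then obtain \<mu> where "rep_tmod (tmod_proj w) - w = lin \<mu>"
    unfolding tmod_proj_eq_iff lineality_eq by blast
  hence "quartet a b d (rep_tmod (tmod_proj w)) - quartet a b d w = 0"
    using linear_diff[OF linear_quartet, of a b d "rep_tmod (tmod_proj w)" w] quartet_eq(2)[OF assms] by simp
  thus ?thesis by (simp add: quartet_tmod_def)
qed

lemma linear_quartet_tmod:
  assumes "a \<in> {1..5}" "b \<in> {1..5}" "d \<in> {1..5}" "a \<noteq> b" "a \<noteq> d" "b \<noteq> d"
  shows "linear (quartet_tmod a b d)"
proof (rule linearI)
  fix x y :: "(3, 6) tmod" and r :: real
  obtain p q where [simp]: "x = tmod_proj p" "y = tmod_proj q" by (metis tmod_projE)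
  have "x + y = tmod_proj (p + q)" "r *\<^sub>R x = tmod_proj (r *\<^sub>R p)"
    by (simp_all add: tmod_proj_linear)
  thus "quartet_tmod a b d (x + y) = quartet_tmod a b d x + quartet_tmod a b d y"
    "quartet_tmod a b d (r *\<^sub>R x) = r *\<^sub>R quartet_tmod a b d x"
    by (simp_all add: quartet_tmod_proj[OF assms] linear_add[OF linear_quartet] linear_scale[OF linear_quartet])
qed

definition ray :: "nat set \<Rightarrow> real ^ (3, 6) ksub" where
  "ray A = pairs_to_triples (delta A)"

lemma quartet_ray:
  assumes "a \<in> {1..5}" "b \<in> {1..5}" "d \<in> {1..5}" "a \<noteq> b" "a \<noteq> d" "b \<noteq> d" "A \<in> clusters {1..5}"
  shows "quartet a b d (ray A) = of_bool (a \<in> A \<and> b \<in> A) - of_bool (a \<in> A \<and> d \<in> A)"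
proof -
  have "6 \<notin> A" using assms(7) by (auto simp: clusters_def)
  moreover have "a \<in> {1..6}" "b \<in> {1..6}" "d \<in> {1..6}" "a \<noteq> 6" "b \<noteq> 6" "d \<noteq> 6" using assms by auto
  ultimately show ?thesis
    unfolding ray_def quartet_eq(1)[OF assms(1-6)] using assms by (simp add: delta_pair)
qed

lemma pairs_to_triples_tree_vec:
  "pairs_to_triples (tree_vec \<mu> c) = lin (\<lambda>i. 2 * \<mu> i) + (\<Sum>A\<in>clusters {1..5}. c A *\<^sub>R ray A)"
  unfolding tree_vec_def ray_def using linear_pairs_to_triples
  by (simp add: linear_add linear_sum linear_scale pairs_to_triples_lin)

lemma (in cluster_fan) support_eq:
  "support = {pt n c | n c. n \<in> N \<and> (\<forall>A. 0 \<le> c A) \<and> {A. c A \<noteq> 0} \<in> families P}"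
proof (intro equalityI subsetI)
  fix x assume "x \<in> support"
  then obtain s where s: "s \<in> families P" "x \<in> ccone s" unfolding support_def cfan_def by blast
  then obtain n c where "n \<in> N" "c \<in> weights s" "x = pt n c" unfolding ccone_def by blast
  thus "x \<in> {pt n c | n c. n \<in> N \<and> (\<forall>A. 0 \<le> c A) \<and> {A. c A \<noteq> 0} \<in> families P}"
    using supp_family[OF _ s(1)] unfolding weights_def by blast
next
  fix x assume "x \<in> {pt n c | n c. n \<in> N \<and> (\<forall>A. 0 \<le> c A) \<and> {A. c A \<noteq> 0} \<in> families P}"
  then obtain n c where x: "x = pt n c" "n \<in> N" "\<forall>A. 0 \<le> c A" "{A. c A \<noteq> 0} \<in> families P" by blast
  hence "c \<in> weights {A. c A \<noteq> 0}" by (simp add: weights_def)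
  thus "x \<in> support" using x unfolding support_def cfan_def ccone_def by blast
qed

interpretation tmod_fan: cluster_fan "{1..5}" "{0}" "{}" "\<lambda>A. tmod_proj (ray A)" quartet_tmod
proof (rule cluster_fan.intro)
  fix a b d :: nat assume *: "a \<in> {1..5}" "b \<in> {1..5}" "d \<in> {1..5}" "a \<noteq> b" "a \<noteq> d" "b \<noteq> d"
  show "linear (quartet_tmod a b d)" using * by (rule linear_quartet_tmod)
  thus "quartet_tmod a b d n = 0" if "n \<in> {0}" for n using that linear_0 by auto
  show "quartet_tmod a b d (tmod_proj (ray A)) = of_bool (a \<in> A \<and> b \<in> A) - of_bool (a \<in> A \<and> d \<in> A)"
    if "A \<in> clusters {1..5}" for A
    unfolding quartet_tmod_proj[OF *] using quartet_ray[OF * that] .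
qed (auto simp: independent_empty)

text \<open>The six such vectors add up to the constant 3, which is 0 in the quotient; so the first
  five span the image of the lineality space.\<close>

definition unit_vec :: "nat \<Rightarrow> (3, 6) ksub tpt" where
  "unit_vec i = tpt_proj (lin (\<lambda>k. of_bool (k = i)))"

lemma sum_unit_vec:
  "(\<Sum>i\<in>{1..5}. r i *\<^sub>R unit_vec i) = tpt_proj (lin (\<lambda>k. if k \<in> {1..5} then r k else 0))"
proof -
  have "(\<Sum>i\<in>{1..5}. r i *\<^sub>R unit_vec i) = tpt_proj (\<Sum>i\<in>{1..5}. r i *\<^sub>R lin (\<lambda>k. of_bool (k = i)))"
    unfolding unit_vec_def tpt_proj_linear ..
  also have "(\<Sum>i\<in>{1..5}. r i *\<^sub>R lin (\<lambda>k. of_bool (k = i))) =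
      (lin (\<lambda>k. if k \<in> {1..5} then r k else 0) :: real ^ (3, 6) ksub)"
  proof (subst vec_eq_iff, intro allI)
    fix I :: "(3, 6) ksub"
    have "(\<Sum>i\<in>{1..5}. r i *\<^sub>R lin (\<lambda>k. of_bool (k = i))) $ I = (\<Sum>i\<in>{1..5}. \<Sum>k\<in>elems I. if k = i then r i else 0)"
      unfolding sum_component lin_def by (intro sum.cong) (auto simp: sum_distrib_left if_distrib cong: if_cong)
    also have "\<dots> = (\<Sum>k\<in>elems I. \<Sum>i\<in>{1..5}. if k = i then r i else 0)" by (rule sum.swap)
    also have "\<dots> = lin (\<lambda>k. if k \<in> {1..5} then r k else 0) $ I"
      unfolding lin_def by (simp add: sum.delta)
    finally show "(\<Sum>i\<in>{1..5}. r i *\<^sub>R lin (\<lambda>k. of_bool (k = i))) $ I =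
      lin (\<lambda>k. if k \<in> {1..5} then r k else 0) $ I" .
  qed
  finally show ?thesis .
qed

lemma sum_unit_vec_eq_0:
  assumes "(\<Sum>i\<in>{1..5}. r i *\<^sub>R unit_vec i) = 0" "i \<in> {1..5}"
  shows "r i = 0"
proof -
  let ?\<mu> = "\<lambda>k. if k \<in> {1..5} then r k else 0"
  have "tpt_proj (lin ?\<mu>) = (tpt_proj 0 :: (3, 6) ksub tpt)"
    using assms(1) linear_0[OF linear_tpt_proj] unfolding sum_unit_vec by simp
  hence "(lin ?\<mu> :: real ^ (3, 6) ksub) \<in> ones_line" unfolding tpt_proj_eq_iff by simp
  from lin_ones_line[OF this, of i 6] assms(2) show ?thesis by auto
qed

lemma inj_on_unit_vec: "inj_on unit_vec {1..5}"
proof (rule inj_onI)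
  fix i j :: nat assume ij: "i \<in> {1..5}" "j \<in> {1..5}" "unit_vec i = unit_vec j"
  have sum: "(\<Sum>k\<in>{1..5}. (of_bool (k = m) :: real) *\<^sub>R unit_vec k) = unit_vec m" if "m \<in> {1..5}" for m
  proof -
    have "(\<Sum>k\<in>{1..5}. (of_bool (k = m) :: real) *\<^sub>R unit_vec k) = (\<Sum>k\<in>{1..5}. if k = m then unit_vec k else 0)"
      by (intro sum.cong) auto
    thus ?thesis using that by (simp add: sum.delta)
  qed
  have "(\<Sum>k\<in>{1..5}. (of_bool (k = i) - of_bool (k = j) :: real) *\<^sub>R unit_vec k) = 0"
    unfolding scaleR_diff_left sum_subtractf sum[OF ij(1)] sum[OF ij(2)] using ij(3) by simp
  from sum_unit_vec_eq_0[OF this ij(1)] show "i = j" by (auto split: if_splits)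
qed

lemma independent_unit_vec: "independent (unit_vec ` {1..5})"
proof (rule independent_if_scalars_zero)
  fix f x assume *: "(\<Sum>x\<in>unit_vec ` {1..5}. f x *\<^sub>R x) = 0" "x \<in> unit_vec ` {1..5}"
  have "(\<Sum>i\<in>{1..5}. f (unit_vec i) *\<^sub>R unit_vec i) = 0"
    using *(1) unfolding sum.reindex[OF inj_on_unit_vec] by simp
  thus "f x = 0" using sum_unit_vec_eq_0[of "\<lambda>i. f (unit_vec i)"] *(2) by blast
qed simp

lemma span_unit_vec: "tpt_proj ` lineality = span (unit_vec ` {1..5})"
proof
  show "span (unit_vec ` {1..5}) \<subseteq> tpt_proj ` lineality"
  proof (rule span_minimal)
    show "unit_vec ` {1..5} \<subseteq> tpt_proj ` lineality" unfolding unit_vec_def lineality_eq by blast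
    show "subspace (tpt_proj ` (lineality :: (real ^ (3, 6) ksub) set))"
      using linear_tpt_proj subspace_lineality by (rule linear_subspace_image)
  qed
  show "tpt_proj ` lineality \<subseteq> span (unit_vec ` {1..5})"
  proof
    fix t assume "t \<in> tpt_proj ` (lineality :: (real ^ (3, 6) ksub) set)"
    then obtain \<mu> where t: "t = tpt_proj (lin \<mu>)" unfolding lineality_eq by blast
    \<comment> \<open>Subtracting \<open>\<mu> 6\<close> everywhere changes the vector by a constant
      and removes the coordinate at 6.\<close>
    let ?\<nu> = "\<lambda>k. if k \<in> {1..5} then \<mu> k - \<mu> 6 else 0"
    have "lin \<mu> = lin ?\<nu> + (lin (\<lambda>_. \<mu> 6) :: real ^ (3, 6) ksub)"
      unfolding lin_add
    proof (rule vec_triple_eqI)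
      fix a b c :: nat assume abc: "a \<in> {1..6}" "b \<in> {1..6}" "c \<in> {1..6}" "a < b" "b < c"
      have "\<mu> k = ?\<nu> k + \<mu> 6" if "k \<in> {1..6}" for k
        using that by (cases "k = 6") auto
      thus "lin \<mu> $ triple a b c = lin (\<lambda>k. ?\<nu> k + \<mu> 6) $ triple a b c"
        using abc by (simp only: lin_triple)
    qed
    hence "t = tpt_proj (lin ?\<nu>)" unfolding t tpt_proj_eq_iff using lin_const[of "\<mu> 6"] by simp
    also have "\<dots> = (\<Sum>i\<in>{1..5}. (\<mu> i - \<mu> 6) *\<^sub>R unit_vec i)" unfolding sum_unit_vec ..
    also have "\<dots> \<in> span (unit_vec ` {1..5})" by (intro span_sum span_scale span_base) auto
    finally show "t \<in> span (unit_vec ` {1..5})" .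
  qed
qed

interpretation tpt_fan: cluster_fan "{1..5}" "tpt_proj ` lineality" "unit_vec ` {1..5}" "\<lambda>A. tpt_proj (ray A)"
  "\<lambda>a b d x. quartet_tmod a b d (mod_lineality x)"
proof (rule cluster_fan.intro)
  show "tpt_proj ` lineality = span (unit_vec ` {1..5})" by (rule span_unit_vec)
  show "independent (unit_vec ` {1..5})" by (rule independent_unit_vec)
  fix a b d :: nat assume *: "a \<in> {1..5}" "b \<in> {1..5}" "d \<in> {1..5}" "a \<noteq> b" "a \<noteq> d" "b \<noteq> d"
  show "linear (\<lambda>x. quartet_tmod a b d (mod_lineality x))"
    using linear_compose[OF linear_mod_lineality linear_quartet_tmod[OF *]] by (simp add: o_def)
  show "quartet_tmod a b d (mod_lineality n) = 0" if "n \<in> tpt_proj ` lineality" for n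
    using that quartet_eq(2)[OF *] by (auto simp: mod_lineality_tpt_proj quartet_tmod_proj[OF *] lineality_eq)
  show "quartet_tmod a b d (mod_lineality (tpt_proj (ray A))) = of_bool (a \<in> A \<and> b \<in> A) - of_bool (a \<in> A \<and> d \<in> A)"
    if "A \<in> clusters {1..5}" for A
    unfolding mod_lineality_tpt_proj quartet_tmod_proj[OF *] using quartet_ray[OF * that] .
qed auto

lemma support_tpt: "tpt_fan.support = trop_SGr"
proof -
  have eq: "tpt_proj (pairs_to_triples (tree_vec \<mu> c)) = tpt_fan.pt (tpt_proj (lin (\<lambda>i. 2 * \<mu> i))) c" for \<mu> c
    unfolding pairs_to_triples_tree_vec tpt_fan.pt_def tpt_proj_linear ..
  have "tpt_fan.support = {tpt_fan.pt n c | n c. n \<in> tpt_proj ` lineality \<and> tree_weights c}"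
    unfolding tpt_fan.support_eq tree_weights_def ..
  also have "\<dots> = {tpt_proj (pairs_to_triples (tree_vec \<mu> c)) | \<mu> c. tree_weights c}"
  proof (intro equalityI subsetI)
    fix t assume "t \<in> {tpt_fan.pt n c | n c. n \<in> tpt_proj ` lineality \<and> tree_weights c}"
    then obtain \<nu> c where "t = tpt_fan.pt (tpt_proj (lin \<nu>)) c" "tree_weights c" unfolding lineality_eq by blast
    \<comment> \<open>The map doubles lineality vectors, hence the halves.\<close>
    hence "t = tpt_proj (pairs_to_triples (tree_vec (\<lambda>i. \<nu> i / 2) c))" "tree_weights c" unfolding eq by simp_all
    thus "t \<in> {tpt_proj (pairs_to_triples (tree_vec \<mu> c)) | \<mu> c. tree_weights c}" by blast
  next
    fix t assume "t \<in> {tpt_proj (pairs_to_triples (tree_vec \<mu> c)) | \<mu> c. tree_weights c}"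
    thus "t \<in> {tpt_fan.pt n c | n c. n \<in> tpt_proj ` lineality \<and> tree_weights c}"
      unfolding eq lineality_eq by blast
  qed
  also have "\<dots> = trop_SGr" unfolding trop_SGr_36 four_point_iff by blast
  finally show ?thesis .
qed

lemma support_tmod: "tmod_fan.support = trop_S"
proof -
  have eq: "tmod_proj (pairs_to_triples (tree_vec \<mu> c)) = tmod_fan.pt 0 c" for \<mu> c
  proof -
    have "tmod_proj (lin (\<lambda>i. 2 * \<mu> i)) = (tmod_proj 0 :: (3, 6) tmod)"
      unfolding tmod_proj_eq_iff lineality_eq by simp
    thus ?thesis
      unfolding pairs_to_triples_tree_vec tmod_fan.pt_def tmod_proj_linear
      by (simp add: linear_0[OF linear_tmod_proj])
  qed
  have "tmod_fan.support = {tmod_fan.pt n c | n c. n \<in> {0} \<and> tree_weights c}"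
    unfolding tmod_fan.support_eq tree_weights_def ..
  also have "\<dots> = {tmod_proj (pairs_to_triples (tree_vec \<mu> c)) | \<mu> c. tree_weights c}"
    unfolding eq by blast
  also have "\<dots> = trop_S" unfolding trop_S_36 four_point_iff by blast
  finally show ?thesis .
qed

section \<open>The lattice and the balancing condition\<close>

lemma int_lattice_mem: "(\<And>I. w $ I \<in> \<int>) \<Longrightarrow> tpt_proj w \<in> int_lattice"
  unfolding int_lattice_def by blast

lemma ex_family_3: "\<exists>s\<in>families {1..5 :: nat}. card s = 3"
proof -
  have "card {s \<in> families {1..5 :: nat}. card s = 3} = 105"
    unfolding card_families_5 using family_lists_counts by simp
  hence "{s \<in> families {1..5 :: nat}. card s = 3} \<noteq> {}" by (metis card.empty zero_neq_numeral)
  thus ?thesis by blast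
qed

text \<open>The identity of pair counts is an identity between sums of \<open>delta\<close>, and the
  linear map carries it to the rays. The whole set contributes a lineality vector, the clusters of
  \<open>t\<close> their own rays.\<close>

lemma ray_link:
  assumes t: "t \<in> families {1..5}" "card t + 1 = 3"
  shows "(\<Sum>A | A \<notin> t \<and> insert A t \<in> families {1..5}. tpt_proj (ray A)) \<in>
    span (unit_vec ` {1..5} \<union> (\<lambda>A. tpt_proj (ray A)) ` t)"
proof -
  let ?E = "{A. A \<notin> t \<and> insert A t \<in> families {1..5}}"
  obtain S where S: "S \<subseteq> insert {1..5} t"
    and eq: "\<And>i j. i \<in> {1..5} \<Longrightarrow> j \<in> {1..5} \<Longrightarrow> i \<noteq> j \<Longrightarrow>
      (\<Sum>A\<in>?E. of_bool (i \<in> A \<and> j \<in> A) :: real) = (\<Sum>A\<in>S. of_bool (i \<in> A \<and> j \<in> A))"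
    using link_family_5[OF t(1)] t(2) by auto
  have E: "A \<subseteq> {1..5}" if "A \<in> ?E" for A using that by (auto simp: families_def clusters_def)
  have S5: "A \<subseteq> {1..5}" if "A \<in> S" for A using that S t(1) by (auto simp: families_def clusters_def)
  have "(\<Sum>A\<in>?E. delta A) = (\<Sum>A\<in>S. delta A)"
  proof (rule vec_pair_eqI)
    fix i j :: nat assume ij: "i \<in> {1..6}" "j \<in> {1..6}" "i < j"
    have "(\<Sum>A\<in>?E. of_bool (i \<in> A \<and> j \<in> A) :: real) = (\<Sum>A\<in>S. of_bool (i \<in> A \<and> j \<in> A))"
    proof (cases "j = 6")
      case True
      have "(\<Sum>A\<in>?E. of_bool (i \<in> A \<and> j \<in> A) :: real) = 0" using E True by (intro sum.neutral) fastforce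
      moreover have "(\<Sum>A\<in>S. of_bool (i \<in> A \<and> j \<in> A) :: real) = 0" using S5 True by (intro sum.neutral) fastforce
      ultimately show ?thesis by simp
    next
      case False
      thus ?thesis using ij by (intro eq) auto
    qed
    thus "(\<Sum>A\<in>?E. delta A) $ pair i j = (\<Sum>A\<in>S. delta A) $ pair i j"
      using ij by (simp add: sum_component delta_pair)
  qed
  moreover have "(\<Sum>A\<in>F. tpt_proj (ray A)) = tpt_proj (pairs_to_triples (\<Sum>A\<in>F. delta A))" for F
    unfolding ray_def linear_sum[OF linear_pairs_to_triples] linear_sum[OF linear_tpt_proj] ..
  ultimately have "(\<Sum>A\<in>?E. tpt_proj (ray A)) = (\<Sum>A\<in>S. tpt_proj (ray A))" by (simp only:)
  also have "\<dots> \<in> span (unit_vec ` {1..5} \<union> (\<lambda>A. tpt_proj (ray A)) ` t)"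
  proof (rule span_sum)
    fix A assume "A \<in> S"
    show "tpt_proj (ray A) \<in> span (unit_vec ` {1..5} \<union> (\<lambda>A. tpt_proj (ray A)) ` t)"
    proof (cases "A = {1..5}")
      case True
      \<comment> \<open>Halves add up to 1 on pairs within \<open>{1..5}\<close> and cancel on pairs
        with 6.\<close>
      have "delta {1..5} = lin (\<lambda>i. if i = 6 then - 1 / 2 else 1 / 2)"
        by (rule vec_pair_eqI) (auto simp: delta_pair lin_pair)
      hence "ray A = lin (\<lambda>i. 2 * (if i = 6 then - 1 / 2 else 1 / 2))"
        unfolding ray_def True by (simp only: pairs_to_triples_lin)
      hence "tpt_proj (ray A) \<in> span (unit_vec ` {1..5})"
        unfolding span_unit_vec[symmetric] lineality_eq by blast
      thus ?thesis using span_mono[of "unit_vec ` {1..5}"] by blast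
    next
      case False
      hence "A \<in> t" using S \<open>A \<in> S\<close> by blast
      thus ?thesis by (intro span_base) auto
    qed
  qed
  finally show ?thesis .
qed

lemma balanced_tpt: "balanced int_lattice tpt_fan.cfan"
proof -
  obtain s0 where s0: "s0 \<in> families {1..5 :: nat}" "card s0 = 3" using ex_family_3 by blast
  show ?thesis
  proof (rule tpt_fan.balanced_cfan[OF _ _ _ _ _ card_family_5_le s0 maximal_family_5])
    show "unit_vec ` {1..5} \<subseteq> int_lattice"
      unfolding unit_vec_def by (auto intro!: int_lattice_mem Ints_sum simp: lin_def)
    show "tpt_proj (ray A) \<in> int_lattice" for A
      unfolding ray_def pairs_to_triples_def delta_def by (auto intro!: int_lattice_mem Ints_sum)
    show "- x \<in> int_lattice" if "x \<in> int_lattice" for x :: "(3, 6) ksub tpt"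
    proof -
      obtain w where w: "x = tpt_proj w" "\<forall>i. w $ i \<in> \<int>" using \<open>x \<in> int_lattice\<close> unfolding int_lattice_def by blast
      have "- x = tpt_proj (- w)" unfolding w(1) by (rule linear_neg[OF linear_tpt_proj, symmetric])
      thus ?thesis using w(2) by (auto intro: int_lattice_mem)
    qed
    show "x - of_int z *\<^sub>R y \<in> int_lattice" if xy: "x \<in> int_lattice" "y \<in> int_lattice" for x y :: "(3, 6) ksub tpt" and z
    proof -
      obtain v w where vw: "x = tpt_proj v" "\<forall>i. v $ i \<in> \<int>" "y = tpt_proj w" "\<forall>i. w $ i \<in> \<int>"
        using xy unfolding int_lattice_def by blast
      have "x - of_int z *\<^sub>R y = tpt_proj (v - of_int z *\<^sub>R w)"
        unfolding vw(1,3) by (simp add: linear_diff[OF linear_tpt_proj] tpt_proj_linear)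
      thus ?thesis using vw by (auto intro!: int_lattice_mem)
    qed
    \<comment> \<open>\<open>quartet\<close> is a signed sum of coordinates, hence integral on
      integer vectors.\<close>
    show "quartet_tmod a b d (mod_lineality x) \<in> \<int>"
      if *: "a \<in> {1..5}" "b \<in> {1..5}" "d \<in> {1..5}" "a \<noteq> b" "a \<noteq> d" "b \<noteq> d" and x: "x \<in> int_lattice"
      for a b d :: nat and x
    proof -
      obtain w where w: "x = tpt_proj w" "\<forall>i. w $ i \<in> \<int>" using x unfolding int_lattice_def by blast
      thus ?thesis unfolding w(1) mod_lineality_tpt_proj quartet_tmod_proj[OF *] quartet_def Let_def by auto
    qed
  qed (use ray_link in auto)
qed

lemma card_unit_vec: "card (unit_vec ` {1..5}) = 5"
  using card_image[OF inj_on_unit_vec] by simp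

theorem theorem6p5:
  shows "(trop_SGr :: (3, 6) ksub tpt set) = sd_tpt trop_Gr
    \<and> sd_tpt (trop_Gr :: (3, 6) ksub tpt set) = sd_tpt Dressian
    \<and> (\<exists>F. coarsest_fan_structure (trop_SGr :: (3, 6) ksub tpt set) F
          \<and> pure_dim 8 F \<and> balanced int_lattice F)
    \<and> linear pairs_to_triples_tpt \<and> inj pairs_to_triples_tpt
    \<and> pairs_to_triples_tpt ` trop_Gr = trop_SGr
    \<and> linear pairs_to_triples_tmod \<and> inj pairs_to_triples_tmod
    \<and> pairs_to_triples_tmod ` trop_R = trop_S
    \<and> (trop_S :: (3, 6) tmod set) = sd_tmod trop_R
    \<and> (\<exists>F K. coarsest_fan_structure (trop_S :: (3, 6) tmod set) F
          \<and> fan_dim F = 3 \<and> pointed F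
          \<and> fan_over K F \<and> complex_dim K = 2 \<and> f_vector K = [25, 105, 105])"
proof -
  obtain s0 where s0: "s0 \<in> families {1..5 :: nat}" "card s0 = 3" using ex_family_3 by blast
  have fan8: "\<exists>F. coarsest_fan_structure (trop_SGr :: (3, 6) ksub tpt set) F \<and> pure_dim 8 F \<and> balanced int_lattice F"
  proof (intro exI[of _ tpt_fan.cfan] conjI)
    show "coarsest_fan_structure trop_SGr tpt_fan.cfan"
      using tpt_fan.coarsest_cfan unfolding support_tpt .
    \<comment> \<open>Five lineality directions plus the three clusters of a maximal family.\<close>
    show "pure_dim 8 tpt_fan.cfan"
      using tpt_fan.pure_dim_cfan[OF maximal_family_5] by (simp add: card_unit_vec[simplified])
  qed (rule balanced_tpt)
  let ?K = "(`) (\<lambda>A. tmod_proj (ray A)) ` families {1..5}"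
  have fan3: "\<exists>F K. coarsest_fan_structure (trop_S :: (3, 6) tmod set) F \<and> fan_dim F = 3 \<and> pointed F \<and>
      fan_over K F \<and> complex_dim K = 2 \<and> f_vector K = [25, 105, 105]"
  proof (rule exI[of _ tmod_fan.cfan], rule exI[of _ ?K], intro conjI)
    show "coarsest_fan_structure trop_S tmod_fan.cfan"
      using tmod_fan.coarsest_cfan unfolding support_tmod .
    show "fan_dim tmod_fan.cfan = 3"
      using tmod_fan.fan_dim_cfan[OF card_family_5_le s0] by simp
    show "pointed tmod_fan.cfan" by (rule tmod_fan.pointed_cfan) (rule refl)
    show "fan_over ?K tmod_fan.cfan" by (rule tmod_fan.fan_over_cfan) (rule refl)
    show dim: "complex_dim ?K = 2"
      using tmod_fan.complex_dim_cfan[OF card_family_5_le s0] by simp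
    have "f_vector ?K = map (\<lambda>i. card {s \<in> families {1..5 :: nat}. card s = i + 1}) [0..<3]"
      unfolding f_vector_def dim tmod_fan.card_complex[OF refl] by simp
    also have "\<dots> = map (\<lambda>i. length (filter (\<lambda>l. length l = i) family_lists)) [1, 2, 3]"
      unfolding card_families_5 by (simp add: upt_rec numeral_2_eq_2 numeral_3_eq_3)
    also have "\<dots> = [25, 105, 105]" by (rule family_lists_counts)
    finally show "f_vector ?K = [25, 105, 105]" .
  qed
  have "pairs_to_triples_tpt ` trop_Gr = trop_SGr"
    unfolding trop_Gr_26 trop_SGr_36 image_image pairs_to_triples_tpt_proj ..
  moreover have "pairs_to_triples_tmod ` trop_R = trop_S"
    unfolding trop_R_26 trop_S_36 image_image pairs_to_triples_tmod_proj ..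
  moreover have "(trop_SGr :: (3, 6) ksub tpt set) = sd_tpt trop_Gr"
    unfolding trop_SGr_36 sd_trop_Gr_36 ..
  moreover have "sd_tpt (trop_Gr :: (3, 6) ksub tpt set) = sd_tpt Dressian"
    unfolding sd_trop_Gr_36 sd_Dressian_36 ..
  moreover have "(trop_S :: (3, 6) tmod set) = sd_tmod trop_R"
    unfolding trop_S_36 trop_R_36_sd ..
  ultimately show ?thesis
    using fan8 fan3 linear_pairs_to_triples_tpt inj_pairs_to_triples_tpt linear_pairs_to_triples_tmod
      inj_pairs_to_triples_tmod by blast
qed

end
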